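(* Let $G,T$ be finitely presentable groups. Suppose the cohomology ring of $G$ satisfies property (A), $\chi_{\le 2}(G)\le 2$, and $\dim H_2(G;\mathbb{F}_2)>0$. Then $\kappa(G\ast T)\ge 2\rho(\chi_{\le 2}(G))-2\chi_{\le 2}(G)$.
   Context: All (co)homology has coefficients in $\mathbb{F}_2$; the (co)homology of a group $G$ means that of a $K(G,1)$-space. Property (A): for every nonzero $\alpha\in H^1(G;\mathbb{F}_2)$ there exists $\beta\in H^1(G;\mathbb{F}_2)$ with $\alpha\cup\beta\neq0$ in $H^2(G;\mathbb{F}_2)$. $\chi_{\le 2}(G)=\dim H_2(G;\mathbb{F}_2)-\dim H_1(G;\mathbb{F}_2)+1$. For an integer $k\le2$, $\rho(k)=\left\lceil \frac{7+\sqrt{49-24k}}{2}\right\rceil$. The simplicial complexity $\kappa(H)$ of a finitely presentable group $H$ is the minimum number of $2$-simplices of a finite simplicial complex of dimension $2$ with fundamental group isomorphic to $H$. *)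

theory Defs
  imports Complex_Main "HOL-Algebra.Coset"
begin

text \<open>Letters of the free group on generators 0..n-1: (i, b), b = True meaning the inverse.\<close>

fun fg_cons :: "nat \<times> bool \<Rightarrow> (nat \<times> bool) list \<Rightarrow> (nat \<times> bool) list" where
  "fg_cons (i, b) [] = [(i, b)]"
| "fg_cons (i, b) ((j, c) # w) = (if j = i \<and> c \<noteq> b then w else (i, b) # (j, c) # w)"

fun fg_reduced :: "(nat \<times> bool) list \<Rightarrow> bool" where
  "fg_reduced [] = True"
| "fg_reduced [x] = True"
| "fg_reduced ((i, b) # (j, c) # w) = (\<not> (i = j \<and> b \<noteq> c) \<and> fg_reduced ((j, c) # w))"

definition free_group :: "nat \<Rightarrow> (nat \<times> bool) list monoid" where
  "free_group n = \<lparr> carrier = {w. fg_reduced w \<and> (\<forall>x\<in>set w. fst x < n)},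
                   mult = (\<lambda>u v. foldr fg_cons u v),
                   one = [] \<rparr>"

definition normal_closure :: "('a, 'b) monoid_scheme \<Rightarrow> 'a set \<Rightarrow> 'a set" where
  "normal_closure F R = {x \<in> carrier F. \<forall>N. N \<lhd> F \<and> R \<subseteq> N \<longrightarrow> x \<in> N}"

definition finitely_presentable :: "('a, 'b) monoid_scheme \<Rightarrow> bool" where
  "finitely_presentable G \<longleftrightarrow> group G \<and>
     (\<exists>n R. finite R \<and> R \<subseteq> carrier (free_group n) \<and>
        G \<cong> (free_group n Mod normal_closure (free_group n) R))"

fun fp_cons :: "('a, 'c) monoid_scheme \<Rightarrow> ('b, 'd) monoid_scheme \<Rightarrow> 'a + 'b \<Rightarrow> ('a + 'b) list \<Rightarrow> ('a + 'b) list" where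
  "fp_cons G T (Inl g) w =
     (if g = \<one>\<^bsub>G\<^esub> then w else
      (case w of
         Inl g' # w' \<Rightarrow> (if g \<otimes>\<^bsub>G\<^esub> g' = \<one>\<^bsub>G\<^esub> then w' else Inl (g \<otimes>\<^bsub>G\<^esub> g') # w')
       | _ \<Rightarrow> Inl g # w))"
| "fp_cons G T (Inr t) w =
     (if t = \<one>\<^bsub>T\<^esub> then w else
      (case w of
         Inr t' # w' \<Rightarrow> (if t \<otimes>\<^bsub>T\<^esub> t' = \<one>\<^bsub>T\<^esub> then w' else Inr (t \<otimes>\<^bsub>T\<^esub> t') # w')
       | _ \<Rightarrow> Inr t # w))"

fun fp_alternating :: "('a + 'b) list \<Rightarrow> bool" where
  "fp_alternating [] = True"
| "fp_alternating [x] = True"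
| "fp_alternating (x # y # w) = ((isl x \<longleftrightarrow> \<not> isl y) \<and> fp_alternating (y # w))"

definition free_product :: "('a, 'c) monoid_scheme \<Rightarrow> ('b, 'd) monoid_scheme \<Rightarrow> ('a + 'b) list monoid" where
  "free_product G T = \<lparr> carrier = {w. fp_alternating w \<and>
        (\<forall>x\<in>set w. case x of Inl g \<Rightarrow> g \<in> carrier G \<and> g \<noteq> \<one>\<^bsub>G\<^esub>
                             | Inr t \<Rightarrow> t \<in> carrier T \<and> t \<noteq> \<one>\<^bsub>T\<^esub>)},
      mult = (\<lambda>u v. foldr (fp_cons G T) u v),
      one = [] \<rparr>"

text \<open>A bar n-cell [g1|...|gn] is a list of length n of group elements. F_2-chains are
  finitely supported functions to bool (= F_2); addition is pointwise xor.\<close>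

definition bar_face :: "('a, 'b) monoid_scheme \<Rightarrow> nat \<Rightarrow> 'a list \<Rightarrow> 'a list" where
  "bar_face G i x =
     (if i = 0 then tl x
      else if i = length x then butlast x
      else take (i - 1) x @ [x ! (i - 1) \<otimes>\<^bsub>G\<^esub> x ! i] @ drop (i + 1) x)"

definition bar_chains :: "('a, 'b) monoid_scheme \<Rightarrow> nat \<Rightarrow> ('a list \<Rightarrow> bool) set" where
  "bar_chains G n = {c. finite {x. c x} \<and> (\<forall>x. c x \<longrightarrow> length x = n \<and> set x \<subseteq> carrier G)}"

definition bar_boundary :: "('a, 'b) monoid_scheme \<Rightarrow> ('a list \<Rightarrow> bool) \<Rightarrow> ('a list \<Rightarrow> bool)" where
  "bar_boundary G c y = odd (card {(x, i). c x \<and> i \<le> length x \<and> bar_face G i x = y})"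

definition cycles :: "('a, 'b) monoid_scheme \<Rightarrow> nat \<Rightarrow> ('a list \<Rightarrow> bool) set" where
  "cycles G n = {c \<in> bar_chains G n. bar_boundary G c = (\<lambda>_. False)}"

definition boundaries :: "('a, 'b) monoid_scheme \<Rightarrow> nat \<Rightarrow> ('a list \<Rightarrow> bool) set" where
  "boundaries G n = bar_boundary G ` bar_chains G (Suc n)"

definition f2_sum :: "('x \<Rightarrow> bool) set \<Rightarrow> ('x \<Rightarrow> bool)" where
  "f2_sum S y = odd (card {c \<in> S. c y})"

text \<open>Dimension over F_2 of the quotient Z/B: largest size of a finite subset of Z that is
  linearly independent modulo B (over F_2 linear combinations are subset sums).\<close>
definition f2_quotient_dim :: "('x \<Rightarrow> bool) set \<Rightarrow> ('x \<Rightarrow> bool) set \<Rightarrow> nat" where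
  "f2_quotient_dim Z B = (GREATEST k. \<exists>S. S \<subseteq> Z \<and> finite S \<and> card S = k \<and>
       (\<forall>U. U \<subseteq> S \<and> U \<noteq> {} \<longrightarrow> f2_sum U \<notin> B))"

definition homology_dim :: "('a, 'b) monoid_scheme \<Rightarrow> nat \<Rightarrow> nat" where
  "homology_dim G n = f2_quotient_dim (cycles G n) (boundaries G n)"

definition chi2 :: "('a, 'b) monoid_scheme \<Rightarrow> int" where
  "chi2 G = int (homology_dim G 2) - int (homology_dim G 1) + 1"

definition bar_cochains :: "('a, 'b) monoid_scheme \<Rightarrow> nat \<Rightarrow> ('a list \<Rightarrow> bool) set" where
  "bar_cochains G n = {f. \<forall>x. f x \<longrightarrow> length x = n \<and> set x \<subseteq> carrier G}"

definition bar_coboundary :: "('a, 'b) monoid_scheme \<Rightarrow> nat \<Rightarrow> ('a list \<Rightarrow> bool) \<Rightarrow> ('a list \<Rightarrow> bool)" where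
  "bar_coboundary G n f x =
     (length x = Suc n \<and> set x \<subseteq> carrier G \<and> odd (card {i. i \<le> Suc n \<and> f (bar_face G i x)}))"

definition cocycles :: "('a, 'b) monoid_scheme \<Rightarrow> nat \<Rightarrow> ('a list \<Rightarrow> bool) set" where
  "cocycles G n = {f \<in> bar_cochains G n. bar_coboundary G n f = (\<lambda>_. False)}"

definition coboundaries :: "('a, 'b) monoid_scheme \<Rightarrow> nat \<Rightarrow> ('a list \<Rightarrow> bool) set" where
  "coboundaries G n = (if n = 0 then {\<lambda>_. False}
                       else bar_coboundary G (n - 1) ` bar_cochains G (n - 1))"

definition cup11 :: "('a, 'b) monoid_scheme \<Rightarrow> ('a list \<Rightarrow> bool) \<Rightarrow> ('a list \<Rightarrow> bool) \<Rightarrow> ('a list \<Rightarrow> bool)" where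
  "cup11 G a b x = (length x = 2 \<and> set x \<subseteq> carrier G \<and> a [x ! 0] \<and> b [x ! 1])"

definition property_A :: "('a, 'b) monoid_scheme \<Rightarrow> bool" where
  "property_A G \<longleftrightarrow> (\<forall>a \<in> cocycles G 1. a \<notin> coboundaries G 1 \<longrightarrow>
       (\<exists>b \<in> cocycles G 1. cup11 G a b \<notin> coboundaries G 2))"

definition rho :: "int \<Rightarrow> int" where
  "rho k = \<lceil>(7 + sqrt (49 - 24 * real_of_int k)) / 2\<rceil>"

definition simplicial_complex :: "nat set set \<Rightarrow> bool" where
  "simplicial_complex K \<longleftrightarrow> finite K \<and> (\<forall>s\<in>K. finite s \<and> s \<noteq> {}) \<and>
     (\<forall>s\<in>K. \<forall>t. t \<subseteq> s \<and> t \<noteq> {} \<longrightarrow> t \<in> K)"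

definition dimension_two :: "nat set set \<Rightarrow> bool" where
  "dimension_two K \<longleftrightarrow> (\<forall>s\<in>K. card s \<le> 3) \<and> (\<exists>s\<in>K. card s = 3)"

definition edge_path :: "nat set set \<Rightarrow> nat list \<Rightarrow> bool" where
  "edge_path K p \<longleftrightarrow> p \<noteq> [] \<and> (\<forall>v\<in>set p. {v} \<in> K) \<and>
     (\<forall>i. Suc i < length p \<longrightarrow> {p ! i, p ! Suc i} \<in> K)"

definition edge_step :: "nat set set \<Rightarrow> nat list \<Rightarrow> nat list \<Rightarrow> bool" where
  "edge_step K p q \<longleftrightarrow>
     (\<exists>xs u v w ys. p = xs @ [u, v, w] @ ys \<and> q = xs @ [u, w] @ ys \<and> {u, v, w} \<in> K) \<or>
     (\<exists>xs u ys. p = xs @ [u, u] @ ys \<and> q = xs @ [u] @ ys)"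

definition edge_loops :: "nat set set \<Rightarrow> nat \<Rightarrow> nat list set" where
  "edge_loops K v0 = {p. edge_path K p \<and> hd p = v0 \<and> last p = v0}"

definition edge_equiv :: "nat set set \<Rightarrow> nat \<Rightarrow> (nat list \<times> nat list) set" where
  "edge_equiv K v0 =
     ({(p, q). p \<in> edge_loops K v0 \<and> q \<in> edge_loops K v0 \<and> (edge_step K p q \<or> edge_step K q p)})\<^sup>*
     \<inter> (edge_loops K v0 \<times> edge_loops K v0)"

text \<open>Edge-path group (= fundamental group of the realization) at base vertex v0.\<close>
definition edge_path_group :: "nat set set \<Rightarrow> nat \<Rightarrow> nat list set monoid" where
  "edge_path_group K v0 = \<lparr> carrier = edge_loops K v0 // edge_equiv K v0,
      mult = (\<lambda>X Y. edge_equiv K v0 `` {(SOME x. x \<in> X) @ tl (SOME y. y \<in> Y)}),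
      one = edge_equiv K v0 `` {[v0]} \<rparr>"

definition simplicial_complexity :: "('a, 'b) monoid_scheme \<Rightarrow> nat" where
  "simplicial_complexity H = (LEAST n. \<exists>K v0. simplicial_complex K \<and> dimension_two K \<and>
       {v0} \<in> K \<and> card {s \<in> K. card s = 3} = n \<and> edge_path_group K v0 \<cong> H)"

end

theory Submission
  imports Defs "HOL-Library.Countable"
begin

text \<open>
  Let \<open>K\<close> have fundamental group \<open>G * T\<close>. Since \<open>G\<close> is a retract of \<open>G * T\<close>, the edges of \<open>K\<close> carry
  labels in \<open>G\<close>, which send simplicial chains of \<open>K\<close> to bar chains of \<open>G\<close>. A 2-cocycle of \<open>G\<close> that
  vanishes on all 2-cycles of \<open>K\<close> is a coboundary. Choose a minimal set \<open>L\<close> of triangles whose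
  2-cycles still detect \<open>H\<^sup>2(G)\<close> in this sense. By minimality every edge of \<open>L\<close> lies in two triangles
  and \<open>dim Z\<^sub>2(L) \<le> dim H\<^sub>2(G)\<close>; by property (A) the restriction \<open>H\<^sup>1(G) \<rightarrow> H\<^sup>1(L)\<close> is injective. With
  \<open>n = r + 1\<close>, where \<open>r\<close> is the rank of the 1-skeleton of \<open>L\<close> (so components count as if they were
  wedged together), this gives \<open>n - s\<^sub>1 + s\<^sub>2 \<le> \<chi>\<close>, \<open>2 s\<^sub>1 \<le> 3 s\<^sub>2\<close> and \<open>2 s\<^sub>1 \<le> n (n - 1)\<close>, from which
  \<open>n \<ge> \<rho>(\<chi>)\<close> follows as in Heawood's inequality, and \<open>s\<^sub>2 \<ge> 2 n - 2 \<chi>\<close>.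

  The complexity is a \<open>LEAST\<close>, which says nothing unless some complex with group \<open>G * T\<close> exists;
  a triangulated presentation complex is one.
\<close>

section \<open>The edge-path group\<close>

text \<open>\<open>L\<close> need not be connected and nothing is known about its fundamental group,
  so only its mod 2 cochains are used. Write b1, b2 for the Betti numbers of \<open>G\<close>.
  Injectivity on first cohomology comes from cup products: if a 1-cocycle \<alpha> of
  \<open>G\<close> becomes on \<open>L\<close> the coboundary of a vertex function u, then \<alpha>
  cup \<beta> becomes there the coboundary of u cup \<beta>, vanishes on all 2-cycles of
  \<open>L\<close>, and so is a coboundary of \<open>G\<close> for every \<beta>, against property
  (A). Subspaces enter only through their cardinalities: b1 + r is at most the dimension of the
  1-cocycles of \<open>L\<close>, a double count of the incidence of edges and triangles turns this
  into s1 - s2 + dim Z_2(\<open>L\<close>), and dim Z_2(\<open>L\<close>) is at most b2. Since b1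
  and b2 are defined by independent cycles while detection and property (A) speak of cocycles,
  independent cycles have to be traded for dual cocycles. These live on an infinite bar complex,
  whence the use of Zorn's lemma. Both Betti numbers are also given by \<open>GREATEST\<close>, so
  bounds on independent sets are needed before they mean anything; they come from the edges and
  triangles of a complex with group \<open>G * T\<close>.\<close>

definition hpt :: "nat set set \<Rightarrow> nat list \<Rightarrow> nat list \<Rightarrow> bool" where
  "hpt K = (\<lambda>p q. edge_step K p q \<or> edge_step K q p)\<^sup>*\<^sup>*"

lemma edge_path_successively:
  "edge_path K p \<longleftrightarrow> p \<noteq> [] \<and> (\<forall>v\<in>set p. {v} \<in> K) \<and> successively (\<lambda>u v. {u, v} \<in> K) p"
  unfolding edge_path_def successively_conv_nth by (auto simp: Suc_less_eq)

lemma edge_path_single [simp]: "edge_path K [v] \<longleftrightarrow> {v} \<in> K"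
  by (simp add: edge_path_successively)

lemma edge_path_Cons [simp]:
  "edge_path K (u # v # p) \<longleftrightarrow> {u} \<in> K \<and> {u, v} \<in> K \<and> edge_path K (v # p)"
  by (auto simp: edge_path_successively)

lemma edge_path_append:
  assumes "p \<noteq> []" "q \<noteq> []"
  shows "edge_path K (p @ q) \<longleftrightarrow> edge_path K p \<and> edge_path K q \<and> {last p, hd q} \<in> K"
  using assms by (auto simp: edge_path_successively successively_append_iff)

lemma edge_path_rev: "edge_path K p \<Longrightarrow> edge_path K (rev p)"
  by (simp add: edge_path_successively successively_rev insert_commute)

lemma edge_path_glue:
  assumes "edge_path K p" "edge_path K q" "last p = hd q"
  shows "edge_path K (p @ tl q)"
proof (cases "tl q = []")
  case False
  then obtain a b r where q: "q = a # b # r" by (cases q; cases "tl q") auto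
  from assms have "p \<noteq> []" by (auto simp: edge_path_def)
  with q assms show ?thesis by (simp add: edge_path_append)
qed (use assms in simp)

lemma last_glue: "last p = hd q \<Longrightarrow> q \<noteq> [] \<Longrightarrow> p \<noteq> [] \<Longrightarrow> last (p @ tl q) = last q"
  by (cases q) auto

lemma hpt_refl [simp]: "hpt K p p" by (simp add: hpt_def)

lemma hpt_sym: "hpt K p q \<Longrightarrow> hpt K q p"
  unfolding hpt_def
proof (induction rule: rtranclp_induct)
  case (step y z)
  then have "edge_step K z y \<or> edge_step K y z" by blast
  then show ?case using step.IH by (rule converse_rtranclp_into_rtranclp)
qed simp

lemma hpt_trans [trans]: "hpt K p q \<Longrightarrow> hpt K q r \<Longrightarrow> hpt K p r"
  unfolding hpt_def by simp

lemma hpt_triangle: "{u, v, w} \<in> K \<Longrightarrow> hpt K (xs @ u # v # w # ys) (xs @ u # w # ys)"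
  unfolding hpt_def edge_step_def
  by (rule r_into_rtranclp, rule disjI1, rule disjI1, intro exI[of _ xs] exI[of _ u] exI[of _ v] exI[of _ w] exI[of _ ys]) simp

lemma hpt_stutter: "hpt K (xs @ u # u # ys) (xs @ u # ys)"
  unfolding hpt_def edge_step_def
  by (rule r_into_rtranclp, rule disjI1, rule disjI2, intro exI[of _ xs] exI[of _ u] exI[of _ ys]) simp

lemma edge_step_context: "edge_step K p q \<Longrightarrow> edge_step K (a @ p @ b) (a @ q @ b)"
  unfolding edge_step_def
proof (elim disjE exE conjE, goal_cases)
  case (1 xs u v w ys)
  show ?case
    by (rule disjI1, rule exI[of _ "a @ xs"], intro exI[of _ u] exI[of _ v] exI[of _ w] exI[of _ "ys @ b"])
       (simp add: 1)
next
  case (2 xs u ys)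
  show ?case
    by (rule disjI2, rule exI[of _ "a @ xs"], intro exI[of _ u] exI[of _ "ys @ b"]) (simp add: 2)
qed

lemma hpt_context: "hpt K p q \<Longrightarrow> hpt K (a @ p @ b) (a @ q @ b)"
  unfolding hpt_def
proof (induction rule: rtranclp_induct)
  case (step y z)
  then have "edge_step K (a @ y @ b) (a @ z @ b) \<or> edge_step K (a @ z @ b) (a @ y @ b)"
    using edge_step_context by blast
  with step.IH show ?case by (rule rtranclp.rtrancl_into_rtrancl)
qed simp

lemma edge_step_hd_last:
  assumes "edge_step K p q"
  shows "hd p = hd q \<and> last p = last q \<and> p \<noteq> [] \<and> q \<noteq> []"
proof -
  have "hd (xs @ u # ys) = hd (xs @ u # zs)" for xs ys zs :: "nat list" and u
    by (cases xs) auto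
  then show ?thesis using assms unfolding edge_step_def by (auto simp: last_append)
qed

lemma hpt_nonempty: "hpt K p q \<Longrightarrow> p \<noteq> [] \<longleftrightarrow> q \<noteq> []"
  unfolding hpt_def by (induction rule: rtranclp_induct) (auto dest: edge_step_hd_last)

lemma hpt_hd: "hpt K p q \<Longrightarrow> hd p = hd q"
  unfolding hpt_def by (induction rule: rtranclp_induct) (auto dest: edge_step_hd_last)

lemma hpt_last: "hpt K p q \<Longrightarrow> last p = last q"
  unfolding hpt_def by (induction rule: rtranclp_induct) (auto dest: edge_step_hd_last)

lemma simplicial_complex_subset:
  "simplicial_complex K \<Longrightarrow> s \<in> K \<Longrightarrow> t \<subseteq> s \<Longrightarrow> t \<noteq> {} \<Longrightarrow> t \<in> K"
  unfolding simplicial_complex_def by blast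

lemma edge_step_edge_path:
  assumes K: "simplicial_complex K" and "edge_step K p q"
  shows "edge_path K p \<longleftrightarrow> edge_path K q"
  using assms(2) unfolding edge_step_def
proof (elim disjE exE conjE, goal_cases)
  case (1 xs u v w ys)
  have "{u, v} \<in> K" "{v, w} \<in> K" "{u, w} \<in> K" "{u} \<in> K" "{v} \<in> K" "{w} \<in> K"
    by (rule simplicial_complex_subset[OF K \<open>{u, v, w} \<in> K\<close>]; auto)+
  then show ?case unfolding 1 edge_path_successively
    by (auto simp: successively_append_iff)
next
  case (2 xs u ys)
  then show ?case unfolding 2 edge_path_successively
    by (auto simp: successively_append_iff)
qed

lemma hpt_edge_path:
  assumes K: "simplicial_complex K" and "hpt K p q"
  shows "edge_path K p \<longleftrightarrow> edge_path K q"
  using assms(2) unfolding hpt_def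
  by (induction rule: rtranclp_induct) (auto dest: edge_step_edge_path[OF K])

lemma hpt_loops:
  assumes K: "simplicial_complex K" and h: "hpt K p q"
  shows "p \<in> edge_loops K v \<longleftrightarrow> q \<in> edge_loops K v"
  using hpt_edge_path[OF K h] hpt_hd[OF h] hpt_last[OF h] by (auto simp: edge_loops_def)

text \<open>A move keeps the end points and, in either direction, the property of being an edge
  path, so a chain of moves that starts at a loop never leaves the loops. The unrestricted relation
  \<open>hpt\<close> is the convenient one because it is stable under
  \<open>hpt_context\<close>.\<close>

lemma edge_equiv_hpt:
  assumes K: "simplicial_complex K" and p: "p \<in> edge_loops K v"
  shows "(p, q) \<in> edge_equiv K v \<longleftrightarrow> hpt K p q"
proof
  assume "(p, q) \<in> edge_equiv K v"
  then have "(p, q) \<in> {(p, q). p \<in> edge_loops K v \<and> q \<in> edge_loops K v \<and> (edge_step K p q \<or> edge_step K q p)}\<^sup>*"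
    by (simp add: edge_equiv_def)
  then show "hpt K p q" unfolding hpt_def
  proof (induction rule: rtrancl_induct)
    case (step y z)
    then have "edge_step K y z \<or> edge_step K z y" by blast
    with step.IH show ?case by (rule rtranclp.rtrancl_into_rtrancl)
  qed simp
next
  assume "hpt K p q"
  then have "(p, q) \<in> {(p, q). p \<in> edge_loops K v \<and> q \<in> edge_loops K v \<and> (edge_step K p q \<or> edge_step K q p)}\<^sup>*
     \<and> q \<in> edge_loops K v" unfolding hpt_def
  proof (induction rule: rtranclp_induct)
    case (step y z)
    then have "hpt K y z" by (auto simp: hpt_def)
    then have "z \<in> edge_loops K v" using hpt_loops[OF K] step by blast
    with step have "(y, z) \<in> {(p, q). p \<in> edge_loops K v \<and> q \<in> edge_loops K v \<and> (edge_step K p q \<or> edge_step K q p)}"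
      by blast
    with step.IH \<open>z \<in> edge_loops K v\<close> show ?case
      by (blast intro: rtrancl_into_rtrancl)
  qed (use p in simp)
  with p show "(p, q) \<in> edge_equiv K v" by (simp add: edge_equiv_def)
qed

definition cls :: "nat set set \<Rightarrow> nat list \<Rightarrow> nat list set" where
  "cls K p = {q. hpt K p q}"

lemma cls_eq_iff: "cls K p = cls K q \<longleftrightarrow> hpt K p q"
proof
  assume "cls K p = cls K q"
  then have "q \<in> cls K p" by (simp add: cls_def)
  then show "hpt K p q" by (simp add: cls_def)
next
  assume "hpt K p q"
  then have "hpt K p r \<longleftrightarrow> hpt K q r" for r by (meson hpt_sym hpt_trans)
  then show "cls K p = cls K q" by (simp add: cls_def)
qed

lemma edge_equiv_cls:
  assumes "simplicial_complex K" "p \<in> edge_loops K v"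
  shows "edge_equiv K v `` {p} = cls K p"
  using edge_equiv_hpt[OF assms] by (auto simp: cls_def)

lemma carrier_edge_path_group:
  assumes "simplicial_complex K"
  shows "carrier (edge_path_group K v) = cls K ` edge_loops K v"
  using edge_equiv_cls[OF assms] by (auto simp: edge_path_group_def quotient_def)

lemma edge_loops_glue:
  "p \<in> edge_loops K v \<Longrightarrow> q \<in> edge_loops K v \<Longrightarrow> p @ tl q \<in> edge_loops K v"
  using edge_path_glue[of K p q] last_glue[of p q] by (auto simp: edge_loops_def edge_path_def)

lemma hpt_glue:
  assumes "hpt K p p'" "hpt K q q'" "last p = hd q" "p \<noteq> []" "q \<noteq> []"
  shows "hpt K (p @ tl q) (p' @ tl q')"
proof -
  \<comment> \<open>The shared vertex may be credited to either factor; this form displays the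
    second factor whole, so that \<open>hpt_context\<close> applies to it as well.\<close>
  have *: "a @ tl b = butlast a @ b" if "last a = hd b" "a \<noteq> []" "b \<noteq> []" for a b :: "nat list"
    using that by (cases b; cases a rule: rev_cases) auto
  have p': "last p' = hd q" "p' \<noteq> []"
    using assms hpt_last[OF assms(1)] hpt_nonempty[OF assms(1)] by auto
  have q': "hd q' = hd q" "q' \<noteq> []"
    using assms hpt_hd[OF assms(2)] hpt_nonempty[OF assms(2)] by auto
  have "hpt K (p @ tl q) (p' @ tl q)"
    using hpt_context[OF assms(1), of "[]" "tl q"] by simp
  also have "p' @ tl q = butlast p' @ q"
    using *[of p' q] p' assms(5) by simp
  also have "hpt K \<dots> (butlast p' @ q')"
    using hpt_context[OF assms(2), of "butlast p'" "[]"] by simp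
  also have "butlast p' @ q' = p' @ tl q'"
    using *[of p' q'] p' q' by simp
  finally show ?thesis .
qed

lemma mult_edge_path_group:
  assumes K: "simplicial_complex K" and p: "p \<in> edge_loops K v" and q: "q \<in> edge_loops K v"
  shows "cls K p \<otimes>\<^bsub>edge_path_group K v\<^esub> cls K q = cls K (p @ tl q)"
proof -
  define x where "x = (SOME x. x \<in> cls K p)"
  define y where "y = (SOME y. y \<in> cls K q)"
  have "x \<in> cls K p" unfolding x_def by (rule someI[of _ p]) (simp add: cls_def)
  then have x: "hpt K p x" by (simp add: cls_def)
  have "y \<in> cls K q" unfolding y_def by (rule someI[of _ q]) (simp add: cls_def)
  then have y: "hpt K q y" by (simp add: cls_def)
  have l: "x \<in> edge_loops K v" "y \<in> edge_loops K v"
    using hpt_loops[OF K x] hpt_loops[OF K y] p q by auto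
  have "cls K p \<otimes>\<^bsub>edge_path_group K v\<^esub> cls K q = edge_equiv K v `` {x @ tl y}"
    by (simp add: edge_path_group_def x_def y_def)
  also have "\<dots> = cls K (x @ tl y)"
    by (rule edge_equiv_cls[OF K edge_loops_glue[OF l]])
  also have "\<dots> = cls K (p @ tl q)"
    using p q hpt_glue[OF x y] by (auto simp: cls_eq_iff edge_loops_def edge_path_def intro: hpt_sym)
  finally show ?thesis .
qed

lemma one_edge_path_group:
  assumes K: "simplicial_complex K" and "{v} \<in> K"
  shows "\<one>\<^bsub>edge_path_group K v\<^esub> = cls K [v]"
  using edge_equiv_cls[OF K, of "[v]" v] assms(2)
  by (simp add: edge_path_group_def edge_loops_def)

lemma hpt_rev_cancel:
  assumes "edge_path K p"
  shows "hpt K (p @ tl (rev p)) [hd p]"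
  using assms
proof (induction p rule: induct_list012)
  case (3 u v p)
  \<comment> \<open>As a set this is the edge \<open>{u, v}\<close>: the backtracking u v u is a
    triangle move across a degenerate triangle.\<close>
  have K: "{u, v, u} \<in> K" using 3 by (simp add: insert_commute)
  have ne: "rev (v # p) \<noteq> []" by simp
  have "(u # v # p) @ tl (rev (u # v # p)) = [u] @ ((v # p) @ tl (rev (v # p))) @ [u]"
    using ne by (simp del: rev.simps add: tl_append2 rev.simps(2)[of u])
  also have "hpt K \<dots> ([u] @ [v] @ [u])"
    by (rule hpt_context) (use 3 in simp)
  also have "hpt K \<dots> ([] @ [u,u] @ [])" using hpt_triangle[OF K, of "[]" "[]"] by simp
  also have "hpt K \<dots> [u]" using hpt_stutter[of K "[]" u "[]"] by simp
  finally show ?case by simp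
qed (auto simp: edge_path_def)

lemma edge_loops_rev: "p \<in> edge_loops K v \<Longrightarrow> rev p \<in> edge_loops K v"
  by (auto simp: edge_loops_def edge_path_rev hd_rev last_rev)

lemma group_edge_path_group:
  assumes K: "simplicial_complex K" and v: "{v} \<in> K"
  shows "group (edge_path_group K v)"
proof (rule groupI, goal_cases)
  case (1 x y)
  then show ?case
    by (auto simp: carrier_edge_path_group[OF K] mult_edge_path_group[OF K] edge_loops_glue)
next
  case 2
  then show ?case using v
    by (auto simp: carrier_edge_path_group[OF K] one_edge_path_group[OF K] edge_loops_def)
next
  case (3 x y z)
  have "p @ tl (q @ tl r) = (p @ tl q) @ tl r" if "q \<in> edge_loops K v" for p q r
    using that by (cases q) (auto simp: edge_loops_def edge_path_def)
  with 3 show ?case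
    by (auto simp: carrier_edge_path_group[OF K] mult_edge_path_group[OF K] edge_loops_glue)
next
  case (4 x)
  then obtain p where p: "p \<in> edge_loops K v" "x = cls K p"
    by (auto simp: carrier_edge_path_group[OF K])
  moreover have "[v] \<in> edge_loops K v" using v by (simp add: edge_loops_def)
  moreover have "[v] @ tl p = p" using p by (cases p) (auto simp: edge_loops_def edge_path_def)
  ultimately show ?case
    by (simp only: one_edge_path_group[OF K v] mult_edge_path_group[OF K])
next
  case (5 x)
  then obtain p where p: "p \<in> edge_loops K v" "x = cls K p"
    by (auto simp: carrier_edge_path_group[OF K])
  have "hpt K (rev p @ tl p) [v]"
    using hpt_rev_cancel[of K "rev p"] edge_loops_rev[OF p(1)] by (auto simp: edge_loops_def)
  then have "cls K (rev p) \<otimes>\<^bsub>edge_path_group K v\<^esub> x = \<one>\<^bsub>edge_path_group K v\<^esub>"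
    using p edge_loops_rev[OF p(1)]
    by (simp add: mult_edge_path_group[OF K] one_edge_path_group[OF K v] cls_eq_iff)
  then show ?case using edge_loops_rev[OF p(1)]
    by (auto simp: carrier_edge_path_group[OF K])
qed

section \<open>Labelings of a complex by group elements\<close>

text \<open>For a group \<open>Q\<close> these are the homomorphisms from the edge-path groupoid to
  \<open>Q\<close>, or flat connections. The triples may be degenerate, which forces trivial labels
  at vertices and inverse labels on reversed edges.\<close>

definition labeling :: "nat set set \<Rightarrow> ('q, 'e) monoid_scheme \<Rightarrow> (nat \<Rightarrow> nat \<Rightarrow> 'q) \<Rightarrow> bool" where
  "labeling K Q l \<longleftrightarrow> (\<forall>u v. {u, v} \<in> K \<longrightarrow> l u v \<in> carrier Q) \<and>
     (\<forall>u v w. {u, v, w} \<in> K \<longrightarrow> l u v \<otimes>\<^bsub>Q\<^esub> l v w = l u w)"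

fun path_label :: "('q, 'e) monoid_scheme \<Rightarrow> (nat \<Rightarrow> nat \<Rightarrow> 'q) \<Rightarrow> nat list \<Rightarrow> 'q" where
  "path_label Q l (u # v # p) = l u v \<otimes>\<^bsub>Q\<^esub> path_label Q l (v # p)"
| "path_label Q l _ = \<one>\<^bsub>Q\<^esub>"

locale labeled_complex = group Q for Q (structure) +
  fixes K :: "nat set set" and l :: "nat \<Rightarrow> nat \<Rightarrow> 'a"
  assumes complex: "simplicial_complex K" and labeling: "labeling K Q l"
begin

lemma label_closed [simp]: "{u, v} \<in> K \<Longrightarrow> l u v \<in> carrier Q"
  using labeling by (auto simp: labeling_def)

lemma label_mult: "{u, v, w} \<in> K \<Longrightarrow> l u v \<otimes> l v w = l u w"
  using labeling by (auto simp: labeling_def)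

lemma label_refl [simp]: "{u} \<in> K \<Longrightarrow> l u u = \<one>"
  using label_mult[of u u u] label_closed[of u u] by (simp add: r_cancel_one')

lemma vertex_of_edge: "{u, v} \<in> K \<Longrightarrow> {u} \<in> K" "{u, v} \<in> K \<Longrightarrow> {v} \<in> K"
  by (auto intro: simplicial_complex_subset[OF complex])

lemma label_sym: "{u, v} \<in> K \<Longrightarrow> l v u = inv (l u v)"
  using label_mult[of u v u] vertex_of_edge[of u v]
  by (intro inv_equality[symmetric]) (auto simp: insert_commute label_mult)

lemma path_label_closed [simp]: "edge_path K p \<Longrightarrow> path_label Q l p \<in> carrier Q"
  by (induction p rule: induct_list012) auto

lemma path_label_append:
  assumes "edge_path K (xs @ u # ys)"
  shows "path_label Q l (xs @ u # ys) = path_label Q l (xs @ [u]) \<otimes> path_label Q l (u # ys)"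
  using assms
proof (induction xs rule: induct_list012)
  case 1
  then show ?case by simp
next
  case (2 x)
  then have "l x u \<in> carrier Q" "path_label Q l (u # ys) \<in> carrier Q" by auto
  then show ?case by simp
next
  case (3 x y xs)
  then have "edge_path K (y # xs @ u # ys)" by simp
  moreover from this have "edge_path K (u # ys)" and "edge_path K (y # xs @ [u])"
    using edge_path_append[of "y # xs" "u # ys" K] edge_path_append[of "y # xs" "[u]" K]
    by (auto simp: edge_path_def)
  ultimately show ?case using 3 by (simp add: m_assoc)
qed

lemma path_label_step:
  assumes "edge_step K p q" "edge_path K p"
  shows "path_label Q l p = path_label Q l q"
proof -
  have q: "edge_path K q" using edge_step_edge_path[OF complex assms(1)] assms(2) by simp
  from assms(1) show ?thesis unfolding edge_step_def
  proof (elim disjE exE conjE, goal_cases)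
    case (1 xs u v w ys)
    have *: "{u, v} \<in> K" "{v, w} \<in> K" "{u, w} \<in> K"
      by (rule simplicial_complex_subset[OF complex \<open>{u, v, w} \<in> K\<close>]; auto)+
    have "edge_path K (w # ys)"
      using edge_path_append[of "xs @ [u, v]" "w # ys" K] assms(2) 1 by simp
    then have "path_label Q l (u # v # w # ys) = path_label Q l (u # w # ys)"
      using * label_mult[OF \<open>{u, v, w} \<in> K\<close>] by (simp flip: m_assoc)
    then show ?case
      using path_label_append[of xs u "v # w # ys"] path_label_append[of xs u "w # ys"] 1 assms(2) q
      by simp
  next
    case (2 xs u ys)
    have "edge_path K (u # ys)"
      using edge_path_append[of "xs @ [u]" "u # ys" K] assms(2) 2 by simp
    moreover from this have "{u} \<in> K" by (auto simp: edge_path_def)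
    ultimately have "path_label Q l (u # u # ys) = path_label Q l (u # ys)"
      by simp
    then show ?case
      using path_label_append[of xs u "u # ys"] path_label_append[of xs u "ys"] 2 assms(2) q
      by simp
  qed
qed

lemma path_label_hpt:
  assumes "hpt K p q" "edge_path K p"
  shows "path_label Q l p = path_label Q l q"
  using assms unfolding hpt_def
proof (induction rule: rtranclp_induct)
  case (step y z)
  have "edge_path K y" using hpt_edge_path[OF complex, of p y] step by (auto simp: hpt_def)
  then have "path_label Q l y = path_label Q l z"
    using step(2) path_label_step edge_step_edge_path[OF complex] by metis
  with step show ?case by simp
qed simp

lemma path_label_glue:
  assumes "edge_path K p" "edge_path K q" "last p = hd q"
  shows "path_label Q l (p @ tl q) = path_label Q l p \<otimes> path_label Q l q"
proof -
  obtain xs u where p: "p = xs @ [u]" using assms by (cases p rule: rev_cases) (auto simp: edge_path_def)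
  obtain ys where q: "q = u # ys" using assms p by (cases q) (auto simp: edge_path_def)
  show ?thesis using path_label_append[of xs u ys] edge_path_glue[OF assms] p q by simp
qed

definition induced :: "nat list set \<Rightarrow> 'a" where
  "induced X = path_label Q l (SOME p. p \<in> X)"

lemma induced_cls:
  assumes "edge_path K p"
  shows "induced (cls K p) = path_label Q l p"
proof -
  have "(SOME q. q \<in> cls K p) \<in> cls K p" by (rule someI[of _ p]) (simp add: cls_def)
  then have "hpt K p (SOME q. q \<in> cls K p)" by (simp add: cls_def)
  then show ?thesis unfolding induced_def using path_label_hpt assms by metis
qed

lemma induced_hom: "induced \<in> hom (edge_path_group K v) Q"
proof (rule homI)
  fix x assume "x \<in> carrier (edge_path_group K v)"
  then show "induced x \<in> carrier Q"
    by (auto simp: carrier_edge_path_group[OF complex] edge_loops_def induced_cls)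
next
  fix x y assume "x \<in> carrier (edge_path_group K v)" "y \<in> carrier (edge_path_group K v)"
  then obtain p q where pq: "p \<in> edge_loops K v" "q \<in> edge_loops K v" "x = cls K p" "y = cls K q"
    by (auto simp: carrier_edge_path_group[OF complex])
  then have "edge_path K p" "edge_path K q" "last p = hd q" by (auto simp: edge_loops_def)
  then show "induced (x \<otimes>\<^bsub>edge_path_group K v\<^esub> y) = induced x \<otimes> induced y"
    using pq by (simp add: mult_edge_path_group[OF complex] induced_cls path_label_glue edge_path_glue)
qed

end

text \<open>Every other order of a triangle follows from the increasing one by inverting. It serves
  where labels are built from unordered data, as in the central extension below.\<close>

lemma (in group) labeling_of_sorted:
  assumes K: "simplicial_complex K"
    and closed: "\<And>u v. {u, v} \<in> K \<Longrightarrow> u < v \<Longrightarrow> l u v \<in> carrier G"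
    and mult: "\<And>u v w. {u, v, w} \<in> K \<Longrightarrow> u < v \<Longrightarrow> v < w \<Longrightarrow> l u v \<otimes> l v w = l u w"
  shows "labeling K G (\<lambda>u v. if u < v then l u v else if v < u then inv (l v u) else \<one>)"
    (is "labeling K G ?l")
proof -
  have cl: "?l u v \<in> carrier G" if "{u, v} \<in> K" for u v
    using closed[of u v] closed[of v u] that by (auto simp: insert_commute)
  have m1: "?l u v \<otimes> ?l v w = ?l u w" if s: "{u, v, w} \<in> K" for u v w
  proof -
    have e: "{u, v} \<in> K" "{v, w} \<in> K" "{u, w} \<in> K" "{v, u} \<in> K" "{w, v} \<in> K" "{w, u} \<in> K"
      by (rule simplicial_complex_subset[OF K s]; auto)+
    have perm: "{u, w, v} \<in> K" "{v, u, w} \<in> K" "{v, w, u} \<in> K" "{w, u, v} \<in> K" "{w, v, u} \<in> K"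
      using s by (simp_all add: insert_commute)
    have r: "a \<otimes> inv b = c" if "c \<otimes> b = a" "b \<in> carrier G" "c \<in> carrier G" for a b c
      unfolding that(1)[symmetric] using that(2,3) by (simp add: m_assoc)
    have lft: "inv b \<otimes> a = c" if "b \<otimes> c = a" "b \<in> carrier G" "c \<in> carrier G" for a b c
      unfolding that(1)[symmetric] using that(2,3) by (simp flip: m_assoc)
    consider "u = v" | "v = w" | "u = w" "u \<noteq> v" | "u < v" "v < w" | "u < w" "w < v" | "v < u" "u < w" | "v < w" "w < u"
      | "w < u" "u < v" | "w < v" "v < u" by linarith
    then show ?thesis
    proof cases
      case 1 then show ?thesis using cl[OF e(3)] by auto
    next
      case 2 then show ?thesis using cl[OF e(3)] by auto
    next
      case 3 then show ?thesis using closed[of u v] closed[of v u] e by auto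
    next
      case 4 then show ?thesis using mult[OF s] by auto
    next
      case 5 then show ?thesis using mult[OF perm(1)] closed e by (auto intro!: r)
    next
      case 6 then show ?thesis using mult[OF perm(2)] closed e by (auto intro!: lft)
    next
      case 7
      have "inv (l v u) = inv (l v w \<otimes> l w u)" using mult[OF perm(3)] 7 by simp
      also have "\<dots> = inv (l w u) \<otimes> inv (l v w)" using 7 closed e by (simp add: inv_mult_group)
      finally show ?thesis using 7 closed e by (auto simp: m_assoc)
    next
      case 8
      have "inv (l w v) = inv (l w u \<otimes> l u v)" using mult[OF perm(4)] 8 by simp
      also have "\<dots> = inv (l u v) \<otimes> inv (l w u)" using 8 closed e by (simp add: inv_mult_group)
      finally show ?thesis using 8 closed e by (auto simp flip: m_assoc)
    next
      case 9
      have "inv (l w u) = inv (l w v \<otimes> l v u)" using mult[OF perm(5)] 9 by simp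
      then show ?thesis using 9 closed e by (auto simp: inv_mult_group)
    qed
  qed
  show ?thesis unfolding labeling_def using cl m1 by blast
qed

definition path_to :: "nat set set \<Rightarrow> nat \<Rightarrow> nat list \<Rightarrow> nat \<Rightarrow> bool" where
  "path_to K v0 p v \<longleftrightarrow> edge_path K p \<and> hd p = v0 \<and> last p = v"

text \<open>Complexes may be disconnected: \<open>\<tau>\<close> is an actual path from
  \<open>v0\<close> only on the component of \<open>v0\<close>, and \<open>adjacent\<close> says
  that the vertices where this holds are closed under edges. The chosen paths need not form a
  tree.\<close>

locale rooted_complex =
  fixes K :: "nat set set" and v0 :: nat and \<tau> :: "nat \<Rightarrow> nat list"
  assumes complex: "simplicial_complex K" and base: "{v0} \<in> K" and root: "\<tau> v0 = [v0]"
    and adjacent: "\<And>u v. {u, v} \<in> K \<Longrightarrow> path_to K v0 (\<tau> u) u \<Longrightarrow> path_to K v0 (\<tau> v) v"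
begin

abbreviation "\<pi> \<equiv> edge_path_group K v0"

sublocale pi: group \<pi>
  using group_edge_path_group[OF complex base] .

text \<open>The tautological labels: go out along \<open>\<tau> u\<close>, cross the edge to
  \<open>v\<close>, come back along \<open>\<tau> v\<close>. The trivial value on the other
  components makes this a labeling of the whole complex.\<close>

definition canon :: "nat \<Rightarrow> nat \<Rightarrow> nat list set" where
  "canon u v = (if path_to K v0 (\<tau> u) u \<and> path_to K v0 (\<tau> v) v
     then cls K (\<tau> u @ rev (\<tau> v)) else \<one>\<^bsub>\<pi>\<^esub>)"

lemma adjacent_iff: "{u, v} \<in> K \<Longrightarrow> path_to K v0 (\<tau> u) u \<longleftrightarrow> path_to K v0 (\<tau> v) v"
  using adjacent[of u v] adjacent[of v u] by (auto simp: insert_commute)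

lemma path_to_root: "path_to K v0 (\<tau> v0) v0"
  using base root by (simp add: path_to_def)

lemma canon_loop:
  assumes "{u, v} \<in> K" "path_to K v0 (\<tau> u) u" "path_to K v0 (\<tau> v) v"
  shows "\<tau> u @ rev (\<tau> v) \<in> edge_loops K v0"
  using assms edge_path_append[of "\<tau> u" "rev (\<tau> v)" K] edge_path_rev[of K "\<tau> v"]
  by (auto simp: path_to_def edge_loops_def edge_path_def[of K "\<tau> _"] hd_rev last_rev)

lemma tree_path_cancel:
  assumes "path_to K v0 (\<tau> v) v"
  shows "hpt K (rev (\<tau> v) @ tl (\<tau> v)) [v]"
  using hpt_rev_cancel[of K "rev (\<tau> v)"] assms edge_path_rev[of K "\<tau> v"]
  by (auto simp: path_to_def hd_rev)

lemma canon_mult: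
  assumes K: "{u, v, w} \<in> K"
    and u: "path_to K v0 (\<tau> u) u" and v: "path_to K v0 (\<tau> v) v" and w: "path_to K v0 (\<tau> w) w"
  shows "cls K (\<tau> u @ rev (\<tau> v)) \<otimes>\<^bsub>\<pi>\<^esub> cls K (\<tau> v @ rev (\<tau> w)) = cls K (\<tau> u @ rev (\<tau> w))"
proof -
  have "{u, v} \<in> K" "{v, w} \<in> K"
    by (rule simplicial_complex_subset[OF complex K]; auto)+
  then have loops: "\<tau> u @ rev (\<tau> v) \<in> edge_loops K v0" "\<tau> v @ rev (\<tau> w) \<in> edge_loops K v0"
    using canon_loop u v w by auto
  obtain a where a: "\<tau> u = a @ [u]"
    using u by (cases "\<tau> u" rule: rev_cases) (auto simp: path_to_def edge_path_def)
  obtain b where b: "rev (\<tau> w) = w # b"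
    using w by (cases "\<tau> w" rule: rev_cases) (auto simp: path_to_def edge_path_def)
  have ne: "\<tau> v \<noteq> []" using v by (auto simp: path_to_def edge_path_def)
  have "(\<tau> u @ rev (\<tau> v)) @ tl (\<tau> v @ rev (\<tau> w)) = \<tau> u @ (rev (\<tau> v) @ tl (\<tau> v)) @ rev (\<tau> w)"
    using ne by simp
  also have "hpt K \<dots> (\<tau> u @ [v] @ rev (\<tau> w))"
    by (rule hpt_context[OF tree_path_cancel[OF v]])
  also have "hpt K (\<tau> u @ [v] @ rev (\<tau> w)) (\<tau> u @ rev (\<tau> w))"
    using hpt_triangle[OF K, of a b] a b by simp
  finally show ?thesis
    by (simp add: mult_edge_path_group[OF complex loops] cls_eq_iff)
qed

lemma labeled_canon: "labeled_complex \<pi> K canon"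
proof (unfold_locales)
  show "simplicial_complex K" by (rule complex)
  show "labeling K \<pi> canon" unfolding labeling_def
  proof (intro conjI allI impI)
    fix u v assume "{u, v} \<in> K"
    then show "canon u v \<in> carrier \<pi>"
      using canon_loop[of u v] pi.one_closed
      by (auto simp: canon_def carrier_edge_path_group[OF complex] simp del: pi.one_closed)
  next
    fix u v w assume K: "{u, v, w} \<in> K"
    have "{u, v} \<in> K" "{v, w} \<in> K"
      by (rule simplicial_complex_subset[OF complex K]; auto)+
    then show "canon u v \<otimes>\<^bsub>\<pi>\<^esub> canon v w = canon u w"
      using canon_mult[OF K] adjacent_iff[of u v] adjacent_iff[of v w] by (auto simp: canon_def)
  qed
qed

text \<open>Stated for paths with arbitrary ends, joined to \<open>v0\<close> by
  \<open>\<tau>\<close>, because the induction removes the first vertex and so leaves the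
  loops.\<close>

lemma path_label_canon:
  assumes "edge_path K p" "path_to K v0 (\<tau> (hd p)) (hd p)"
  shows "path_to K v0 (\<tau> (last p)) (last p) \<and>
    \<tau> (hd p) @ tl p @ tl (rev (\<tau> (last p))) \<in> edge_loops K v0 \<and>
    path_label \<pi> canon p = cls K (\<tau> (hd p) @ tl p @ tl (rev (\<tau> (last p))))"
  using assms
proof (induction p rule: induct_list012)
  case (2 u)
  then have e: "edge_path K (\<tau> u)" "hd (\<tau> u) = v0" "last (\<tau> u) = u" "\<tau> u \<noteq> []"
    by (auto simp: path_to_def edge_path_def)
  have "edge_path K (\<tau> u @ tl (rev (\<tau> u)))"
    using e by (intro edge_path_glue edge_path_rev) (auto simp: hd_rev)
  then have "\<tau> u @ tl (rev (\<tau> u)) \<in> edge_loops K v0"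
    using e by (auto simp: edge_loops_def last_glue hd_rev last_rev)
  moreover have "\<one>\<^bsub>\<pi>\<^esub> = cls K (\<tau> u @ tl (rev (\<tau> u)))"
    using hpt_rev_cancel[OF e(1)] e(2)
    by (simp add: one_edge_path_group[OF complex base] cls_eq_iff hpt_sym)
  ultimately show ?case using 2 by simp
next
  case (3 u v p)
  let ?q = "tl (v # p) @ tl (rev (\<tau> (last (v # p))))"
  have uv: "{u, v} \<in> K" and u: "path_to K v0 (\<tau> u) u" using 3 by auto
  have v: "path_to K v0 (\<tau> v) v" using adjacent uv u by blast
  have IH: "path_to K v0 (\<tau> (last (v # p))) (last (v # p))" "\<tau> v @ ?q \<in> edge_loops K v0"
    "path_label \<pi> canon (v # p) = cls K (\<tau> v @ ?q)"
    using "3.IH"(2) "3.prems" v by auto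
  have ne: "\<tau> v \<noteq> []" using v by (auto simp: path_to_def edge_path_def)
  have l: "\<tau> u @ rev (\<tau> v) \<in> edge_loops K v0" using canon_loop uv u v by blast
  have "(\<tau> u @ rev (\<tau> v)) @ tl (\<tau> v @ ?q) = \<tau> u @ (rev (\<tau> v) @ tl (\<tau> v)) @ ?q"
    using ne by simp
  also have "hpt K \<dots> (\<tau> u @ [v] @ ?q)"
    by (rule hpt_context[OF tree_path_cancel[OF v]])
  finally have h: "hpt K ((\<tau> u @ rev (\<tau> v)) @ tl (\<tau> v @ ?q)) (\<tau> u @ [v] @ ?q)" .
  have "path_label \<pi> canon (u # v # p) = cls K (\<tau> u @ rev (\<tau> v)) \<otimes>\<^bsub>\<pi>\<^esub> cls K (\<tau> v @ ?q)"
    using IH u v by (simp add: canon_def)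
  also have "\<dots> = cls K (\<tau> u @ [v] @ ?q)"
    using h by (simp only: mult_edge_path_group[OF complex l IH(2)] cls_eq_iff)
  finally have "path_label \<pi> canon (u # v # p) = cls K (\<tau> u @ [v] @ ?q)" .
  moreover have "\<tau> u @ [v] @ ?q \<in> edge_loops K v0"
    using hpt_loops[OF complex h, of v0] edge_loops_glue[OF l IH(2)] by blast
  ultimately show ?case using IH(1) by simp
qed (simp add: edge_path_def)

text \<open>Thus \<open>canon\<close> induces the identity of \<open>\<pi>\<close>, and every
  homomorphism out of \<open>\<pi>\<close> is induced by its composite with
  \<open>canon\<close>.\<close>

lemma path_label_canon_loop:
  assumes "p \<in> edge_loops K v0"
  shows "path_label \<pi> canon p = cls K p"
proof -
  have "p = v0 # tl p" using assms by (cases p) (auto simp: edge_loops_def edge_path_def)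
  then have "[v0] @ tl p = p" by simp
  then show ?thesis
    using path_label_canon[of p] assms root path_to_root by (simp add: edge_loops_def)
qed

lemma canon_tree:
  assumes "path_to K v0 (\<tau> u) u" "{u, v} \<in> K" "\<tau> v = \<tau> u @ [v]"
  shows "canon u v = \<one>\<^bsub>\<pi>\<^esub>"
proof -
  have v: "path_to K v0 (\<tau> v) v" using assms adjacent by blast
  have "hpt K (\<tau> u @ rev (\<tau> v)) [v0]"
    using hpt_rev_cancel[of K "\<tau> v"] v assms(3) by (simp add: path_to_def)
  then show ?thesis
    using assms(1) v by (simp add: canon_def one_edge_path_group[OF complex base] cls_eq_iff)
qed

end

lemma ex_rooted_complex:
  assumes K: "simplicial_complex K" and v0: "{v0} \<in> K"
  shows "\<exists>\<tau>. rooted_complex K v0 \<tau>"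
proof -
  define \<tau> where "\<tau> v = (if v = v0 then [v0] else SOME p. path_to K v0 p v)" for v
  have \<tau>: "path_to K v0 (\<tau> v) v" if "path_to K v0 p v" for p v
  proof (cases "v = v0")
    case True then show ?thesis using v0 by (simp add: path_to_def \<tau>_def)
  next
    case False then show ?thesis using someI[of "\<lambda>p. path_to K v0 p v", OF that] by (simp add: \<tau>_def)
  qed
  have "rooted_complex K v0 \<tau>"
  proof
    fix u v assume uv: "{u, v} \<in> K" "path_to K v0 (\<tau> u) u"
    have "{v} \<in> K" by (rule simplicial_complex_subset[OF K uv(1)]) auto
    then have "path_to K v0 (\<tau> u @ [v]) v"
      using uv edge_path_append[of "\<tau> u" "[v]" K] by (auto simp: path_to_def edge_path_def[of K "\<tau> u"])
    then show "path_to K v0 (\<tau> v) v" by (rule \<tau>)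
  qed (auto simp: K v0 \<tau>_def)
  then show ?thesis by blast
qed

section \<open>Free groups, free products and presentations\<close>

definition flip :: "nat \<times> bool \<Rightarrow> nat \<times> bool" where
  "flip x = (fst x, \<not> snd x)"

lemma fg_reduced_tl: "fg_reduced (x # w) \<Longrightarrow> fg_reduced w"
  by (cases w; cases x) auto

lemma fg_reduced_cons [simp]: "fg_reduced w \<Longrightarrow> fg_reduced (fg_cons x w)"
  by (cases "(x, w)" rule: fg_cons.cases) (auto dest: fg_reduced_tl)

lemma fg_cons_Cons: "fg_cons x (y # w) = (if y = flip x then w else x # y # w)"
  by (cases x; cases y) (auto simp: flip_def)

lemma flip_flip [simp]: "flip (flip x) = x"
  by (simp add: flip_def)

lemma flip_neq [simp]: "x \<noteq> flip x"
  by (cases x) (simp add: flip_def)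

lemma fg_cons_Nil [simp]: "fg_cons x [] = [x]"
  by (cases x) simp

lemma fg_reduced_Cons: "fg_reduced (x # y # w) \<longleftrightarrow> y \<noteq> flip x \<and> fg_reduced (y # w)"
  by (cases x; cases y) (auto simp: flip_def)

text \<open>Van der Waerden's trick: a letter acts as a permutation of the reduced words.
  Associativity and inverses then follow without any confluence argument for cancellation.\<close>

lemma fg_cons_flip:
  assumes "fg_reduced w"
  shows "fg_cons (flip x) (fg_cons x w) = w"
proof (cases w)
  case (Cons y v)
  with assms show ?thesis
    by (cases v) (auto simp: fg_cons_Cons fg_reduced_Cons simp del: fg_cons.simps fg_reduced.simps(3))
qed (simp add: fg_cons_Cons)

lemma fg_cons_flip': "fg_reduced w \<Longrightarrow> fg_cons x (fg_cons (flip x) w) = w"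
  using fg_cons_flip[of w "flip x"] by simp

lemma fg_cons_reduced: "fg_reduced (x # w) \<Longrightarrow> fg_cons x w = x # w"
  by (cases w) (auto simp: fg_cons_Cons fg_reduced_Cons simp del: fg_reduced.simps(3))

lemma set_fg_cons: "set (fg_cons x w) \<subseteq> insert x (set w)"
  by (cases "(x, w)" rule: fg_cons.cases) auto

lemma fg_reduced_foldr [simp]: "fg_reduced w \<Longrightarrow> fg_reduced (foldr fg_cons u w)"
  by (induction u) auto

lemma set_foldr_fg_cons: "set (foldr fg_cons u w) \<subseteq> set u \<union> set w"
  using set_fg_cons by (induction u) fastforce+

lemma foldr_fg_cons_Nil: "fg_reduced u \<Longrightarrow> foldr fg_cons u [] = u"
proof (induction u)
  case (Cons x u)
  then show ?case using fg_reduced_tl[OF Cons.prems] fg_cons_reduced[OF Cons.prems] by simp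
qed simp

lemma foldr_fg_cons_cons:
  assumes "fg_reduced v" "fg_reduced w"
  shows "foldr fg_cons (fg_cons x v) w = fg_cons x (foldr fg_cons v w)"
proof (cases v)
  case (Cons y v')
  show ?thesis
  proof (cases "y = flip x")
    case True
    then have "fg_cons x v = v'" using Cons by (cases x) (auto simp: flip_def)
    then show ?thesis using Cons True fg_cons_flip' assms by simp
  next
    case False
    then have "fg_cons x v = x # v" using Cons by (cases x; cases y) (auto simp: flip_def)
    then show ?thesis by simp
  qed
qed (cases x, simp)

lemma foldr_fg_cons_assoc:
  assumes "fg_reduced v" "fg_reduced w"
  shows "foldr fg_cons (foldr fg_cons u v) w = foldr fg_cons u (foldr fg_cons v w)"
  using assms by (induction u) (auto simp: foldr_fg_cons_cons)

lemma foldr_fg_cons_inverse: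
  assumes "fg_reduced u"
  shows "foldr fg_cons (rev (map flip u)) u = []"
  using assms
proof (induction u)
  case (Cons x u)
  have "fg_cons (flip x) (x # u) = u" by (cases x) (simp add: flip_def)
  with Cons show ?case by (simp add: fg_reduced_tl)
qed simp

lemma carrier_free_group: "w \<in> carrier (free_group n) \<longleftrightarrow> fg_reduced w \<and> fst ` set w \<subseteq> {..<n}"
  by (auto simp: free_group_def)

lemma mult_free_group [simp]: "u \<otimes>\<^bsub>free_group n\<^esub> v = foldr fg_cons u v"
  by (simp add: free_group_def)

lemma one_free_group [simp]: "\<one>\<^bsub>free_group n\<^esub> = []"
  by (simp add: free_group_def)

lemma group_free_group: "group (free_group n)"
proof (rule groupI, goal_cases)
  case (1 x y)
  then show ?case using set_foldr_fg_cons[of x y] by (fastforce simp: carrier_free_group)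
next
  case (5 x)
  let ?y = "foldr fg_cons (rev (map flip x)) []"
  have "fst ` set ?y \<subseteq> fst ` set (rev (map flip x))"
    using set_foldr_fg_cons[of "rev (map flip x)" "[]"] by auto
  also have "\<dots> \<subseteq> fst ` set x" by (force simp: flip_def)
  finally have "?y \<in> carrier (free_group n)" using 5 by (auto simp: carrier_free_group)
  moreover have "?y \<otimes>\<^bsub>free_group n\<^esub> x = \<one>\<^bsub>free_group n\<^esub>"
    using 5 by (simp add: carrier_free_group foldr_fg_cons_assoc foldr_fg_cons_inverse)
  ultimately show ?case by blast
qed (auto simp: carrier_free_group foldr_fg_cons_assoc)

definition weval :: "('q, 'e) monoid_scheme \<Rightarrow> (nat \<Rightarrow> 'q) \<Rightarrow> (nat \<times> bool) list \<Rightarrow> 'q" where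
  "weval Q y w = foldr (\<lambda>x a. (if snd x then inv\<^bsub>Q\<^esub> (y (fst x)) else y (fst x)) \<otimes>\<^bsub>Q\<^esub> a) w \<one>\<^bsub>Q\<^esub>"

lemma weval_Nil [simp]: "weval Q y [] = \<one>\<^bsub>Q\<^esub>"
  by (simp add: weval_def)

lemma weval_Cons [simp]:
  "weval Q y (x # w) = (if snd x then inv\<^bsub>Q\<^esub> (y (fst x)) else y (fst x)) \<otimes>\<^bsub>Q\<^esub> weval Q y w"
  by (simp add: weval_def)

abbreviation letters :: "nat \<Rightarrow> (nat \<times> bool) list \<Rightarrow> bool" where
  "letters n w \<equiv> fst ` set w \<subseteq> {..<n}"

lemma (in group) weval_closed:
  "\<forall>i<n. y i \<in> carrier G \<Longrightarrow> letters n w \<Longrightarrow> weval G y w \<in> carrier G"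
  by (induction w) auto

lemma (in group) weval_append:
  "\<forall>i<n. y i \<in> carrier G \<Longrightarrow> letters n v \<Longrightarrow> letters n w \<Longrightarrow> weval G y (v @ w) = weval G y v \<otimes> weval G y w"
  by (induction v) (auto simp: weval_closed[of n] m_assoc)

lemma weval_hom:
  assumes "group H" "group Q" "\<theta> \<in> hom H Q" "\<forall>i<n. x i \<in> carrier H" "letters n w"
  shows "\<theta> (weval H x w) = weval Q (\<lambda>i. \<theta> (x i)) w"
proof -
  interpret group_hom H Q \<theta> using assms by (simp add: group_hom_def group_hom_axioms_def)
  show ?thesis using assms(5,4)
    by (induction w) (auto simp: H.weval_closed[of n] G.weval_closed[of n])
qed

lemma weval_cong: "letters n w \<Longrightarrow> \<forall>i<n. x i = y i \<Longrightarrow> weval Q x w = weval Q y w"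
  by (induction w) auto

lemma (in group) weval_fg_cons:
  assumes "\<forall>i<n. y i \<in> carrier G" "fst x < n" "letters n w"
  shows "weval G y (fg_cons x w) = (if snd x then inv (y (fst x)) else y (fst x)) \<otimes> weval G y w"
proof (cases "(x, w)" rule: fg_cons.cases)
  case (2 i b j c v)
  have "weval G y v \<in> carrier G" using 2 assms by (intro weval_closed[of n]) auto
  then show ?thesis using 2 assms by (auto simp flip: m_assoc)
qed simp

lemma (in group) weval_free_group_hom:
  assumes "\<forall>i<n. y i \<in> carrier G"
  shows "weval G y \<in> hom (free_group n) G"
proof (rule homI)
  fix w assume "w \<in> carrier (free_group n)"
  then show "weval G y w \<in> carrier G" using assms weval_closed by (auto simp: carrier_free_group)
next
  fix u v assume "u \<in> carrier (free_group n)" "v \<in> carrier (free_group n)"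
  then have *: "letters n u" "letters n v" by (auto simp: carrier_free_group)
  then have "weval G y (foldr fg_cons u v) = weval G y u \<otimes> weval G y v"
  proof (induction u)
    case (Cons x u)
    have "letters n (foldr fg_cons u v)" using Cons.prems set_foldr_fg_cons[of u v] by fastforce
    then show ?case using Cons assms
      by (auto simp: weval_fg_cons[OF assms] weval_closed[OF assms] m_assoc)
  qed (use weval_closed[OF assms] in simp)
  then show "weval G y (u \<otimes>\<^bsub>free_group n\<^esub> v) = weval G y u \<otimes> weval G y v" by simp
qed

section \<open>Presentations\<close>

lemma normal_normal_closure:
  assumes "group F"
  shows "normal_closure F R \<lhd> F"
proof -
  interpret group F by fact
  have sub: "N \<subseteq> carrier F" if "N \<lhd> F" for N
    using that normal_imp_subgroup subgroup.subset by blast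
  have "subgroup (normal_closure F R) F"
  proof (rule subgroupI)
    have "\<one>\<^bsub>F\<^esub> \<in> normal_closure F R"
      by (auto simp: normal_closure_def normal_imp_subgroup subgroup.one_closed)
    then show "normal_closure F R \<noteq> {}" by blast
  qed (auto simp: normal_closure_def normal_imp_subgroup subgroup.m_inv_closed subgroup.m_closed)
  then show ?thesis
    unfolding normal_inv_iff by (auto simp: normal_closure_def normal.inv_op_closed2)
qed

lemma normal_closure_superset: "R \<subseteq> carrier F \<Longrightarrow> R \<subseteq> normal_closure F R"
  by (auto simp: normal_closure_def)

text \<open>The universal property is required only for target groups on the type of
  edge-path groups, since a definition cannot quantify over types.\<close>

definition presents :: "('a, 'c) monoid_scheme \<Rightarrow> nat \<Rightarrow> (nat \<times> bool) list set \<Rightarrow> (nat \<Rightarrow> 'a) \<Rightarrow> bool" where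
  "presents H n R x \<longleftrightarrow> group H \<and> finite R \<and> (\<forall>i<n. x i \<in> carrier H) \<and>
     (\<forall>r\<in>R. letters n r \<and> weval H x r = \<one>\<^bsub>H\<^esub>) \<and>
     (\<forall>h\<in>carrier H. \<exists>w. letters n w \<and> h = weval H x w) \<and>
     (\<forall>(Q :: nat list set monoid) y. group Q \<and> (\<forall>i<n. y i \<in> carrier Q) \<and> (\<forall>r\<in>R. weval Q y r = \<one>\<^bsub>Q\<^esub>) \<longrightarrow>
        (\<exists>\<theta>\<in>hom H Q. \<forall>i<n. \<theta> (x i) = y i))"

lemma presentsD:
  assumes "presents H n R x"
  shows "group H" "finite R" "\<forall>i<n. x i \<in> carrier H" "\<And>r. r \<in> R \<Longrightarrow> letters n r"
    "\<And>r. r \<in> R \<Longrightarrow> weval H x r = \<one>\<^bsub>H\<^esub>" "\<And>h. h \<in> carrier H \<Longrightarrow> \<exists>w. letters n w \<and> h = weval H x w"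
  using assms by (auto simp: presents_def)

lemma presents_universal:
  fixes Q :: "nat list set monoid"
  assumes "presents H n R x" "group Q" "\<forall>i<n. y i \<in> carrier Q" "\<And>r. r \<in> R \<Longrightarrow> weval Q y r = \<one>\<^bsub>Q\<^esub>"
  obtains \<theta> where "\<theta> \<in> hom H Q" "\<forall>i<n. \<theta> (x i) = y i"
proof -
  have "\<exists>\<theta>\<in>hom H Q. \<forall>i<n. \<theta> (x i) = y i"
    using assms(1)[unfolded presents_def, THEN conjunct2, THEN conjunct2, THEN conjunct2, THEN conjunct2,
        THEN conjunct2, THEN spec[of _ Q], THEN spec[of _ y]] assms(2,3,4) by simp
  then show thesis using that by blast
qed

lemma weval_free_group_generators:
  assumes "letters n w"
  shows "weval (free_group n) (\<lambda>i. [(i, False)]) w = foldr fg_cons w []"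
  using assms
proof (induction w)
  case (Cons x w)
  interpret group "free_group n" by (rule group_free_group)
  have x: "fst x < n" using Cons by auto
  then have "[(fst x, True)] = inv\<^bsub>free_group n\<^esub> [(fst x, False)]"
    by (intro inv_equality[symmetric]) (auto simp: carrier_free_group)
  then have "(if snd x then inv\<^bsub>free_group n\<^esub> [(fst x, False)] else [(fst x, False)]) = [x]"
    by (cases x) auto
  then show ?case using Cons by simp
qed simp

text \<open>Trades the quotient of a free group for generators with a universal property, the form
  that passes to free products and yields homomorphisms into edge-path groups.\<close>

lemma finitely_presentable_presents:
  fixes G :: "('a, 'c) monoid_scheme"
  assumes "finitely_presentable G"
  shows "\<exists>n R x. presents G n R x"
proof -
  obtain n R \<phi> where G: "group G" and R: "finite R" "R \<subseteq> carrier (free_group n)"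
    and \<phi>: "\<phi> \<in> iso G (free_group n Mod normal_closure (free_group n) R)"
    using assms unfolding finitely_presentable_def is_iso_def by blast
  define F where "F = free_group n"
  define N where "N = normal_closure F R"
  interpret F: group F unfolding F_def by (rule group_free_group)
  interpret G: group G by (rule G)
  interpret N: normal N F unfolding N_def by (rule normal_normal_closure) (rule F.is_group)
  interpret FN: group "F Mod N" by (rule N.factorgroup_is_group)
  define \<psi> where "\<psi> = inv_into (carrier G) \<phi>"
  have \<phi>: "\<phi> \<in> iso G (F Mod N)" using \<phi> by (simp add: F_def N_def)
  have \<psi>: "\<psi> \<in> iso (F Mod N) G" unfolding \<psi>_def by (rule G.iso_set_sym[OF \<phi>])
  have inv1: "\<psi> (\<phi> g) = g" if "g \<in> carrier G" for g
    using that \<phi> by (auto simp: \<psi>_def iso_def bij_betw_def)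
  have inv2: "\<phi> (\<psi> c) = c" if "c \<in> carrier (F Mod N)" for c
    using that \<phi> by (auto simp: \<psi>_def iso_def bij_betw_def f_inv_into_f)
  have \<psi>h: "(\<lambda>w. \<psi> (N #>\<^bsub>F\<^esub> w)) \<in> hom F G"
    using hom_compose[OF N.r_coset_hom_Mod iso_imp_homomorphism[OF \<psi>]] by (simp add: comp_def)
  define x where "x i = \<psi> (N #>\<^bsub>F\<^esub> [(i, False)])" for i
  have gF: "\<forall>i<n. [(i, False)] \<in> carrier F" by (simp add: F_def carrier_free_group)
  have xG: "\<forall>i<n. x i \<in> carrier G"
    using gF hom_in_carrier[OF \<psi>h] unfolding x_def by blast
  have ev: "weval G x w = \<psi> (N #>\<^bsub>F\<^esub> foldr fg_cons w [])" if "letters n w" for w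
    using weval_hom[OF F.is_group G \<psi>h gF that] weval_free_group_generators[OF that]
    unfolding x_def F_def by simp
  have rN: "R \<subseteq> N" unfolding N_def using normal_closure_superset R by (simp add: F_def)
  have "presents G n R x" unfolding presents_def
  proof (intro conjI ballI allI impI; (elim conjE)?)
    fix r assume r: "r \<in> R"
    then have "r \<in> carrier (free_group n)" using R by blast
    then have red: "fg_reduced r" and "letters n r" by (simp_all only: carrier_free_group)
    then show "fst ` set r \<subseteq> {..<n}" by simp
    have "weval G x r = \<psi> (N #>\<^bsub>F\<^esub> r)"
      using ev \<open>letters n r\<close> red by (simp add: foldr_fg_cons_Nil)
    also have "N #>\<^bsub>F\<^esub> r = N" using rN r N.rcos_const[OF F.is_group, of r] by blast
    also have "\<psi> N = \<one>\<^bsub>G\<^esub>"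
      using hom_one[OF iso_imp_homomorphism[OF \<psi>] FN.is_group G] by simp
    finally show "weval G x r = \<one>\<^bsub>G\<^esub>" .
  next
    fix h assume h: "h \<in> carrier G"
    then have "\<phi> h \<in> carrier (F Mod N)" using \<phi> by (auto simp: iso_def hom_def)
    then obtain w where w: "w \<in> carrier F" "\<phi> h = N #>\<^bsub>F\<^esub> w"
      by (auto simp: carrier_FactGroup)
    then have "h = \<psi> (N #>\<^bsub>F\<^esub> w)" using inv1[OF h] by simp
    moreover have "letters n w" "foldr fg_cons w [] = w"
      using w by (auto simp: F_def carrier_free_group foldr_fg_cons_Nil)
    ultimately show "\<exists>w. letters n w \<and> h = weval G x w" using ev by metis
  next
    fix Q :: "nat list set monoid" and y
    assume Q: "group Q" "\<forall>i<n. y i \<in> carrier Q" "\<forall>r\<in>R. weval Q y r = \<one>\<^bsub>Q\<^esub>"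
    interpret Q: group Q by (rule Q)
    interpret h: group_hom F Q "weval Q y"
      using Q.weval_free_group_hom[OF Q(2)] by unfold_locales (simp add: F_def)
    have "kernel F Q (weval Q y) \<lhd> F" by (rule h.normal_kernel)
    moreover have "R \<subseteq> kernel F Q (weval Q y)"
      using R Q(3) by (auto simp: kernel_def F_def)
    ultimately have sub: "N \<subseteq> kernel F Q (weval Q y)"
      unfolding N_def normal_closure_def by blast
    \<comment> \<open>The kernel of the evaluation is a normal subgroup containing the relators,
      hence contains \<open>N\<close>; so evaluation is constant on cosets and descends to the
      quotient.\<close>
    have "weval Q y u = weval Q y v" if uv: "u \<in> carrier F" "v \<in> carrier F" "N #>\<^bsub>F\<^esub> u = N #>\<^bsub>F\<^esub> v" for u v
    proof -
      have "u \<in> N #>\<^bsub>F\<^esub> v" using F.rcos_self[OF uv(1) N.subgroup_axioms] uv by simp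
      then obtain c where "c \<in> N" "u = c \<otimes>\<^bsub>F\<^esub> v" by (auto simp: r_coset_def)
      then show ?thesis using sub uv by (auto simp: kernel_def subset_iff)
    qed
    then obtain g where g: "g \<in> hom (F Mod N) Q" "\<And>w. w \<in> carrier F \<Longrightarrow> g (N #>\<^bsub>F\<^esub> w) = weval Q y w"
      using FactGroup_universal[OF h.homh N.normal_axioms] by metis
    have "g \<circ> \<phi> \<in> hom G Q" using hom_compose[OF iso_imp_homomorphism[OF \<phi>] g(1)] .
    moreover have "(g \<circ> \<phi>) (x i) = y i" if "i < n" for i
      using that gF g(2)[of "[(i, False)]"] Q(2) inv2[of "N #>\<^bsub>F\<^esub> [(i, False)]"]
      by (auto simp: x_def carrier_FactGroup)
    ultimately show "\<exists>\<theta>\<in>hom G Q. \<forall>i<n. \<theta> (x i) = y i" by blast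
  qed (use G R xG in auto)
  then show ?thesis by blast
qed

section \<open>Free products\<close>

declare fp_cons.simps [simp del]

locale free_product_groups = G: group G + T: group T
  for G :: "('a, 'c) monoid_scheme" and T :: "('b, 'd) monoid_scheme"
begin

abbreviation "FP \<equiv> free_product G T"
abbreviation "lcons \<equiv> fp_cons G T"

definition letter :: "'a + 'b \<Rightarrow> bool" where
  "letter x = (case x of Inl g \<Rightarrow> g \<in> carrier G | Inr t \<Rightarrow> t \<in> carrier T)"

definition trivial :: "'a + 'b \<Rightarrow> bool" where
  "trivial x = (case x of Inl g \<Rightarrow> g = \<one>\<^bsub>G\<^esub> | Inr t \<Rightarrow> t = \<one>\<^bsub>T\<^esub>)"

definition inv_letter :: "'a + 'b \<Rightarrow> 'a + 'b" where
  "inv_letter x = (case x of Inl g \<Rightarrow> Inl (inv\<^bsub>G\<^esub> g) | Inr t \<Rightarrow> Inr (inv\<^bsub>T\<^esub> t))"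

text \<open>Meaningful only for two letters of the same factor.\<close>

fun lmul :: "'a + 'b \<Rightarrow> 'a + 'b \<Rightarrow> 'a + 'b" where
  "lmul (Inl g) (Inl h) = Inl (g \<otimes>\<^bsub>G\<^esub> h)"
| "lmul (Inr t) (Inr u) = Inr (t \<otimes>\<^bsub>T\<^esub> u)"
| "lmul x _ = x"

lemma letter_simps [simp]:
  "letter (Inl g) \<longleftrightarrow> g \<in> carrier G" "letter (Inr t) \<longleftrightarrow> t \<in> carrier T"
  "trivial (Inl g) \<longleftrightarrow> g = \<one>\<^bsub>G\<^esub>" "trivial (Inr t) \<longleftrightarrow> t = \<one>\<^bsub>T\<^esub>"
  "inv_letter (Inl g) = Inl (inv\<^bsub>G\<^esub> g)" "inv_letter (Inr t) = Inr (inv\<^bsub>T\<^esub> t)"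
  by (simp_all add: letter_def trivial_def inv_letter_def)

lemma letter_inv [simp]: "letter x \<Longrightarrow> letter (inv_letter x)" "isl (inv_letter x) = isl x"
  by (cases x; simp)+

lemma lmul_letter: "isl x = isl y \<Longrightarrow> letter x \<Longrightarrow> letter y \<Longrightarrow> letter (lmul x y)"
  and isl_lmul [simp]: "isl (lmul x y) = isl x"
  and lmul_assoc: "isl x = isl y \<Longrightarrow> isl y = isl z \<Longrightarrow> letter x \<Longrightarrow> letter y \<Longrightarrow> letter z \<Longrightarrow>
    lmul (lmul x y) z = lmul x (lmul y z)"
  and lmul_trivial_left: "isl x = isl y \<Longrightarrow> letter y \<Longrightarrow> trivial x \<Longrightarrow> lmul x y = y"
  and lmul_trivial_right: "isl x = isl y \<Longrightarrow> letter x \<Longrightarrow> trivial y \<Longrightarrow> lmul x y = x"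
  and lmul_inv: "letter x \<Longrightarrow> trivial (lmul (inv_letter x) x)" "letter x \<Longrightarrow> trivial (lmul x (inv_letter x))"
  by (cases x; cases y; cases z; simp add: G.m_assoc T.m_assoc; fail)+

lemma fp_cons_Nil [simp]: "lcons x [] = (if trivial x then [] else [x])"
  by (cases x) (auto simp: fp_cons.simps)

lemma fp_cons_Cons: "lcons x (y # w) = (if trivial x then y # w
    else if isl x = isl y then (if trivial (lmul x y) then w else lmul x y # w) else x # y # w)"
  by (cases x; cases y) (auto simp: fp_cons.simps)

lemma carrier_FP: "w \<in> carrier FP \<longleftrightarrow> fp_alternating w \<and> (\<forall>x\<in>set w. letter x \<and> \<not> trivial x)"
proof -
  have "letter x \<and> \<not> trivial x \<longleftrightarrow> (case x of Inl g \<Rightarrow> g \<in> carrier G \<and> g \<noteq> \<one>\<^bsub>G\<^esub>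
      | Inr t \<Rightarrow> t \<in> carrier T \<and> t \<noteq> \<one>\<^bsub>T\<^esub>)" for x
    by (cases x) auto
  then show ?thesis by (simp add: free_product_def)
qed

lemma one_FP [simp]: "\<one>\<^bsub>FP\<^esub> = []"
  by (simp add: free_product_def)

lemma mult_FP [simp]: "u \<otimes>\<^bsub>FP\<^esub> v = foldr lcons u v"
  by (simp add: free_product_def)

lemma Nil_FP [simp]: "[] \<in> carrier FP"
  by (simp add: carrier_FP)

definition fresh :: "'a + 'b \<Rightarrow> ('a + 'b) list \<Rightarrow> bool" where
  "fresh x w \<longleftrightarrow> w = [] \<or> isl x \<noteq> isl (hd w)"

lemma Cons_FP: "x # w \<in> carrier FP \<longleftrightarrow> letter x \<and> \<not> trivial x \<and> w \<in> carrier FP \<and> fresh x w"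
  by (cases w) (auto simp: carrier_FP fresh_def)

lemma fp_cons_fresh: "fresh x w \<Longrightarrow> lcons x w = (if trivial x then w else x # w)"
  by (cases w) (auto simp: fresh_def fp_cons_Cons)

lemma fresh_cong: "isl x = isl y \<Longrightarrow> fresh x w = fresh y w"
  by (simp add: fresh_def)

lemma fp_cons_absorb:
  assumes "y # w \<in> carrier FP" "isl x = isl y"
  shows "lcons x (y # w) = lcons (lmul x y) w"
  using assms fresh_cong[of "lmul x y" y w]
  by (auto simp: Cons_FP fp_cons_Cons fp_cons_fresh lmul_trivial_left)

lemma fp_cons_closed [simp]:
  assumes "w \<in> carrier FP" "letter x"
  shows "lcons x w \<in> carrier FP"
proof (cases w)
  case (Cons y v)
  then show ?thesis
    using assms fresh_cong[of "lmul x y" y v] by (auto simp: fp_cons_Cons Cons_FP lmul_letter fresh_def)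
qed (use assms in \<open>simp add: Cons_FP fresh_def\<close>)

text \<open>Each factor acts on the normal forms. As for free groups, the group laws are read off
  from this action by letters.\<close>

lemma fp_cons_mult:
  assumes w: "w \<in> carrier FP" and x: "letter x" "letter y" "isl x = isl y"
  shows "lcons x (lcons y w) = lcons (lmul x y) w"
proof (cases "fresh x w")
  case True
  then show ?thesis
    using x fresh_cong[of y x w] fresh_cong[of "lmul x y" x w]
    by (auto simp: fp_cons_fresh fp_cons_Cons lmul_trivial_left lmul_trivial_right)
next
  case False
  then obtain k v where k: "w = k # v" "isl k = isl x" by (cases w) (auto simp: fresh_def)
  then have v: "letter k" "fresh k v" using w by (auto simp: Cons_FP)
  have fr: "fresh a v" if "isl a = isl x" for a using v(2) k(2) that by (simp add: fresh_def)
  have yk: "letter (lmul y k)" "isl x = isl (lmul y k)" using x v k by (simp_all add: lmul_letter)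
  have "lcons x (lcons (lmul y k) v) = lcons (lmul x (lmul y k)) v"
    using fp_cons_fresh[OF fr[OF yk(2)[symmetric]]] fp_cons_fresh[OF fr[of "lmul x (lmul y k)"]] fp_cons_fresh[OF fr[OF refl]]
    by (simp add: fp_cons_Cons yk(2)[symmetric] x lmul_trivial_right[OF yk(2)] lmul_trivial_left[OF yk(2,1)])
  moreover have "lcons y w = lcons (lmul y k) v" "lcons (lmul x y) w = lcons (lmul (lmul x y) k) v"
    unfolding k(1) by (rule fp_cons_absorb; use w k x in simp)+
  ultimately show ?thesis using x k(2) v(1) by (simp add: lmul_assoc)
qed

lemma fp_cons_trivial: "trivial x \<Longrightarrow> lcons x w = w"
  by (cases w) (simp_all add: fp_cons_Cons)

lemma fp_cons_inv:
  assumes "w \<in> carrier FP" "letter x"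
  shows "lcons (inv_letter x) (lcons x w) = w" "lcons x (lcons (inv_letter x) w) = w"
  using assms by (simp_all add: fp_cons_mult lmul_inv fp_cons_trivial)

lemma fp_cons_reduced: "x # w \<in> carrier FP \<Longrightarrow> lcons x w = x # w"
  by (simp add: Cons_FP fp_cons_fresh)

lemma foldr_closed [simp]: "\<forall>x\<in>set u. letter x \<Longrightarrow> w \<in> carrier FP \<Longrightarrow> foldr lcons u w \<in> carrier FP"
  by (induction u) auto

lemma foldr_Nil: "u \<in> carrier FP \<Longrightarrow> foldr lcons u [] = u"
proof (induction u)
  case (Cons x u)
  then show ?case using fp_cons_reduced[OF Cons.prems] by (simp add: Cons_FP)
qed simp

lemma FP_letters: "u \<in> carrier FP \<Longrightarrow> \<forall>x\<in>set u. letter x"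
  by (auto simp: carrier_FP)

lemma foldr_fp_cons:
  assumes v: "v \<in> carrier FP" and w: "w \<in> carrier FP" and x: "letter x"
  shows "foldr lcons (lcons x v) w = lcons x (foldr lcons v w)"
proof (cases "fresh x v")
  case True
  then show ?thesis by (simp add: fp_cons_fresh fp_cons_trivial)
next
  case False
  then obtain y u where y: "v = y # u" "isl x = isl y" by (cases v) (auto simp: fresh_def)
  then have yu: "letter y" "u \<in> carrier FP" "fresh y u" using v by (auto simp: Cons_FP)
  have u: "foldr lcons u w \<in> carrier FP" using FP_letters[OF yu(2)] w by (rule foldr_closed)
  have "fresh (lmul x y) u" using yu(3) fresh_cong[of y "lmul x y" u] y(2) by simp
  then have "foldr lcons (lcons x v) w = lcons (lmul x y) (foldr lcons u w)"
    using v y by (simp add: fp_cons_absorb fp_cons_fresh fp_cons_trivial)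
  then show ?thesis using fp_cons_mult[OF u x yu(1) y(2)] y by simp
qed

lemma foldr_assoc:
  assumes "\<forall>x\<in>set u. letter x" "v \<in> carrier FP" "w \<in> carrier FP"
  shows "foldr lcons (foldr lcons u v) w = foldr lcons u (foldr lcons v w)"
  using assms by (induction u) (auto simp: foldr_fp_cons)

lemma foldr_inverse:
  assumes "\<forall>x\<in>set u. letter x" "v \<in> carrier FP"
  shows "foldr lcons (rev (map inv_letter u)) (foldr lcons u v) = v"
  using assms by (induction u arbitrary: v) (auto simp: fp_cons_inv)

lemma group_FP: "group FP"
proof (rule groupI, goal_cases)
  case (1 x y)
  then show ?case by (simp add: FP_letters)
next
  case (3 x y z)
  then show ?case by (simp add: FP_letters foldr_assoc)
next
  case (5 x)
  let ?y = "foldr lcons (rev (map inv_letter x)) []"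
  have l: "\<forall>z\<in>set (rev (map inv_letter x)). letter z" using FP_letters[OF 5] by auto
  then have "?y \<otimes>\<^bsub>FP\<^esub> x = foldr lcons (rev (map inv_letter x)) x"
    using foldr_assoc[OF l Nil_FP 5] by simp
  also have "\<dots> = []"
    using foldr_inverse[OF FP_letters[OF 5] Nil_FP] foldr_Nil[OF 5] by simp
  finally show ?case using l by (intro bexI[of _ ?y]) auto
qed auto

sublocale FP: group FP by (rule group_FP)

lemma emb_mult:
  assumes "letter x" "letter y" "isl x = isl y"
  shows "lcons x [] \<otimes>\<^bsub>FP\<^esub> lcons y [] = lcons (lmul x y) []"
  using foldr_fp_cons[OF Nil_FP fp_cons_closed[OF Nil_FP assms(2)] assms(1)] fp_cons_mult[OF Nil_FP assms]
  by (simp only: mult_FP foldr.simps id_apply)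

definition inl :: "'a \<Rightarrow> ('a + 'b) list" where "inl g = lcons (Inl g) []"
definition inr :: "'b \<Rightarrow> ('a + 'b) list" where "inr t = lcons (Inr t) []"

lemma inl_hom: "inl \<in> hom G FP"
  by (rule homI) (auto simp: inl_def emb_mult simp del: fp_cons_Nil mult_FP)

lemma inr_hom: "inr \<in> hom T FP"
  by (rule homI) (auto simp: inr_def emb_mult simp del: fp_cons_Nil mult_FP)

lemma FP_induct [consumes 1, case_names Nil Inl Inr]:
  assumes "w \<in> carrier FP" "P []"
    and "\<And>g w. g \<in> carrier G \<Longrightarrow> w \<in> carrier FP \<Longrightarrow> P w \<Longrightarrow> P (inl g \<otimes>\<^bsub>FP\<^esub> w)"
    and "\<And>t w. t \<in> carrier T \<Longrightarrow> w \<in> carrier FP \<Longrightarrow> P w \<Longrightarrow> P (inr t \<otimes>\<^bsub>FP\<^esub> w)"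
  shows "P w"
  using assms(1)
proof (induction w)
  case (Cons x w)
  then have w: "w \<in> carrier FP" "P w" and x: "letter x" "\<not> trivial x" by (auto simp: Cons_FP)
  have "x # w = lcons x [] \<otimes>\<^bsub>FP\<^esub> w" using x fp_cons_reduced[OF Cons.prems] by simp
  then show ?case using assms(3)[of _ w] assms(4)[of _ w] w x unfolding inl_def inr_def
    by (cases x) (auto simp del: fp_cons_Nil mult_FP)
qed (rule assms(2))

text \<open>Used twice: to present a free product, and with the identity of \<open>G\<close> and the
  trivial map of \<open>T\<close> to obtain the retraction onto \<open>G\<close>.\<close>

lemma FP_universal:
  assumes Q: "group Q" and a: "a \<in> hom G Q" and b: "b \<in> hom T Q"
  obtains c where "c \<in> hom FP Q" "\<And>g. g \<in> carrier G \<Longrightarrow> c (inl g) = a g" "\<And>t. t \<in> carrier T \<Longrightarrow> c (inr t) = b t"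
proof
  interpret Q: group Q by (rule Q)
  interpret a: group_hom G Q a using a by unfold_locales
  interpret b: group_hom T Q b using b by unfold_locales
  define v where "v x = (case x of Inl g \<Rightarrow> a g | Inr t \<Rightarrow> b t)" for x
  define c where "c w = foldr (\<lambda>x q. v x \<otimes>\<^bsub>Q\<^esub> q) w \<one>\<^bsub>Q\<^esub>" for w
  have v: "v x \<in> carrier Q" if "letter x" for x using that by (cases x) (auto simp: v_def)
  have c: "c w \<in> carrier Q" if "\<forall>x\<in>set w. letter x" for w
    using that by (induction w) (auto simp: c_def v)
  have cC: "c (x # w) = v x \<otimes>\<^bsub>Q\<^esub> c w" for x w by (simp add: c_def)
  have vmul: "v (lmul x y) = v x \<otimes>\<^bsub>Q\<^esub> v y" if "letter x" "letter y" "isl x = isl y" for x y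
    using that by (cases x; cases y) (auto simp: v_def)
  have vtriv: "v x = \<one>\<^bsub>Q\<^esub>" if "trivial x" for x using that by (cases x) (auto simp: v_def)
  have fresh: "c (lcons x w) = v x \<otimes>\<^bsub>Q\<^esub> c w" if "fresh x w" "w \<in> carrier FP" for x w
    using that c[OF FP_letters[OF that(2)]] by (simp add: fp_cons_fresh cC vtriv)
  have fp: "c (lcons x w) = v x \<otimes>\<^bsub>Q\<^esub> c w" if x: "letter x" and w: "w \<in> carrier FP" for x w
  proof (cases "fresh x w")
    case False
    then obtain y u where y: "w = y # u" "isl x = isl y" by (cases w) (auto simp: fresh_def)
    then have yu: "letter y" "u \<in> carrier FP" "fresh y u" using w by (auto simp: Cons_FP)
    have "fresh (lmul x y) u" using yu(3) fresh_cong[of y "lmul x y" u] y(2) by simp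
    then show ?thesis
      using w x y yu v[OF x] v[OF yu(1)] c[OF FP_letters[OF yu(2)]]
      by (simp add: fp_cons_absorb fresh vmul cC Q.m_assoc)
  qed (use fresh w in blast)
  show "c \<in> hom FP Q"
  proof (rule homI)
    fix u w assume u: "u \<in> carrier FP" and w: "w \<in> carrier FP"
    have "c (foldr lcons u w) = c u \<otimes>\<^bsub>Q\<^esub> c w"
      using FP_letters[OF u]
    proof (induction u)
      case Nil
      then show ?case using c[OF FP_letters[OF w]] by (simp add: c_def)
    next
      case (Cons x u)
      then show ?case using c[OF FP_letters[OF w]] c[of u] w v[of x] by (simp add: fp cC Q.m_assoc)
    qed
    then show "c (u \<otimes>\<^bsub>FP\<^esub> w) = c u \<otimes>\<^bsub>Q\<^esub> c w" by simp
  qed (use c FP_letters in blast)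
  show "c (inl g) = a g" if "g \<in> carrier G" for g using that by (auto simp: c_def inl_def v_def)
  show "c (inr t) = b t" if "t \<in> carrier T" for t using that by (auto simp: c_def inr_def v_def)
qed

lemma weval_shift: "weval Q y (map (\<lambda>z. (fst z + n, snd z)) w) = weval Q (\<lambda>i. y (i + n)) w"
  by (induction w) auto

lemma presents_FP:
  assumes G: "presents G n R x" and T: "presents T m S z"
  shows "presents FP (n + m) (R \<union> map (\<lambda>z. (fst z + n, snd z)) ` S)
     (\<lambda>i. if i < n then inl (x i) else inr (z (i - n)))" (is "presents FP _ (R \<union> ?sh ` S) ?x")
proof -
  note Gp = presentsD[OF G] and Tp = presentsD[OF T]
  have xG: "\<forall>i<n. x i \<in> carrier G" and zT: "\<forall>i<m. z i \<in> carrier T" using Gp Tp by auto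
  have xFP: "\<forall>i<n + m. ?x i \<in> carrier FP"
    using xG zT hom_in_carrier[OF inl_hom] hom_in_carrier[OF inr_hom] by auto
  have letters: "letters (n + m) (?sh w)" if "letters m w" for w using that by fastforce
  have lettersG: "letters (n + m) w" if "letters n w" for w using that by fastforce
  have evG: "weval FP ?x w = inl (weval G x w)" if "letters n w" for w
    unfolding weval_hom[OF G.is_group FP.is_group inl_hom xG that] using that by (intro weval_cong) auto
  have evT: "weval FP ?x (?sh w) = inr (weval T z w)" if "letters m w" for w
    unfolding weval_hom[OF T.is_group FP.is_group inr_hom zT that] weval_shift using that by (intro weval_cong) auto
  show ?thesis unfolding presents_def
  proof (intro conjI ballI allI impI; (elim conjE)?)
    show "finite (R \<union> ?sh ` S)" using Gp Tp by simp
    show "?x i \<in> carrier FP" if "i < n + m" for i using xFP that by blast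
    fix r assume "r \<in> R \<union> ?sh ` S"
    then show "letters (n + m) r" using letters lettersG Gp(4) Tp(4) by blast
    show "weval FP ?x r = \<one>\<^bsub>FP\<^esub>"
      using \<open>r \<in> R \<union> ?sh ` S\<close> evG evT Gp(4,5) Tp(4,5) by (auto simp: inl_def inr_def)
  next
    fix h assume "h \<in> carrier FP"
    then show "\<exists>w. letters (n + m) w \<and> h = weval FP ?x w"
    proof (induction h rule: FP_induct)
      case Nil
      then show ?case by (intro exI[of _ "[]"]) simp
    next
      case (Inl g w)
      obtain u where u: "letters n u" "g = weval G x u" using Gp(6)[OF Inl(1)] by blast
      obtain v where v: "letters (n + m) v" "w = weval FP ?x v" using Inl(3) by blast
      show ?case
        using u v evG[of u] lettersG[of u] FP.weval_append[OF xFP, of u v] by (intro exI[of _ "u @ v"]) auto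
    next
      case (Inr g w)
      obtain u where u: "letters m u" "g = weval T z u" using Tp(6)[OF Inr(1)] by blast
      obtain v where v: "letters (n + m) v" "w = weval FP ?x v" using Inr(3) by blast
      have "letters (n + m) (?sh u @ v)" using letters[OF u(1)] v(1) by (simp only: set_append image_Un Un_subset_iff)
      moreover have "inr g \<otimes>\<^bsub>FP\<^esub> w = weval FP ?x (?sh u @ v)"
        unfolding FP.weval_append[OF xFP letters[OF u(1)] v(1)] evT[OF u(1)] using u v by simp
      ultimately show ?case by blast
    qed
  next
    fix Q :: "nat list set monoid" and y
    assume Q: "group Q" "\<forall>i<n + m. y i \<in> carrier Q" "\<forall>r\<in>R \<union> ?sh ` S. weval Q y r = \<one>\<^bsub>Q\<^esub>"
    obtain a where a: "a \<in> hom G Q" "\<forall>i<n. a (x i) = y i"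
      by (rule presents_universal[OF G Q(1), of y]) (use Q in auto)
    have S: "weval Q (\<lambda>i. y (i + n)) r = \<one>\<^bsub>Q\<^esub>" if "r \<in> S" for r
      using Q(3) that weval_shift[of Q y n r] by force
    obtain b where b: "b \<in> hom T Q" "\<forall>i<m. b (z i) = y (i + n)"
      by (rule presents_universal[OF T Q(1), of "\<lambda>i. y (i + n)"]) (use Q S in auto)
    obtain c where c: "c \<in> hom FP Q" "\<And>g. g \<in> carrier G \<Longrightarrow> c (inl g) = a g" "\<And>t. t \<in> carrier T \<Longrightarrow> c (inr t) = b t"
      using FP_universal[OF Q(1) a(1) b(1)] by blast
    show "\<exists>\<theta>\<in>hom FP Q. \<forall>i<n + m. \<theta> (?x i) = y i"
      using c a b xG zT by (intro bexI[of _ c]) auto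
  qed (rule FP.is_group)
qed

end

lemma finitely_presentable_free_product:
  assumes "finitely_presentable G" "finitely_presentable T"
  shows "\<exists>n R x. presents (free_product G T) n R x"
proof -
  interpret free_product_groups G T
    using assms by (simp add: free_product_groups_def finitely_presentable_def)
  show ?thesis using finitely_presentable_presents[OF assms(1)] finitely_presentable_presents[OF assms(2)] presents_FP
    by blast
qed

section \<open>The presentation complex\<close>

text \<open>A generator \<open>i\<close> is the loop \<open>Base - Fst i - Snd i - Base\<close>. The disk of relator \<open>r\<close> is an annulus
  between its boundary walk and the rim \<open>Rim r 0, Rim r 1, \<dots>\<close>, coned off at \<open>Hub r\<close>; the rim keeps
  the triangles apart although the walk repeats vertices. The slit between the two ends of the rim
  is closed by the edge from \<open>Hub r\<close> to \<open>Base\<close>.\<close>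

datatype vx = Base | Fst nat | Snd nat | Rim nat nat | Hub nat

instance vx :: countable
  by countable_datatype

fun corners :: "(nat \<times> bool) list \<Rightarrow> vx list" where
  "corners [] = []"
| "corners ((i, b) # w) = (if b then [Snd i, Fst i, Base] else [Fst i, Snd i, Base]) @ corners w"

definition walk :: "(nat \<times> bool) list \<Rightarrow> vx list" where
  "walk w = Base # corners w"

lemma last_walk: "last (walk w) = Base"
  by (induction w rule: corners.induct) (auto simp: walk_def)

definition loop_edges :: "nat \<Rightarrow> vx set set" where
  "loop_edges i = {{Base, Fst i}, {Base, Snd i}, {Fst i, Snd i}}"

lemma successively_walk:
  "letters n w \<Longrightarrow> successively (\<lambda>u v. \<exists>i<n. {u, v} \<in> loop_edges i) (walk w)"
  by (induction w rule: corners.induct) (auto simp: walk_def loop_edges_def insert_commute)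

fun vprod :: "('q, 'e) monoid_scheme \<Rightarrow> (vx \<Rightarrow> vx \<Rightarrow> 'q) \<Rightarrow> vx list \<Rightarrow> 'q" where
  "vprod Q m (u # v # p) = m u v \<otimes>\<^bsub>Q\<^esub> vprod Q m (v # p)"
| "vprod Q m _ = \<one>\<^bsub>Q\<^esub>"

lemma vprod_cong:
  "successively (\<lambda>u v. m u v = m' u v) p \<Longrightarrow> vprod Q m p = vprod Q m' p"
  by (induction p rule: induct_list012) auto

lemma (in group) vprod_closed:
  "successively (\<lambda>u v. m u v \<in> carrier G) p \<Longrightarrow> vprod G m p \<in> carrier G"
  by (induction p rule: induct_list012) auto

lemma successively_drop: "successively P p \<Longrightarrow> successively P (drop k p)"
  by (simp add: successively_conv_nth)

locale presentation_complex =
  fixes n :: nat and rs :: "(nat \<times> bool) list list"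
  assumes letters: "r \<in> set rs \<Longrightarrow> letters n r" and nonempty: "rs \<noteq> []"
begin

definition len :: "nat \<Rightarrow> nat" where "len r = length (corners (rs ! r))"

definition corner :: "nat \<Rightarrow> nat \<Rightarrow> vx" where "corner r k = walk (rs ! r) ! k"

definition facets :: "vx set set" where
  "facets = (\<Union>i<n. loop_edges i) \<union>
     (\<Union>r<length rs. {{Hub r, Rim r 0, Base}, {Hub r, Rim r (len r), Base}} \<union>
       (\<Union>k<len r. {{corner r k, corner r (Suc k), Rim r k},
                     {corner r (Suc k), Rim r k, Rim r (Suc k)},
                     {Rim r k, Rim r (Suc k), Hub r}}))"

lemma facetsI:
  "i < n \<Longrightarrow> f \<in> loop_edges i \<Longrightarrow> f \<in> facets"
  "r < length rs \<Longrightarrow> {Hub r, Rim r 0, Base} \<in> facets"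
  "r < length rs \<Longrightarrow> {Hub r, Rim r (len r), Base} \<in> facets"
  "r < length rs \<Longrightarrow> k < len r \<Longrightarrow> {corner r k, corner r (Suc k), Rim r k} \<in> facets"
  "r < length rs \<Longrightarrow> k < len r \<Longrightarrow> {corner r (Suc k), Rim r k, Rim r (Suc k)} \<in> facets"
  "r < length rs \<Longrightarrow> k < len r \<Longrightarrow> {Rim r k, Rim r (Suc k), Hub r} \<in> facets"
  unfolding facets_def by blast+

lemma facets_cases:
  assumes "f \<in> facets"
  obtains i where "i < n" "f \<in> loop_edges i"
  | r where "r < length rs" "f = {Hub r, Rim r 0, Base}"
  | r where "r < length rs" "f = {Hub r, Rim r (len r), Base}"
  | r k where "r < length rs" "k < len r" "f = {corner r k, corner r (Suc k), Rim r k}"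
  | r k where "r < length rs" "k < len r" "f = {corner r (Suc k), Rim r k, Rim r (Suc k)}"
  | r k where "r < length rs" "k < len r" "f = {Rim r k, Rim r (Suc k), Hub r}"
  using assms unfolding facets_def by blast

lemma letters_nth: "r < length rs \<Longrightarrow> letters n (rs ! r)"
  by (rule letters) simp

lemma corner_edge:
  assumes "r < length rs" "k < len r"
  shows "\<exists>i<n. {corner r k, corner r (Suc k)} \<in> loop_edges i"
  using successively_walk[OF letters_nth[OF assms(1)]] assms(2)
  by (simp add: successively_conv_nth corner_def len_def walk_def)

lemma corner_0 [simp]: "corner r 0 = Base"
  by (simp add: corner_def walk_def)

lemma corner_len [simp]: "corner r (len r) = Base"
  using last_walk[of "rs ! r"] last_conv_nth[of "walk (rs ! r)"]
  by (simp add: corner_def len_def walk_def)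

lemma drop_walk: "k \<le> len r \<Longrightarrow> drop k (walk (rs ! r)) = corner r k # drop (Suc k) (walk (rs ! r))"
  unfolding corner_def len_def by (rule Cons_nth_drop_Suc[symmetric]) (simp add: walk_def)

lemma drop_walk_len: "drop (len r) (walk (rs ! r)) = [Base]"
  using drop_walk[of "len r" r] corner_len[of r] by (simp add: len_def walk_def del: corner_len)

definition cplx :: "nat set set" where
  "cplx = {to_nat ` s | s. s \<noteq> {} \<and> (\<exists>f\<in>facets. s \<subseteq> f)}"

lemma cplx_iff: "to_nat ` s \<in> cplx \<longleftrightarrow> s \<noteq> {} \<and> (\<exists>f\<in>facets. s \<subseteq> f)"
proof -
  have "(to_nat ` s = to_nat ` t) = (s = t)" for s t :: "vx set"
    by (rule inj_image_eq_iff) simp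
  then show ?thesis unfolding cplx_def by auto
qed

lemma facet_finite_card: "f \<in> facets \<Longrightarrow> finite f \<and> card f \<le> 3"
  by (erule facets_cases) (auto simp: loop_edges_def card_insert_if)

lemma finite_facets: "finite facets"
  by (auto simp: facets_def loop_edges_def)

lemma simplicial_complex_cplx: "simplicial_complex cplx"
proof -
  have "cplx \<subseteq> (\<Union>f\<in>facets. (`) to_nat ` Pow f)" unfolding cplx_def by blast
  then have "finite cplx"
    by (rule finite_subset) (use finite_facets facet_finite_card in auto)
  moreover have "t \<in> cplx" if "s \<in> cplx" "t \<subseteq> s" "t \<noteq> {}" for s t
  proof -
    obtain a f where "s = to_nat ` a" "a \<subseteq> f" "f \<in> facets" using \<open>s \<in> cplx\<close> unfolding cplx_def by blast
    then obtain b where "t = to_nat ` b" "b \<subseteq> a" using \<open>t \<subseteq> s\<close> by (auto simp: subset_image_iff)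
    then show ?thesis using that \<open>a \<subseteq> f\<close> \<open>f \<in> facets\<close> unfolding cplx_def by blast
  qed
  moreover have "finite s \<and> s \<noteq> {}" if "s \<in> cplx" for s
    using that facet_finite_card unfolding cplx_def by (auto intro: finite_subset)
  ultimately show ?thesis unfolding simplicial_complex_def by blast
qed

lemma dimension_two_cplx: "dimension_two cplx"
proof -
  have "card s \<le> 3" if s: "s \<in> cplx" for s
  proof -
    obtain a f where "s = to_nat ` a" "a \<subseteq> f" "f \<in> facets" using s unfolding cplx_def by blast
    then show ?thesis using facet_finite_card[of f] card_mono[of f a] card_image_le[of a to_nat]
      by (auto dest: finite_subset)
  qed
  moreover have "to_nat ` {Hub 0, Rim 0 0, Base} \<in> cplx"
    using facetsI(2)[of 0] nonempty unfolding cplx_iff by blast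
  moreover have "card (to_nat ` {Hub 0, Rim 0 0, Base}) = 3"
    by (subst card_image) (auto intro: inj_on_subset)
  ultimately show ?thesis unfolding dimension_two_def by blast
qed

definition vlabeling :: "('q, 'e) monoid_scheme \<Rightarrow> (vx \<Rightarrow> vx \<Rightarrow> 'q) \<Rightarrow> bool" where
  "vlabeling Q m \<longleftrightarrow> (\<forall>f\<in>facets. \<forall>u\<in>f. \<forall>v\<in>f. \<forall>w\<in>f. m u v \<in> carrier Q \<and> m u v \<otimes>\<^bsub>Q\<^esub> m v w = m u w)"

lemma in_range: "{u} \<in> cplx \<Longrightarrow> \<exists>a. u = to_nat (a :: vx)"
  unfolding cplx_def by auto

lemma labeling_vlabeling:
  "vlabeling Q m \<Longrightarrow> labeling cplx Q (\<lambda>u v. m (from_nat u) (from_nat v))"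
proof -
  assume m: "vlabeling Q m"
  have "\<exists>f\<in>facets. \<exists>a\<in>f. \<exists>b\<in>f. \<exists>c\<in>f. u = to_nat a \<and> v = to_nat b \<and> w = to_nat c"
    if uvw: "{u, v, w} \<in> cplx" for u v w
  proof -
    have "{u} \<in> cplx" "{v} \<in> cplx" "{w} \<in> cplx"
      by (rule simplicial_complex_subset[OF simplicial_complex_cplx uvw]; auto)+
    then obtain a b c :: vx where abc: "u = to_nat a" "v = to_nat b" "w = to_nat c"
      using in_range by blast
    then have "to_nat ` {a, b, c} \<in> cplx" using uvw by simp
    then show ?thesis unfolding cplx_iff using abc by blast
  qed
  then have *: "m (from_nat u) (from_nat v) \<in> carrier Q \<and>
      m (from_nat u) (from_nat v) \<otimes>\<^bsub>Q\<^esub> m (from_nat v) (from_nat w) = m (from_nat u) (from_nat w)"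
    if "{u, v, w} \<in> cplx" for u v w
    using that m unfolding vlabeling_def by fastforce
  show ?thesis unfolding labeling_def
  proof (intro conjI allI impI)
    fix u v assume "{u, v} \<in> cplx"
    then show "m (from_nat u) (from_nat v) \<in> carrier Q" using *[of u v v] by simp
  qed (use * in blast)
qed

lemma vlabeling_labeling:
  assumes "labeling cplx Q l"
  shows "vlabeling Q (\<lambda>u v. l (to_nat u) (to_nat v))"
  unfolding vlabeling_def
proof (intro ballI)
  fix f u v w assume f: "f \<in> facets" "u \<in> f" "v \<in> f" "w \<in> f"
  then have "to_nat ` {u, v, w} \<in> cplx" "to_nat ` {u, v} \<in> cplx" unfolding cplx_iff by blast+
  then have "{to_nat u, to_nat v, to_nat w} \<in> cplx" "{to_nat u, to_nat v} \<in> cplx" by simp_all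
  then show "l (to_nat u) (to_nat v) \<in> carrier Q \<and>
      l (to_nat u) (to_nat v) \<otimes>\<^bsub>Q\<^esub> l (to_nat v) (to_nat w) = l (to_nat u) (to_nat w)"
    using assms unfolding labeling_def by blast
qed

text \<open>The edges with prescribed trivial label form a spanning tree, the one described by
  \<open>tree_path\<close>. A labeling normalized in this way is the same thing as a choice of
  generator images that satisfies the relators.\<close>

definition normalized :: "('q, 'e) monoid_scheme \<Rightarrow> (vx \<Rightarrow> vx \<Rightarrow> 'q) \<Rightarrow> bool" where
  "normalized Q m \<longleftrightarrow> vlabeling Q m \<and> (\<forall>i<n. m Base (Fst i) = \<one>\<^bsub>Q\<^esub> \<and> m Base (Snd i) = \<one>\<^bsub>Q\<^esub>) \<and>
     (\<forall>r<length rs. m Base (Hub r) = \<one>\<^bsub>Q\<^esub> \<and> (\<forall>k\<le>len r. m (Hub r) (Rim r k) = \<one>\<^bsub>Q\<^esub>))"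

end

section \<open>Labelings that are trivial on the spanning tree\<close>

locale normalized_labeling = presentation_complex n rs + Q: group Q
  for n rs and Q :: "('q, 'e) monoid_scheme" (structure) +
  fixes m :: "vx \<Rightarrow> vx \<Rightarrow> 'q"
  assumes normalized: "normalized Q m"
begin

lemma closed: "f \<in> facets \<Longrightarrow> u \<in> f \<Longrightarrow> v \<in> f \<Longrightarrow> m u v \<in> carrier Q"
  using normalized unfolding normalized_def vlabeling_def by blast

lemma mult: "f \<in> facets \<Longrightarrow> u \<in> f \<Longrightarrow> v \<in> f \<Longrightarrow> w \<in> f \<Longrightarrow> m u v \<otimes> m v w = m u w"
  using normalized unfolding normalized_def vlabeling_def by blast

lemma refl1: "f \<in> facets \<Longrightarrow> u \<in> f \<Longrightarrow> m u u = \<one>"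
  using mult[of f u u u] closed[of f u u] by (simp add: Q.r_cancel_one')

lemma sym: "f \<in> facets \<Longrightarrow> u \<in> f \<Longrightarrow> v \<in> f \<Longrightarrow> m v u = inv (m u v)"
  using mult[of f v u v] refl1[of f v] closed[of f]
  by (intro Q.inv_equality[symmetric]) auto

lemma from_center:
  assumes "f \<in> facets" "c \<in> f" "u \<in> f" "v \<in> f"
  shows "m u v = inv (m c u) \<otimes> m c v"
  using mult[of f u c v] sym[of f c u] assms by simp

lemma tree: "i < n \<Longrightarrow> m Base (Fst i) = \<one>" "i < n \<Longrightarrow> m Base (Snd i) = \<one>"
  "r < length rs \<Longrightarrow> m Base (Hub r) = \<one>" "r < length rs \<Longrightarrow> k \<le> len r \<Longrightarrow> m (Hub r) (Rim r k) = \<one>"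
  using normalized unfolding normalized_def by blast+

lemma tree': "i < n \<Longrightarrow> m (Fst i) Base = \<one>" "i < n \<Longrightarrow> m (Snd i) Base = \<one>"
  "i < n \<Longrightarrow> m (Snd i) (Fst i) = inv (m (Fst i) (Snd i))"
  using sym[OF facetsI(1)[of i "{Base, Fst i}"], of Base "Fst i"] tree(1)[of i]
    sym[OF facetsI(1)[of i "{Base, Snd i}"], of Base "Snd i"] tree(2)[of i]
    sym[OF facetsI(1)[of i "{Fst i, Snd i}"], of "Fst i" "Snd i"]
  by (auto simp: loop_edges_def)

lemma generator_closed: "i < n \<Longrightarrow> m (Fst i) (Snd i) \<in> carrier Q"
  by (rule closed[OF facetsI(1)[of i "{Fst i, Snd i}"]]) (auto simp: loop_edges_def)

lemma hub_base: "r < length rs \<Longrightarrow> m (Hub r) Base = \<one>"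
  using sym[OF facetsI(2)[of r], of Base "Hub r"] tree(3)[of r] by simp

text \<open>The hub triangles make the rim edges trivial, so a quadrilateral of the annulus carries
  the spoke at corner \<open>k\<close> to the spoke at corner \<open>k + 1\<close> through one
  boundary edge.\<close>

lemma rim_step:
  assumes "r < length rs" "k < len r"
  shows "m (Rim r k) (corner r k) \<otimes> m (corner r k) (corner r (Suc k)) = m (Rim r (Suc k)) (corner r (Suc k))"
proof -
  have "m (Rim r k) (Rim r (Suc k)) = \<one>"
    using from_center[OF facetsI(6)[OF assms], of "Hub r" "Rim r k" "Rim r (Suc k)"] tree(4) assms by simp
  then have "m (Rim r k) (corner r (Suc k)) = m (Rim r (Suc k)) (corner r (Suc k))"
    using mult[OF facetsI(5)[OF assms], of "Rim r k" "Rim r (Suc k)" "corner r (Suc k)"]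
      closed[OF facetsI(5)[OF assms], of "Rim r (Suc k)" "corner r (Suc k)"] by simp
  then show ?thesis
    using mult[OF facetsI(4)[OF assms], of "Rim r k" "corner r k" "corner r (Suc k)"] by simp
qed

lemma rim_base: "r < length rs \<Longrightarrow> m (Rim r 0) Base = \<one>" "r < length rs \<Longrightarrow> m (Rim r (len r)) Base = \<one>"
  using from_center[OF facetsI(2)[of r], of "Hub r" "Rim r 0" Base]
    from_center[OF facetsI(3)[of r], of "Hub r" "Rim r (len r)" Base] tree(4)[of r] hub_base[of r] by auto

lemma loop_closed: "i < n \<Longrightarrow> {u, v} \<in> loop_edges i \<Longrightarrow> m u v \<in> carrier Q"
  by (rule closed[OF facetsI(1)[of i "{u, v}"]]) auto

lemma walk_closed:
  assumes "r < length rs"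
  shows "vprod Q m (drop k (walk (rs ! r))) \<in> carrier Q"
proof (rule Q.vprod_closed)
  show "successively (\<lambda>u v. m u v \<in> carrier Q) (drop k (walk (rs ! r)))"
    using successively_drop[OF successively_walk[OF letters_nth[OF assms]], of k]
    by (rule successively_mono) (use loop_closed in blast)
qed

lemma rim_corner_closed:
  assumes "r < length rs" "k \<le> len r"
  shows "m (Rim r k) (corner r k) \<in> carrier Q"
  using assms closed[OF facetsI(4)[of r k], of "Rim r k" "corner r k"]
    rim_base(2)[of r] by (cases "k = len r") auto

text \<open>Unrolls the annulus backwards from its end at \<open>len r\<close>, where the spoke is
  trivial: each spoke is inverse to what remains of the boundary walk. At \<open>k = 0\<close> the
  spoke is trivial again, and this is the relation.\<close>

lemma rim_corner_walk:
  assumes r: "r < length rs" and "k \<le> len r"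
  shows "m (Rim r k) (corner r k) \<otimes> vprod Q m (drop k (walk (rs ! r))) = \<one>"
  using assms(2)
proof (induction k rule: inc_induct)
  case base
  then show ?case using r by (simp add: drop_walk_len rim_base)
next
  case (step k)
  have d: "vprod Q m (drop k (walk (rs ! r))) =
      m (corner r k) (corner r (Suc k)) \<otimes> vprod Q m (drop (Suc k) (walk (rs ! r)))"
    using step drop_walk[of k r] drop_walk[of "Suc k" r] by simp
  have "m (corner r k) (corner r (Suc k)) \<in> carrier Q"
    using corner_edge[OF r step(2)] loop_closed by blast
  then show ?case
    using step.IH rim_step[OF r step(2)] rim_corner_closed[OF r, of k] step(2) walk_closed[OF r, of "Suc k"]
    unfolding d by (simp flip: Q.m_assoc)
qed

lemma rim_corner:
  assumes "r < length rs" "k \<le> len r"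
  shows "m (Rim r k) (corner r k) = inv (vprod Q m (drop k (walk (rs ! r))))"
  using rim_corner_walk[OF assms] walk_closed[OF assms(1)] rim_corner_closed[OF assms]
  by (intro Q.inv_equality[symmetric]) auto

lemma vprod_walk:
  assumes "letters n w"
  shows "vprod Q m (walk w) = weval Q (\<lambda>i. m (Fst i) (Snd i)) w"
  using assms
proof (induction w rule: corners.induct)
  case (2 i b w)
  then have "i < n" "letters n w" by auto
  moreover have "weval Q (\<lambda>i. m (Fst i) (Snd i)) w \<in> carrier Q"
    using \<open>letters n w\<close> generator_closed by (intro Q.weval_closed[of n]) auto
  ultimately show ?case
    using 2 tree tree' generator_closed[of i] by (auto simp: walk_def)
qed (simp add: walk_def)

lemma relator:
  assumes "r \<in> set rs"
  shows "weval Q (\<lambda>i. m (Fst i) (Snd i)) r = \<one>"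
proof -
  obtain j where j: "j < length rs" "r = rs ! j" using assms by (auto simp: in_set_conv_nth)
  then show ?thesis
    using rim_corner_walk[OF j(1), of 0] walk_closed[OF j(1), of 0] rim_base(1)[OF j(1)]
      vprod_walk[OF letters[OF assms]] by simp
qed

end

text \<open>The generator edges determine the boundary walks, these determine the spokes by
  \<open>rim_corner\<close>, and in each facet the labels from one vertex determine the rest. It
  identifies \<open>canon\<close> with the image of the labels in the presented group.\<close>

lemma (in presentation_complex) normalized_unique:
  assumes "group Q" "normalized Q m" "normalized Q m'"
    and gen: "\<And>i. i < n \<Longrightarrow> m (Fst i) (Snd i) = m' (Fst i) (Snd i)"
    and f: "f \<in> facets" "u \<in> f" "v \<in> f"
  shows "m u v = m' u v"
proof -
  interpret group Q by fact
  interpret m: normalized_labeling n rs Q m by unfold_locales fact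
  interpret m': normalized_labeling n rs Q m' by unfold_locales fact
  have center: "m u v = m' u v" if "f \<in> facets" "c \<in> f" "\<And>v. v \<in> f \<Longrightarrow> m c v = m' c v" "u \<in> f" "v \<in> f" for f c u v
    using m.from_center[of f c u v] m'.from_center[of f c u v] that by simp
  have loops: "m u v = m' u v" if i: "i < n" "{u, v} \<in> loop_edges i" for i u v
  proof -
    have "u \<in> {Base, Fst i, Snd i} \<and> v \<in> {Base, Fst i, Snd i} \<and> u \<noteq> v"
      using i(2) by (auto simp: loop_edges_def doubleton_eq_iff)
    then show ?thesis using i m.tree m'.tree m.tree' m'.tree' gen by auto
  qed
  have refl: "m v v = m' v v" if "f \<in> facets" "v \<in> f" for f v
    using that m.refl1 m'.refl1 by simp
  have walk: "vprod Q m (drop k (walk (rs ! r))) = vprod Q m' (drop k (walk (rs ! r)))" if "r < length rs" for r k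
  proof (rule vprod_cong)
    show "successively (\<lambda>u v. m u v = m' u v) (drop k (walk (rs ! r)))"
      using successively_drop[OF successively_walk[OF letters_nth[OF that]], of k]
      by (rule successively_mono) (use loops in blast)
  qed
  have rim: "m (Rim r k) (corner r k) = m' (Rim r k) (corner r k)" if "r < length rs" "k \<le> len r" for r k
    using m.rim_corner[OF that] m'.rim_corner[OF that] walk[OF that(1)] by simp
  have rim': "m (Rim r k) (corner r (Suc k)) = m' (Rim r k) (corner r (Suc k))" if k: "r < length rs" "k < len r" for r k
    using m.mult[OF facetsI(4)[OF k], of "Rim r k" "corner r k" "corner r (Suc k)"]
      m'.mult[OF facetsI(4)[OF k], of "Rim r k" "corner r k" "corner r (Suc k)"]
      rim[of r k] corner_edge[OF k] loops k by auto
  have hub: "m (Hub r) (Rim r k) = m' (Hub r) (Rim r k)" if "r < length rs" "k \<le> len r" for r k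
    using m.tree(4) m'.tree(4) that by simp
  have by_center: "m u v = m' u v" if "c \<in> f" "\<forall>v\<in>f. m c v = m' c v" for c
    by (rule center[OF f(1) that(1) _ f(2,3)]) (use that(2) in blast)
  from f(1) show ?thesis
  proof (cases rule: facets_cases)
    case (1 i)
    then have "{u, v} \<in> loop_edges i \<or> u = v" using f by (auto simp: loop_edges_def insert_commute)
    then show ?thesis using loops[OF 1(1)] refl[OF f(1,2)] by metis
  next
    case (2 r)
    show ?thesis
      by (rule by_center[of "Hub r"])
        (use 2 hub[of r 0] m.hub_base m'.hub_base refl[OF f(1), of "Hub r"] in auto)
  next
    case (3 r)
    show ?thesis
      by (rule by_center[of "Hub r"])
        (use 3 hub[of r "len r"] m.hub_base m'.hub_base refl[OF f(1), of "Hub r"] in auto)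
  next
    case (4 r k)
    show ?thesis
      by (rule by_center[of "Rim r k"]) (use 4 rim[of r k] rim'[of r k] refl[OF f(1), of "Rim r k"] in auto)
  next
    case (5 r k)
    have "m (Rim r k) (Rim r (Suc k)) = m' (Rim r k) (Rim r (Suc k))"
      by (rule center[OF facetsI(6)[OF 5(1,2)], of "Hub r"])
        (use 5 hub[of r k] hub[of r "Suc k"] refl[OF facetsI(6)[OF 5(1,2)], of "Hub r"] in auto)
    then show ?thesis
      by (intro by_center[of "Rim r k"]) (use 5 rim'[of r k] refl[OF f(1), of "Rim r k"] in auto)
  next
    case (6 r k)
    show ?thesis
      by (rule by_center[of "Hub r"])
        (use 6 hub[of r k] hub[of r "Suc k"] refl[OF f(1), of "Hub r"] in auto)
  qed
qed

section \<open>The labeling by the presented group\<close>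

locale presentation_labels = presentation_complex n rs + group H
  for n rs and H :: "('a, 'c) monoid_scheme" (structure) +
  fixes x :: "nat \<Rightarrow> 'a"
  assumes x_closed: "\<And>i. x i \<in> carrier H"
    and x_rel: "\<And>r. r \<in> set rs \<Longrightarrow> weval H x r = \<one>"
begin

fun ell0 :: "vx \<Rightarrow> vx \<Rightarrow> 'a" where
  "ell0 (Fst i) (Snd j) = (if i = j then x i else \<one>)"
| "ell0 (Snd i) (Fst j) = (if i = j then inv (x i) else \<one>)"
| "ell0 _ _ = \<one>"

text \<open>The element by which the base point of the disk of a relator, lifted to the universal
  cover, differs from its \<open>k\<close>-th boundary corner.\<close>

definition shift :: "nat \<Rightarrow> nat \<Rightarrow> 'a" where
  "shift r k = inv (vprod H ell0 (drop k (walk (rs ! r))))"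

text \<open>Consecutive corners differ by \<open>corner_neq\<close>, so the two cases do not
  compete. For \<open>k = len r\<close> the second index runs past the end of the walk, but the only
  corner joined to that rim vertex is \<open>Base\<close>, which the first case catches.\<close>

definition pos :: "nat \<Rightarrow> nat \<Rightarrow> vx \<Rightarrow> 'a" where
  "pos r k u = (if u = corner r k then shift r k else if u = corner r (Suc k) then shift r (Suc k) else \<one>)"

fun ell :: "vx \<Rightarrow> vx \<Rightarrow> 'a" where
  "ell (Rim r k) (Rim _ _) = \<one>"
| "ell (Rim r k) (Hub _) = \<one>"
| "ell (Hub _) (Rim _ _) = \<one>"
| "ell (Rim r k) u = pos r k u"
| "ell u (Rim r k) = inv (pos r k u)"
| "ell u v = ell0 u v"

lemma ell0_closed: "ell0 u v \<in> carrier H"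
  by (induction u v rule: ell0.induct) (auto simp: x_closed)

lemma ell0_sym: "ell0 v u = inv (ell0 u v)"
  by (cases u; cases v) (auto simp: x_closed)

lemma ell0_refl [simp]: "ell0 u u = \<one>"
  by (cases u) auto

lemma vprod_ell0_closed: "vprod H ell0 p \<in> carrier H"
  by (induction p rule: induct_list012) (auto simp: ell0_closed)

lemma shift_closed [simp]: "shift r k \<in> carrier H"
  by (simp add: shift_def vprod_ell0_closed)

lemma weval_x_closed: "weval H x w \<in> carrier H"
  by (induction w) (auto simp: x_closed)

lemma vprod_ell0_walk: "vprod H ell0 (walk w) = weval H x w"
  by (induction w rule: corners.induct) (auto simp: walk_def x_closed weval_x_closed)

lemma shift_0: "r < length rs \<Longrightarrow> shift r 0 = \<one>"
  by (simp add: shift_def vprod_ell0_walk x_rel)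

lemma shift_len: "shift r (len r) = \<one>"
  by (simp add: shift_def drop_walk_len)

lemma shift_Suc:
  assumes "k < len r"
  shows "ell0 (corner r k) (corner r (Suc k)) = inv (shift r k) \<otimes> shift r (Suc k)"
proof -
  have "vprod H ell0 (drop k (walk (rs ! r))) =
      ell0 (corner r k) (corner r (Suc k)) \<otimes> vprod H ell0 (drop (Suc k) (walk (rs ! r)))"
    using assms drop_walk[of k r] drop_walk[of "Suc k" r] by simp
  then show ?thesis by (simp add: shift_def vprod_ell0_closed ell0_closed m_assoc)
qed

lemma corner_neq:
  assumes "r < length rs" "k < len r"
  shows "corner r k \<noteq> corner r (Suc k)"
  using corner_edge[OF assms] by (auto simp: loop_edges_def doubleton_eq_iff)

lemma corner_loop:
  assumes "r < length rs" "k \<le> len r"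
  shows "corner r k = Base \<or> (\<exists>i<n. corner r k = Fst i \<or> corner r k = Snd i)"
proof (cases k)
  case (Suc j)
  then show ?thesis using corner_edge[of r j] assms by (auto simp: loop_edges_def doubleton_eq_iff)
qed simp

lemma ell_rim: "r < length rs \<Longrightarrow> k < len r \<Longrightarrow> ell (Rim r k) (corner r k) = shift r k"
  "r < length rs \<Longrightarrow> k < len r \<Longrightarrow> ell (Rim r k) (corner r (Suc k)) = shift r (Suc k)"
  "r < length rs \<Longrightarrow> k \<le> len r \<Longrightarrow> ell (Rim r k) (corner r k) = shift r k"
  "r < length rs \<Longrightarrow> k < len r \<Longrightarrow> ell (corner r k) (Rim r k) = inv (shift r k)"
  "r < length rs \<Longrightarrow> k < len r \<Longrightarrow> ell (corner r (Suc k)) (Rim r k) = inv (shift r (Suc k))"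
  "r < length rs \<Longrightarrow> k \<le> len r \<Longrightarrow> ell (corner r k) (Rim r k) = inv (shift r k)"
  using corner_loop[of r k] corner_loop[of r "Suc k"] corner_neq[of r k] by (auto simp: pos_def)

lemma ell_corners:
  assumes "r < length rs" "k \<le> len r" "j \<le> len r"
  shows "ell (corner r k) (corner r j) = ell0 (corner r k) (corner r j)"
  using corner_loop[of r k] corner_loop[of r j] assms by auto

text \<open>Labels that come from a potential \<open>p\<close> on the facet are automatically flat
  there; each case of \<open>ell_facet\<close> only has to name the potential.\<close>

lemma by_positions:
  assumes "\<And>u. u \<in> f \<Longrightarrow> p u \<in> carrier H" "\<And>u v. u \<in> f \<Longrightarrow> v \<in> f \<Longrightarrow> ell u v = inv (p u) \<otimes> p v"
  shows "\<forall>u\<in>f. \<forall>v\<in>f. \<forall>w\<in>f. ell u v \<in> carrier H \<and> ell u v \<otimes> ell v w = ell u w"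
proof (intro ballI)
  fix u v w assume f: "u \<in> f" "v \<in> f" "w \<in> f"
  have "p v \<otimes> (inv (p v) \<otimes> p w) = p w"
    using f assms(1) by (simp flip: m_assoc)
  then have "inv (p u) \<otimes> p v \<otimes> (inv (p v) \<otimes> p w) = inv (p u) \<otimes> p w"
    using f assms(1) by (simp add: m_assoc)
  then show "ell u v \<in> carrier H \<and> ell u v \<otimes> ell v w = ell u w"
    using f assms by simp
qed

lemma ell_facet:
  assumes "f \<in> facets"
  shows "\<forall>u\<in>f. \<forall>v\<in>f. \<forall>w\<in>f. ell u v \<in> carrier H \<and> ell u v \<otimes> ell v w = ell u w"
  using assms
proof (cases rule: facets_cases)
  case (1 i)
  \<comment> \<open>The loop of generator \<open>i\<close> has total label \<open>x i\<close>, so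
    its three edges admit no common potential; one is chosen for each edge separately.\<close>
  show ?thesis
    by (rule by_positions[where p = "\<lambda>u. if f = {Fst i, Snd i} \<and> u = Snd i then x i else \<one>"])
      (use 1 x_closed in \<open>auto simp: loop_edges_def doubleton_eq_iff\<close>)
next
  case (2 r)
  have "corner r 0 = Base" by simp
  then have "ell (Rim r 0) Base = \<one>" "ell Base (Rim r 0) = \<one>"
    using ell_rim(3)[of r 0] ell_rim(6)[of r 0] 2 by (auto simp: shift_0)
  then show ?thesis by (intro by_positions[where p = "\<lambda>u. \<one>"]) (use 2 in \<open>auto simp: shift_0\<close>)
next
  case (3 r)
  have "ell (Rim r (len r)) Base = \<one>" "ell Base (Rim r (len r)) = \<one>"
    using ell_rim(3)[of r "len r"] ell_rim(6)[of r "len r"] 3 by (auto simp: shift_len)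
  then show ?thesis by (intro by_positions[where p = "\<lambda>u. \<one>"]) (use 3 in \<open>auto simp: shift_len\<close>)
next
  case (4 r k)
  have ne: "corner r k \<noteq> Rim r k" "corner r (Suc k) \<noteq> Rim r k" "corner r k \<noteq> corner r (Suc k)"
    using corner_loop[of r k] corner_loop[of r "Suc k"] corner_neq[of r k] 4 by auto
  have s: "ell0 (corner r (Suc k)) (corner r k) = inv (shift r (Suc k)) \<otimes> shift r k"
    using ell0_sym[of "corner r (Suc k)" "corner r k"] shift_Suc[OF 4(2)] by (simp add: inv_mult_group)
  show ?thesis
    by (rule by_positions[where p = "\<lambda>u. if u = Rim r k then \<one> else if u = corner r k then shift r k else shift r (Suc k)"])
      (use 4 ne s ell_rim[of r k] ell_corners[of r k] ell_corners[of r "Suc k"] shift_Suc[of k r] in \<open>auto simp del: ell.simps(4-)\<close>)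
next
  case (5 r k)
  have ne: "corner r (Suc k) \<noteq> Rim r k" "corner r (Suc k) \<noteq> Rim r (Suc k)"
    using corner_loop[of r "Suc k"] 5 by auto
  show ?thesis
    by (rule by_positions[where p = "\<lambda>u. if u = corner r (Suc k) then shift r (Suc k) else \<one>"])
      (use 5 ne ell_rim[of r k] ell_rim(3,6)[of r "Suc k"] ell_corners[of r "Suc k" "Suc k"] in \<open>auto simp del: ell.simps(4-)\<close>)
next
  case (6 r k)
  show ?thesis
    by (rule by_positions[where p = "\<lambda>u. \<one>"]) (use 6 in auto)
qed

lemma normalized_ell: "normalized H ell"
  unfolding normalized_def vlabeling_def using ell_facet by auto

end

section \<open>The fundamental group of the presentation complex\<close>

context presentation_complex
begin

definition tree_path :: "vx \<Rightarrow> vx list" where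
  "tree_path u = (case u of Base \<Rightarrow> [Base] | Fst i \<Rightarrow> [Base, Fst i] | Snd i \<Rightarrow> [Base, Snd i]
     | Hub r \<Rightarrow> [Base, Hub r] | Rim r k \<Rightarrow> [Base, Hub r, Rim r k])"

definition root_path :: "nat \<Rightarrow> nat list" where
  "root_path v = map to_nat (tree_path (from_nat v))"

definition valid :: "vx \<Rightarrow> bool" where
  "valid u = (case u of Base \<Rightarrow> True | Fst i \<Rightarrow> i < n | Snd i \<Rightarrow> i < n
     | Hub r \<Rightarrow> r < length rs | Rim r k \<Rightarrow> r < length rs \<and> k \<le> len r)"

lemma facet_edge: "f \<in> facets \<Longrightarrow> u \<in> f \<Longrightarrow> v \<in> f \<Longrightarrow> {to_nat u, to_nat v} \<in> cplx"
  using cplx_iff[of "{u, v}"] by auto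

lemma tree_edges:
  "i < n \<Longrightarrow> {to_nat Base, to_nat (Fst i)} \<in> cplx"
  "i < n \<Longrightarrow> {to_nat Base, to_nat (Snd i)} \<in> cplx"
  "i < n \<Longrightarrow> {to_nat (Fst i), to_nat (Snd i)} \<in> cplx"
  "r < length rs \<Longrightarrow> {to_nat Base, to_nat (Hub r)} \<in> cplx"
  "r < length rs \<Longrightarrow> k \<le> len r \<Longrightarrow> {to_nat (Hub r), to_nat (Rim r k)} \<in> cplx"
proof -
  show "{to_nat Base, to_nat (Fst i)} \<in> cplx" "{to_nat Base, to_nat (Snd i)} \<in> cplx"
    "{to_nat (Fst i), to_nat (Snd i)} \<in> cplx" if "i < n" for i
    using facet_edge[OF facetsI(1)[OF that], of "{Base, Fst i}" Base "Fst i"]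
      facet_edge[OF facetsI(1)[OF that], of "{Base, Snd i}" Base "Snd i"]
      facet_edge[OF facetsI(1)[OF that], of "{Fst i, Snd i}" "Fst i" "Snd i"]
    by (auto simp: loop_edges_def)
  show "{to_nat Base, to_nat (Hub r)} \<in> cplx" if "r < length rs" for r
    by (rule facet_edge[OF facetsI(2)[OF that]]) auto
  show "{to_nat (Hub r), to_nat (Rim r k)} \<in> cplx" if "r < length rs" "k \<le> len r" for r k
  proof (cases "k = len r")
    case True
    then show ?thesis using facet_edge[OF facetsI(3)[OF that(1)]] by simp
  next
    case False
    then show ?thesis using facet_edge[OF facetsI(6)[OF that(1), of k]] that by simp
  qed
qed

lemma vertex_cplx: "{u, v} \<in> cplx \<Longrightarrow> {u} \<in> cplx" "{u, v} \<in> cplx \<Longrightarrow> {v} \<in> cplx"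
  using simplicial_complex_subset[OF simplicial_complex_cplx, of "{u, v}"] by auto

lemma base_cplx: "{to_nat Base} \<in> cplx"
  using vertex_cplx(1)[OF tree_edges(4)[of 0]] nonempty by simp

lemma facet_valid: "f \<in> facets \<Longrightarrow> u \<in> f \<Longrightarrow> valid u"
proof (erule facets_cases)
  have c: "valid (corner r k)" if "r < length rs" "k \<le> len r" for r k
  proof (cases k)
    case (Suc j)
    then show ?thesis using corner_edge[of r j] that
      by (auto simp: loop_edges_def doubleton_eq_iff valid_def)
  qed (simp add: valid_def)
  fix r k assume "r < length rs" "k < len r" "f = {corner r k, corner r (Suc k), Rim r k}" "u \<in> f"
  then show "valid u" using c[of r k] c[of r "Suc k"] by (auto simp: valid_def)
next
  fix r k assume rk: "r < length rs" "k < len r" "f = {corner r (Suc k), Rim r k, Rim r (Suc k)}" "u \<in> f"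
  have "valid (corner r (Suc k))"
    using corner_edge[of r k] rk by (auto simp: loop_edges_def doubleton_eq_iff valid_def)
  then show "valid u" using rk by (auto simp: valid_def)
qed (auto simp: loop_edges_def valid_def)

lemma valid_vertex: "valid u \<Longrightarrow> {to_nat u} \<in> cplx"
  by (cases u) (auto simp: valid_def base_cplx intro: vertex_cplx(2) tree_edges)

lemma valid_path: "valid u \<Longrightarrow> path_to cplx (to_nat Base) (root_path (to_nat u)) (to_nat u)"
  using tree_edges valid_vertex[of u] valid_vertex[of "Hub _"] base_cplx
  by (cases u) (auto simp: path_to_def root_path_def tree_path_def valid_def)

lemma cplx_valid: "{v} \<in> cplx \<Longrightarrow> \<exists>u. valid u \<and> v = to_nat u"
proof -
  assume "{v} \<in> cplx"
  then obtain s f where s: "{v} = to_nat ` s" "s \<subseteq> f" "f \<in> facets" unfolding cplx_def by blast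
  then obtain u where "v = to_nat u" "u \<in> f" by blast
  then show ?thesis using facet_valid s(3) by blast
qed

sublocale rooted_complex cplx "to_nat Base" root_path
proof
  show "simplicial_complex cplx" by (rule simplicial_complex_cplx)
  show "{to_nat Base} \<in> cplx" by (rule base_cplx)
  show "root_path (to_nat Base) = [to_nat Base]" by (simp add: root_path_def tree_path_def)
  show "path_to cplx (to_nat Base) (root_path v) v" if "{u, v} \<in> cplx" for u v
    using cplx_valid[OF vertex_cplx(2)[OF that]] valid_path by blast
qed

definition vcanon :: "vx \<Rightarrow> vx \<Rightarrow> nat list set" where
  "vcanon u v = canon (to_nat u) (to_nat v)"

lemma normalized_vcanon: "normalized \<pi> vcanon"
proof -
  interpret L: labeled_complex \<pi> cplx canon by (rule labeled_canon)
  have "vlabeling \<pi> vcanon" using vlabeling_labeling[OF L.labeling] by (simp add: vcanon_def[abs_def])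
  moreover have "vcanon Base (Fst i) = \<one>\<^bsub>\<pi>\<^esub>" "vcanon Base (Snd i) = \<one>\<^bsub>\<pi>\<^esub>" if "i < n" for i
    unfolding vcanon_def using tree_edges(1,2)[OF that] valid_path[of Base]
    by (intro canon_tree; simp add: root_path_def tree_path_def valid_def)+
  moreover have "vcanon Base (Hub r) = \<one>\<^bsub>\<pi>\<^esub>" if "r < length rs" for r
    unfolding vcanon_def using tree_edges(4)[OF that] valid_path[of Base]
    by (intro canon_tree) (simp_all add: root_path_def tree_path_def valid_def)
  moreover have "vcanon (Hub r) (Rim r k) = \<one>\<^bsub>\<pi>\<^esub>" if "r < length rs" "k \<le> len r" for r k
    unfolding vcanon_def using tree_edges(5)[OF that] valid_path[of "Hub r"] that
    by (intro canon_tree) (simp_all add: root_path_def tree_path_def valid_def)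
  ultimately show ?thesis by (simp add: normalized_def)
qed

lemma vcanon_generator:
  "i < n \<Longrightarrow> vcanon (Fst i) (Snd i) = cls cplx (map to_nat [Base, Fst i, Snd i, Base])"
  using valid_path[of "Fst i"] valid_path[of "Snd i"]
  by (simp add: vcanon_def canon_def root_path_def tree_path_def valid_def)

end

lemma path_label_hom:
  assumes "group H" "group Q" "\<theta> \<in> hom H Q" "simplicial_complex K" "labeling K H l"
    and "edge_path K p" "\<And>u v. {u, v} \<in> K \<Longrightarrow> l' u v = \<theta> (l u v)"
  shows "path_label Q l' p = \<theta> (path_label H l p)"
proof -
  interpret labeled_complex H K l using assms by (simp add: labeled_complex_def labeled_complex_axioms_def)
  interpret h: group_hom H Q \<theta> using assms by (simp add: group_hom_def group_hom_axioms_def)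
  show ?thesis using assms(6)
    by (induction p rule: induct_list012) (auto simp: assms(7))
qed

text \<open>Takes the place of the Seifert-van Kampen theorem. The labels \<open>ell\<close> induce
  a homomorphism from \<open>\<pi>\<close> to \<open>H\<close>, the universal property of
  \<open>H\<close> gives \<open>\<theta>\<close> in the other direction. One composite is the
  identity by \<open>normalized_unique\<close>, the other because it fixes the generators.\<close>

theorem ex_complex_of_presentation:
  assumes pres: "presents H n R x"
  shows "\<exists>K v0. simplicial_complex K \<and> dimension_two K \<and> {v0} \<in> K \<and> edge_path_group K v0 \<cong> H"
proof -
  note P = presentsD[OF pres]
  interpret H: group H by (rule P(1))
  \<comment> \<open>The empty relator contributes a single triangle at \<open>Base\<close>, which
    does not change the group. It guarantees dimension two and a base vertex even if there are no
    generators and relators.\<close>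
  obtain rs where rs: "set rs = insert [] R" using finite_list[of "insert [] R"] P(2) by auto
  \<comment> \<open>\<open>ell0\<close> uses the generators at every index, so they are extended by
    a harmless default.\<close>
  define x' where "x' i = (if i < n then x i else \<one>\<^bsub>H\<^esub>)" for i
  have wx: "weval H x' w = weval H x w" if "letters n w" for w
    using that by (intro weval_cong) (auto simp: x'_def)
  interpret presentation_labels n rs H x'
    using P rs wx by unfold_locales (auto simp: x'_def)
  interpret L: labeled_complex \<pi> cplx canon by (rule labeled_canon)
  interpret C: normalized_labeling n rs \<pi> vcanon by unfold_locales (rule normalized_vcanon)
  define l where "l u v = ell (from_nat u) (from_nat v)" for u v :: nat
  have "labeling cplx H l" using labeling_vlabeling normalized_ell by (auto simp: l_def[abs_def] normalized_def)
  then interpret N: labeled_complex H cplx l by unfold_locales (rule simplicial_complex_cplx)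
  obtain \<theta> where \<theta>: "\<theta> \<in> hom H \<pi>" "\<forall>i<n. \<theta> (x i) = vcanon (Fst i) (Snd i)"
    by (rule presents_universal[OF pres pi.is_group, of "\<lambda>i. vcanon (Fst i) (Snd i)"])
      (use C.generator_closed C.relator rs in auto)
  interpret \<theta>: group_hom H \<pi> \<theta> using \<theta>(1) by unfold_locales
  have "normalized \<pi> (\<lambda>u v. \<theta> (ell u v))"
    using normalized_ell hom_mult[OF \<theta>(1)] hom_in_carrier[OF \<theta>(1)]
    unfolding normalized_def vlabeling_def by (auto simp flip: \<theta>.hom_mult)
  then have agree: "vcanon u v = \<theta> (ell u v)" if "f \<in> facets" "u \<in> f" "v \<in> f" for f u v
    using normalized_unique[OF pi.is_group normalized_vcanon _ _ that, of "\<lambda>u v. \<theta> (ell u v)"] \<theta>(2)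
    by (auto simp: x'_def)
  have agree': "canon u v = \<theta> (l u v)" if uv: "{u, v} \<in> cplx" for u v
  proof -
    obtain s f where s: "{u, v} = to_nat ` s" "s \<subseteq> f" "f \<in> facets" using uv unfolding cplx_def by blast
    then obtain a b where "u = to_nat a" "v = to_nat b" "a \<in> f" "b \<in> f" by blast
    then show ?thesis using agree[OF s(3)] by (simp add: vcanon_def l_def)
  qed
  have inverse: "\<theta> (N.induced c) = c" if c: "c \<in> carrier \<pi>" for c
  proof -
    obtain p where p: "p \<in> edge_loops cplx (to_nat Base)" "c = cls cplx p"
      using c by (auto simp: carrier_edge_path_group[OF complex])
    then have "c = path_label \<pi> canon p" by (simp add: path_label_canon_loop)
    also have "\<dots> = \<theta> (path_label H l p)"
      by (rule path_label_hom[OF H.is_group pi.is_group \<theta>(1) complex N.labeling])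
        (use p agree' in \<open>auto simp: edge_loops_def\<close>)
    also have "path_label H l p = N.induced c" using p by (simp add: edge_loops_def N.induced_cls)
    finally show ?thesis ..
  qed
  have gen: "N.induced (\<theta> (x i)) = x i" if i: "i < n" for i
  proof -
    have "edge_path cplx (map to_nat [Base, Fst i, Snd i, Base])"
      using tree_edges(1-3)[OF i] vertex_cplx base_cplx by (auto simp: insert_commute)
    then have "N.induced (\<theta> (x i)) = path_label H l (map to_nat [Base, Fst i, Snd i, Base])"
      using vcanon_generator[OF i] \<theta>(2) i by (simp add: N.induced_cls del: list.map)
    also have "\<dots> = x i" using P(3) i by (simp add: l_def x'_def)
    finally show ?thesis .
  qed
  have comp: "N.induced \<circ> \<theta> \<in> hom H H" using hom_compose[OF \<theta>(1) N.induced_hom] .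
  have "N.induced \<in> iso \<pi> H"
  proof (rule isoI[OF N.induced_hom], unfold bij_betw_def, intro conjI)
    show "inj_on N.induced (carrier \<pi>)" by (rule inj_on_inverseI[of _ \<theta>]) (rule inverse)
    show "N.induced ` carrier \<pi> = carrier H"
    proof (intro equalityI subsetI)
      fix h assume h: "h \<in> carrier H"
      then obtain w where w: "letters n w" "h = weval H x w" using P(6) by blast
      have "(N.induced \<circ> \<theta>) h = weval H (\<lambda>i. (N.induced \<circ> \<theta>) (x i)) w"
        unfolding w(2) by (rule weval_hom[OF H.is_group H.is_group comp P(3) w(1)])
      also have "\<dots> = h" unfolding w(2) using gen by (intro weval_cong[OF w(1)]) simp
      finally show "h \<in> N.induced ` carrier \<pi>" using hom_in_carrier[OF \<theta>(1) h] by force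
    qed (use hom_in_carrier[OF N.induced_hom] in blast)
  qed
  then show ?thesis
    using simplicial_complex_cplx dimension_two_cplx base_cplx is_isoI by blast
qed

section \<open>Linear algebra over the field with two elements\<close>

text \<open>The sum over \<open>A\<close> in the field with two elements, with value zero when
  infinitely many terms are nonzero.\<close>

definition parity :: "'x set \<Rightarrow> ('x \<Rightarrow> bool) \<Rightarrow> bool" where
  "parity A P \<longleftrightarrow> odd (card {x \<in> A. P x})"

lemma parity_sum: "finite A \<Longrightarrow> parity A P \<longleftrightarrow> odd (\<Sum>x\<in>A. of_bool (P x) :: nat)"
  unfolding parity_def card_eq_sum by (subst sum.inter_filter) (simp_all add: of_bool_def)

lemma odd_sum_cong:
  fixes f g :: "'x \<Rightarrow> nat"
  assumes "\<And>x. x \<in> A \<Longrightarrow> odd (f x) \<longleftrightarrow> odd (g x)"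
  shows "odd (sum f A) \<longleftrightarrow> odd (sum g A)"
  using assms by (induction A rule: infinite_finite_induct) auto

lemma parity_empty [simp]: "parity {} P \<longleftrightarrow> False" by (simp add: parity_def)

lemma parity_False [simp]: "parity A (\<lambda>x. False) \<longleftrightarrow> False" by (simp add: parity_def)

lemma parity_cong: "A = B \<Longrightarrow> (\<And>x. x \<in> B \<Longrightarrow> P x \<longleftrightarrow> Q x) \<Longrightarrow> parity A P \<longleftrightarrow> parity B Q"
  unfolding parity_def by (metis (mono_tags, lifting) Collect_cong)

lemma parity_insert [simp]: "finite A \<Longrightarrow> a \<notin> A \<Longrightarrow> parity (insert a A) P \<longleftrightarrow> (P a \<noteq> parity A P)"
proof -
  assume "finite A" "a \<notin> A"
  moreover have "{x \<in> insert a A. P x} = (if P a then insert a {x \<in> A. P x} else {x \<in> A. P x})" by auto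
  ultimately show ?thesis by (simp add: parity_def)
qed

lemma parity_singleton [simp]: "parity {a} P \<longleftrightarrow> P a"
  by simp

lemma parity_xor: "finite A \<Longrightarrow> parity A (\<lambda>x. P x \<noteq> Q x) \<longleftrightarrow> (parity A P \<noteq> parity A Q)"
proof (induction A rule: finite_induct)
  case (insert a A)
  show ?case unfolding parity_insert[OF insert(1,2)] using insert(3) by blast
qed simp

lemma parity_conj: "parity A (\<lambda>x. c \<and> P x) \<longleftrightarrow> c \<and> parity A P"
  by (cases c) auto

lemma parity_swap:
  assumes "finite A" "finite B"
  shows "parity A (\<lambda>x. parity B (R x)) \<longleftrightarrow> parity B (\<lambda>y. parity A (\<lambda>x. R x y))"
  using assms(1)
proof (induction A rule: finite_induct)
  case (insert a A)
  have "parity (insert a A) (\<lambda>x. parity B (R x)) \<longleftrightarrow> (parity B (R a) \<noteq> parity B (\<lambda>y. parity A (\<lambda>x. R x y)))"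
    unfolding parity_insert[OF insert(1,2)] using insert(3) by blast
  also have "\<dots> \<longleftrightarrow> parity B (\<lambda>y. R a y \<noteq> parity A (\<lambda>x. R x y))"
    by (simp only: parity_xor[OF assms(2)])
  finally show ?case unfolding parity_insert[OF insert(1,2)] .
qed simp

lemma parity_delta: "finite A \<Longrightarrow> a \<in> A \<Longrightarrow> parity A (\<lambda>x. a = x \<and> P x) \<longleftrightarrow> P a"
proof -
  assume a: "finite A" "a \<in> A"
  have "{x \<in> A. a = x \<and> P x} = (if P a then {a} else {})" using a by auto
  then show ?thesis by (simp add: parity_def)
qed

lemma parity_superset:
  assumes "A \<subseteq> B" "\<And>x. x \<in> B - A \<Longrightarrow> \<not> P x"
  shows "parity B P \<longleftrightarrow> parity A P"
proof -
  have "{x \<in> B. P x} = {x \<in> A. P x}" using assms by blast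
  then show ?thesis by (simp add: parity_def)
qed

lemma parity_sym_diff:
  assumes "finite A" "finite B"
  shows "parity (sym_diff A B) P \<longleftrightarrow> (parity A P \<noteq> parity B P)"
proof -
  have "parity (sym_diff A B) P \<longleftrightarrow> parity (A \<union> B) (\<lambda>x. (x \<in> A \<and> P x) \<noteq> (x \<in> B \<and> P x))"
    unfolding parity_def by (rule arg_cong[where f = "\<lambda>S. odd (card S)"]) auto
  also have "\<dots> \<longleftrightarrow> (parity (A \<union> B) (\<lambda>x. x \<in> A \<and> P x) \<noteq> parity (A \<union> B) (\<lambda>x. x \<in> B \<and> P x))"
    using assms by (intro parity_xor) simp
  also have "parity (A \<union> B) (\<lambda>x. x \<in> A \<and> P x) = parity A P"
    unfolding parity_def by (rule arg_cong[where f = "\<lambda>S. odd (card S)"]) auto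
  also have "parity (A \<union> B) (\<lambda>x. x \<in> B \<and> P x) = parity B P"
    unfolding parity_def by (rule arg_cong[where f = "\<lambda>S. odd (card S)"]) auto
  finally show ?thesis .
qed

lemma parity_restrict: "finite A \<Longrightarrow> parity {x. c x \<and> x \<in> A} P \<longleftrightarrow> parity A (\<lambda>x. c x \<and> P x)"
  unfolding parity_def by (rule arg_cong[where f = "\<lambda>S. odd (card S)"]) auto

lemma f2_sum_parity: "f2_sum S y \<longleftrightarrow> parity S (\<lambda>c. c y)"
  by (simp add: f2_sum_def parity_def)

definition xor_closed :: "('x \<Rightarrow> bool) set \<Rightarrow> bool" where
  "xor_closed B \<longleftrightarrow> (\<lambda>_. False) \<in> B \<and> (\<forall>a\<in>B. \<forall>b\<in>B. (\<lambda>x. a x \<noteq> b x) \<in> B)"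

lemma xor_closed_xor: "xor_closed B \<Longrightarrow> a \<in> B \<Longrightarrow> b \<in> B \<Longrightarrow> (\<lambda>x. a x \<noteq> b x) \<in> B"
  by (simp add: xor_closed_def)

text \<open>A maximal subspace avoiding \<open>z\<close> has index two, so its indicator is linear.\<close>

lemma ex_separating_functional:
  assumes B: "xor_closed B" and z: "z \<notin> B"
  shows "\<exists>L. (\<forall>a b. L (\<lambda>x. a x \<noteq> b x) \<longleftrightarrow> (L a \<noteq> L b)) \<and> (\<forall>b\<in>B. \<not> L b) \<and> L z"
proof -
  let ?A = "{M. xor_closed M \<and> B \<subseteq> M \<and> z \<notin> M}"
  have "\<exists>M\<in>?A. \<forall>X\<in>?A. M \<subseteq> X \<longrightarrow> X = M"
  proof (rule subset_Zorn_nonempty)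
    show "?A \<noteq> {}" using B z by blast
    fix C assume C: "C \<noteq> {}" "subset.chain ?A C"
    then have CA: "C \<subseteq> ?A" by (simp add: subset_chain_def)
    have tot: "\<forall>X\<in>C. \<forall>Y\<in>C. X \<subseteq> Y \<or> Y \<subseteq> X" using C by (simp add: subset_chain_def)
    have "xor_closed (\<Union>C)" unfolding xor_closed_def
    proof (intro conjI ballI)
      show "(\<lambda>_. False) \<in> \<Union>C" using C(1) CA by (auto simp: xor_closed_def)
      fix a b assume "a \<in> \<Union>C" "b \<in> \<Union>C"
      then obtain X Y where XY: "X \<in> C" "Y \<in> C" "a \<in> X" "b \<in> Y" by blast
      then obtain W where W: "W \<in> C" "a \<in> W" "b \<in> W" using tot by blast
      then have "(\<lambda>x. a x \<noteq> b x) \<in> W" using CA xor_closed_xor[of W a b] by blast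
      then show "(\<lambda>x. a x \<noteq> b x) \<in> \<Union>C" using W by blast
    qed
    then show "\<Union>C \<in> ?A" using C(1) CA by blast
  qed
  then obtain M where M: "xor_closed M" "B \<subseteq> M" "z \<notin> M"
    and max: "\<And>X. xor_closed X \<Longrightarrow> B \<subseteq> X \<Longrightarrow> z \<notin> X \<Longrightarrow> M \<subseteq> X \<Longrightarrow> X = M" by auto
  have coset: "(\<lambda>x. a x \<noteq> z x) \<in> M" if a: "a \<notin> M" for a
  proof (rule ccontr)
    assume na: "(\<lambda>x. a x \<noteq> z x) \<notin> M"
    \<comment> \<open>The union of \<open>M\<close> and the coset of \<open>a\<close>, the subspace
      spanned by both; it would be a larger one that avoids \<open>z\<close>.\<close>
    define X where "X = {p. p \<in> M \<or> (\<lambda>x. a x \<noteq> p x) \<in> M}"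
    have "xor_closed X" unfolding xor_closed_def
    proof (intro conjI ballI)
      show "(\<lambda>_. False) \<in> X" using M(1) by (simp add: xor_closed_def X_def)
      fix p q assume pq: "p \<in> X" "q \<in> X"
      let ?ap = "\<lambda>x. a x \<noteq> p x" and ?aq = "\<lambda>x. a x \<noteq> q x" and ?pq = "\<lambda>x. p x \<noteq> q x"
      have 1: "?pq \<in> M" if "p \<in> M" "q \<in> M" by (rule xor_closed_xor[OF M(1) that])
      have 2: "(\<lambda>x. a x \<noteq> ?pq x) \<in> M" if "?ap \<in> M" "q \<in> M"
      proof -
        have "(\<lambda>x. ?ap x \<noteq> q x) \<in> M" by (rule xor_closed_xor[OF M(1) that])
        moreover have "(\<lambda>x. ?ap x \<noteq> q x) = (\<lambda>x. a x \<noteq> ?pq x)" by auto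
        ultimately show ?thesis by metis
      qed
      have 3: "(\<lambda>x. a x \<noteq> ?pq x) \<in> M" if "p \<in> M" "?aq \<in> M"
      proof -
        have "(\<lambda>x. p x \<noteq> ?aq x) \<in> M" by (rule xor_closed_xor[OF M(1) that])
        moreover have "(\<lambda>x. p x \<noteq> ?aq x) = (\<lambda>x. a x \<noteq> ?pq x)" by auto
        ultimately show ?thesis by metis
      qed
      have 4: "?pq \<in> M" if "?ap \<in> M" "?aq \<in> M"
      proof -
        have "(\<lambda>x. ?ap x \<noteq> ?aq x) \<in> M" by (rule xor_closed_xor[OF M(1) that])
        moreover have "(\<lambda>x. ?ap x \<noteq> ?aq x) = ?pq" by auto
        ultimately show ?thesis by metis
      qed
      show "?pq \<in> X" using pq 1 2 3 4 unfolding X_def mem_Collect_eq by argo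
    qed
    moreover have "z \<notin> X" using M(3) na by (simp add: X_def)
    ultimately have "X = M" using M(2) by (intro max) (auto simp: X_def)
    moreover have "a \<in> X" using M(1) by (simp add: X_def xor_closed_def)
    ultimately show False using a by simp
  qed
  have sub: "(\<lambda>x. a x \<noteq> b x) \<in> M \<longleftrightarrow> (a \<in> M \<longleftrightarrow> b \<in> M)" for a b
  proof -
    have 1: "b \<in> M" if "a \<in> M" "(\<lambda>x. a x \<noteq> b x) \<in> M" for a b
    proof -
      have "(\<lambda>x. a x \<noteq> (a x \<noteq> b x)) \<in> M" by (rule xor_closed_xor[OF M(1) that])
      moreover have "(\<lambda>x. a x \<noteq> (a x \<noteq> b x)) = b" by auto
      ultimately show ?thesis by simp
    qed
    have 2: "(\<lambda>x. a x \<noteq> b x) = (\<lambda>x. b x \<noteq> a x)" by auto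
    have 3: "(\<lambda>x. a x \<noteq> b x) \<in> M" if "a \<notin> M" "b \<notin> M"
    proof -
      have "(\<lambda>x. (a x \<noteq> z x) \<noteq> (b x \<noteq> z x)) \<in> M" by (rule xor_closed_xor[OF M(1) coset[OF that(1)] coset[OF that(2)]])
      moreover have "(\<lambda>x. (a x \<noteq> z x) \<noteq> (b x \<noteq> z x)) = (\<lambda>x. a x \<noteq> b x)" by auto
      ultimately show ?thesis by simp
    qed
    show ?thesis using 1[of a b] 1[of b a, folded 2] 3 xor_closed_xor[OF M(1), of a b] by argo
  qed
  show ?thesis
  proof (rule exI[of _ "\<lambda>a. a \<notin> M"], intro conjI allI ballI)
    show "((\<lambda>x. a x \<noteq> b x) \<notin> M) = ((a \<notin> M) \<noteq> (b \<notin> M))" for a b using sub[of a b] by argo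
  qed (use M in auto)
qed

definition pairing :: "('x \<Rightarrow> bool) \<Rightarrow> ('x \<Rightarrow> bool) \<Rightarrow> bool" where
  "pairing f c \<longleftrightarrow> parity {x. c x} f"

text \<open>A functional on all functions is too large an object to be a cochain, but on finitely
  supported functions it is evaluation of its values on single cells.\<close>

lemma additive_pairing:
  assumes L: "\<And>a b. L (\<lambda>x. a x \<noteq> b x) \<longleftrightarrow> (L a \<noteq> L b)" and "finite {x. c x}"
  shows "L c \<longleftrightarrow> pairing (\<lambda>x. L (\<lambda>y. y = x)) c"
proof -
  have "L (\<lambda>y. y \<in> A) \<longleftrightarrow> parity A (\<lambda>x. L (\<lambda>y. y = x))" if "finite A" for A
    using that
  proof (induction A rule: finite_induct)
    case empty
    then show ?case using L[of "\<lambda>_. False" "\<lambda>_. False"] by simp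
  next
    case (insert a A)
    have "(\<lambda>y. y \<in> insert a A) = (\<lambda>y. (y = a) \<noteq> (y \<in> A))" using insert by auto
    then show ?case using L[of "\<lambda>y. y = a" "\<lambda>y. y \<in> A"] insert by simp
  qed
  from this[OF assms(2)] show ?thesis by (simp add: pairing_def)
qed

lemma ex_separating_cochain:
  assumes "xor_closed B" "\<And>b. b \<in> B \<Longrightarrow> finite {x. b x}" "z \<notin> B" "finite {x. z x}"
  shows "\<exists>f. (\<forall>b\<in>B. \<not> pairing f b) \<and> pairing f z"
proof -
  obtain L where L: "\<forall>a b. L (\<lambda>x. a x \<noteq> b x) \<longleftrightarrow> (L a \<noteq> L b)" "\<forall>b\<in>B. \<not> L b" "L z"
    using ex_separating_functional[OF assms(1,3)] by (elim exE conjE)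
  have *: "pairing (\<lambda>x. L (\<lambda>y. y = x)) c \<longleftrightarrow> L c" if "finite {x. c x}" for c
    by (rule additive_pairing[OF _ that, symmetric]) (simp only: L(1))
  show ?thesis
    by (intro exI[of _ "\<lambda>x. L (\<lambda>y. y = x)"] conjI ballI) (use L(2,3) assms in \<open>simp_all only: *, blast\<close>)
qed

lemma pairing_f2_sum:
  assumes "finite U" "\<And>c. c \<in> U \<Longrightarrow> finite {x. c x}"
  shows "pairing f (f2_sum U) \<longleftrightarrow> parity U (\<lambda>c. pairing f c)" "finite {x. f2_sum U x}"
proof -
  have "finite {x. f2_sum U x} \<and> (pairing f (f2_sum U) \<longleftrightarrow> parity U (\<lambda>c. pairing f c))"
    using assms
  proof (induction U rule: finite_induct)
    case (insert c U)
    have eq: "{x. f2_sum (insert c U) x} = sym_diff {x. c x} {x. f2_sum U x}"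
      using insert by (auto simp: f2_sum_parity)
    show ?case unfolding pairing_def eq using insert by (simp add: parity_sym_diff pairing_def)
  qed (simp add: f2_sum_parity[abs_def] pairing_def)
  then show "pairing f (f2_sum U) \<longleftrightarrow> parity U (\<lambda>c. pairing f c)" "finite {x. f2_sum U x}" by auto
qed

definition independent_mod :: "('x \<Rightarrow> bool) set \<Rightarrow> ('x \<Rightarrow> bool) set \<Rightarrow> ('x \<Rightarrow> bool) set \<Rightarrow> bool" where
  "independent_mod Z B S \<longleftrightarrow> S \<subseteq> Z \<and> finite S \<and> (\<forall>U. U \<subseteq> S \<and> U \<noteq> {} \<longrightarrow> f2_sum U \<notin> B)"

lemma f2_sum_sym_diff:
  "finite U \<Longrightarrow> finite V \<Longrightarrow> f2_sum (sym_diff U V) = (\<lambda>y. f2_sum U y \<noteq> f2_sum V y)"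
  by (auto simp: f2_sum_parity parity_sym_diff)

text \<open>For each \<open>s\<close> a cochain is needed that kills \<open>B\<close> and the other
  elements of \<open>S\<close> but not \<open>s\<close>; independence says exactly that
  \<open>s\<close> is not in their span.\<close>

lemma ex_dual_cochains:
  assumes S: "independent_mod Z B S" and B: "xor_closed B"
    and fin: "\<And>b. b \<in> B \<Longrightarrow> finite {x. b x}" "\<And>z. z \<in> Z \<Longrightarrow> finite {x. z x}"
  shows "\<exists>f. \<forall>s\<in>S. (\<forall>t\<in>S. pairing (f s) t \<longleftrightarrow> s = t) \<and> (\<forall>b\<in>B. \<not> pairing (f s) b)"
proof -
  have finS: "finite S" "S \<subseteq> Z" using S by (auto simp: independent_mod_def)
  have ex: "\<exists>f. (\<forall>t\<in>S. pairing f t \<longleftrightarrow> s = t) \<and> (\<forall>b\<in>B. \<not> pairing f b)" if s: "s \<in> S" for s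
  proof -
    \<comment> \<open>The span of \<open>B\<close> and \<open>S - {s}\<close>.\<close>
    define Bs where "Bs = {\<lambda>y. b y \<noteq> f2_sum U y | b U. b \<in> B \<and> U \<subseteq> S - {s}}"
    have finU: "finite {x. f2_sum U x}" if "U \<subseteq> S" for U
      using that finS fin(2) by (intro pairing_f2_sum(2)) (auto dest: finite_subset)
    have BsI: "p \<in> Bs" if "b \<in> B" "U \<subseteq> S - {s}" "p = (\<lambda>y. b y \<noteq> f2_sum U y)" for p b U
      unfolding Bs_def mem_Collect_eq using that by (intro exI[of _ b] exI[of _ U]) simp
    have BsE: "\<exists>b U. c = (\<lambda>y. b y \<noteq> f2_sum U y) \<and> b \<in> B \<and> U \<subseteq> S - {s}" if "c \<in> Bs" for c
      using that unfolding Bs_def mem_Collect_eq .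
    have finBs: "finite {x. c x}" if c0: "c \<in> Bs" for c
    proof -
      obtain b U where c: "c = (\<lambda>y. b y \<noteq> f2_sum U y)" "b \<in> B" "U \<subseteq> S - {s}"
        using BsE[OF c0] by (elim exE conjE)
      have "{x. c x} \<subseteq> {x. b x} \<union> {x. f2_sum U x}" unfolding c by auto
      moreover have "finite ({x. b x} \<union> {x. f2_sum U x})" using fin(1)[OF c(2)] finU[of U] c(3) by auto
      ultimately show ?thesis by (rule finite_subset)
    qed
    have zero: "(\<lambda>_. False) \<in> B" using B by (simp add: xor_closed_def)
    have closedBs: "xor_closed Bs" unfolding xor_closed_def
    proof (intro conjI ballI)
      show "(\<lambda>_. False) \<in> Bs" by (rule BsI[OF zero, of "{}"]) (simp_all add: f2_sum_parity)
      fix p q assume "p \<in> Bs" "q \<in> Bs"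
      obtain b U where p: "p = (\<lambda>y. b y \<noteq> f2_sum U y)" "b \<in> B" "U \<subseteq> S - {s}"
        using BsE[OF \<open>p \<in> Bs\<close>] by (elim exE conjE)
      obtain c V where q: "q = (\<lambda>y. c y \<noteq> f2_sum V y)" "c \<in> B" "V \<subseteq> S - {s}"
        using BsE[OF \<open>q \<in> Bs\<close>] by (elim exE conjE)
      have "finite U" "finite V" using p(3) q(3) finS(1) by (auto intro: finite_subset)
      then have "(\<lambda>y. p y \<noteq> q y) = (\<lambda>y. (b y \<noteq> c y) \<noteq> f2_sum (sym_diff U V) y)"
        unfolding p q by (auto simp: f2_sum_sym_diff)
      moreover have "sym_diff U V \<subseteq> S - {s}" using p(3) q(3) by blast
      ultimately show "(\<lambda>y. p y \<noteq> q y) \<in> Bs"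
        by (intro BsI[OF xor_closed_xor[OF B p(2) q(2)], of "sym_diff U V"])
    qed
    have sBs: "s \<notin> Bs"
    proof
      assume "s \<in> Bs"
      obtain b U where sU: "s = (\<lambda>y. b y \<noteq> f2_sum U y)" "b \<in> B" "U \<subseteq> S - {s}"
        using BsE[OF \<open>s \<in> Bs\<close>] by (elim exE conjE)
      have U: "finite U" "s \<notin> U" using sU(3) finS(1) by (auto intro: finite_subset)
      have "f2_sum (insert s U) y \<longleftrightarrow> b y" for y
        using U fun_cong[OF sU(1), of y] by (simp add: f2_sum_parity) blast
      then have "f2_sum (insert s U) = b" by (rule ext)
      moreover have "insert s U \<subseteq> S" using s sU(3) by blast
      ultimately show False using S sU(2) unfolding independent_mod_def by blast
    qed
    have "finite {x. s x}" using fin(2) finS(2) s by blast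
    from ex_separating_cochain[OF closedBs finBs sBs this]
    have "\<exists>f. (\<forall>b\<in>Bs. \<not> pairing f b) \<and> pairing f s" by simp
    then obtain f where f: "\<forall>b\<in>Bs. \<not> pairing f b" "pairing f s"
      by (elim exE conjE)
    have "t \<in> Bs" if "t \<in> S" "t \<noteq> s" for t
      by (rule BsI[OF zero, of "{t}"]) (use that in \<open>auto simp: f2_sum_parity\<close>)
    moreover have "b \<in> Bs" if "b \<in> B" for b
      by (rule BsI[OF that, of "{}"]) (auto simp: f2_sum_parity)
    ultimately show ?thesis using f by (intro exI[of _ f] conjI ballI) (metis, blast)
  qed
  show ?thesis by (rule bchoice, rule ballI, rule ex)
qed

text \<open>\<open>GREATEST\<close> is unspecified unless the cardinalities are bounded. For the
  group \<open>G\<close> the bounds are \<open>independent_bound_1\<close> and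
  \<open>independent_bound_2\<close>.\<close>

lemma f2_quotient_dim:
  assumes bound: "\<And>S. independent_mod Z B S \<Longrightarrow> card S \<le> N"
  shows "\<exists>S. independent_mod Z B S \<and> card S = f2_quotient_dim Z B"
    and "independent_mod Z B S \<Longrightarrow> card S \<le> f2_quotient_dim Z B"
proof -
  have eq: "f2_quotient_dim Z B = (GREATEST k. \<exists>S. independent_mod Z B S \<and> card S = k)"
    unfolding f2_quotient_dim_def independent_mod_def by (metis (no_types, lifting))
  have "independent_mod Z B {}" by (simp add: independent_mod_def)
  then have "\<exists>S. independent_mod Z B S \<and> card S = 0" by force
  then show "\<exists>S. independent_mod Z B S \<and> card S = f2_quotient_dim Z B"
    unfolding eq by (rule GreatestI_nat[where b = N]) (use bound in auto)
  show "card S \<le> f2_quotient_dim Z B" if "independent_mod Z B S"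
    unfolding eq by (rule Greatest_le_nat[where b = N]) (use bound that in auto)
qed

section \<open>The bar complex\<close>

lemma bar_boundary_parity:
  assumes "finite {x. c x}"
  shows "bar_boundary G c y \<longleftrightarrow> parity {x. c x} (\<lambda>x. parity {..length x} (\<lambda>i. bar_face G i x = y))"
proof -
  have "{(x, i). c x \<and> i \<le> length x \<and> bar_face G i x = y} =
      (SIGMA x:{x. c x}. {i \<in> {..length x}. bar_face G i x = y})" by auto
  then have "card {(x, i). c x \<and> i \<le> length x \<and> bar_face G i x = y} =
      (\<Sum>x | c x. card {i \<in> {..length x}. bar_face G i x = y})"
    using assms by simp
  then have "bar_boundary G c y \<longleftrightarrow> odd (\<Sum>x | c x. card {i \<in> {..length x}. bar_face G i x = y})"
    by (simp add: bar_boundary_def)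
  also have "\<dots> \<longleftrightarrow> odd (\<Sum>x | c x. of_bool (parity {..length x} (\<lambda>i. bar_face G i x = y)) :: nat)"
    by (rule odd_sum_cong) (simp add: parity_def)
  finally show ?thesis by (simp add: parity_sum[OF assms])
qed

lemma bar_coboundary_parity:
  "bar_coboundary G n f x \<longleftrightarrow> length x = Suc n \<and> set x \<subseteq> carrier G \<and> parity {..Suc n} (\<lambda>i. f (bar_face G i x))"
  by (auto simp: bar_coboundary_def parity_def)

lemma bar_boundary_face:
  assumes "bar_boundary G c y"
  shows "\<exists>x i. c x \<and> i \<le> length x \<and> y = bar_face G i x"
proof (rule ccontr)
  assume "\<not> ?thesis"
  then have "{(x, i). c x \<and> i \<le> length x \<and> bar_face G i x = y} = {}" by blast
  then show False using assms by (simp only: bar_boundary_def card.empty even_zero not_True_eq_False)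
qed

lemma bar_face_closed:
  assumes "group G" "length x = Suc (Suc n)" "set x \<subseteq> carrier G" "i \<le> Suc (Suc n)"
  shows "length (bar_face G i x) = Suc n \<and> set (bar_face G i x) \<subseteq> carrier G"
proof -
  interpret group G by fact
  have nth: "x ! j \<in> carrier G" if "j < length x" for j using assms(3) that nth_mem by blast
  have "set (take j x) \<subseteq> carrier G" "set (drop j x) \<subseteq> carrier G" "set (tl x) \<subseteq> carrier G"
    "set (butlast x) \<subseteq> carrier G" for j
    using assms(3) set_take_subset set_drop_subset in_set_butlastD[of _ x] list.set_sel(2)[of x] assms(2)
    by (fastforce)+
  then show ?thesis
    using assms(2,4) nth[of "i - 1"] nth[of i] by (auto simp: bar_face_def)
qed

lemma finite_bar_boundary:
  assumes "finite {x. c x}"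
  shows "finite {y. bar_boundary G c y}"
proof (rule finite_subset)
  show "{y. bar_boundary G c y} \<subseteq> (\<Union>x\<in>{x. c x}. (\<lambda>i. bar_face G i x) ` {..length x})"
    using bar_boundary_face[of G c] by blast
qed (use assms in auto)

text \<open>Adjointness by exchanging sums over cells and faces; the set \<open>Y\<close> of all
  faces of cells of \<open>c\<close> makes the inner sum finite.\<close>

lemma pairing_boundary:
  assumes c: "c \<in> bar_chains G (Suc n)"
  shows "pairing f (bar_boundary G c) \<longleftrightarrow> pairing (bar_coboundary G n f) c"
proof -
  have fin: "finite {x. c x}" and len: "\<And>x. c x \<Longrightarrow> length x = Suc n \<and> set x \<subseteq> carrier G"
    using c by (auto simp: bar_chains_def)
  define Y where "Y = (\<Union>x\<in>{x. c x}. (\<lambda>i. bar_face G i x) ` {..Suc n})"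
  have Y: "finite Y" using fin by (simp add: Y_def)
  have YI: "bar_face G i x \<in> Y" if "c x" "i \<le> Suc n" for x i using that by (auto simp: Y_def)
  have bd: "bar_boundary G c y \<longleftrightarrow> parity {x. c x} (\<lambda>x. parity {..Suc n} (\<lambda>i. bar_face G i x = y))" for y
    unfolding bar_boundary_parity[OF fin] by (rule parity_cong) (use len in auto)
  have "y \<in> Y" if "bar_boundary G c y" for y
  proof (rule ccontr)
    assume "y \<notin> Y"
    then have "parity {..Suc n} (\<lambda>i. bar_face G i x = y) \<longleftrightarrow> False" if "c x" for x
      using YI[OF that] parity_cong[of "{..Suc n}" "{..Suc n}" "\<lambda>i. bar_face G i x = y" "\<lambda>_. False"] by auto
    then have "parity {x. c x} (\<lambda>x. parity {..Suc n} (\<lambda>i. bar_face G i x = y)) \<longleftrightarrow> parity {x. c x} (\<lambda>x. False)"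
      by (intro parity_cong) auto
    then show False using bd that by simp
  qed
  then have "{y. bar_boundary G c y} = {y. bar_boundary G c y \<and> y \<in> Y}" by blast
  then have "pairing f (bar_boundary G c) \<longleftrightarrow> parity Y (\<lambda>y. bar_boundary G c y \<and> f y)"
    unfolding pairing_def using parity_restrict[OF Y] by metis
  also have "\<dots> \<longleftrightarrow> parity Y (\<lambda>y. parity {x. c x} (\<lambda>x. parity {..Suc n} (\<lambda>i. bar_face G i x = y \<and> f y)))"
  proof (rule parity_cong[OF HOL.refl])
    fix y
    show "(bar_boundary G c y \<and> f y) \<longleftrightarrow> parity {x. c x} (\<lambda>x. parity {..Suc n} (\<lambda>i. bar_face G i x = y \<and> f y))"
      by (cases "f y") (simp_all add: bd)
  qed
  also have "\<dots> \<longleftrightarrow> parity {x. c x} (\<lambda>x. parity Y (\<lambda>y. parity {..Suc n} (\<lambda>i. bar_face G i x = y \<and> f y)))"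
    by (rule parity_swap[OF Y fin])
  also have "\<dots> \<longleftrightarrow> parity {x. c x} (\<lambda>x. parity {..Suc n} (\<lambda>i. parity Y (\<lambda>y. bar_face G i x = y \<and> f y)))"
    by (subst parity_swap[OF Y]) simp_all
  also have "\<dots> \<longleftrightarrow> parity {x. c x} (\<lambda>x. bar_coboundary G n f x)"
  proof (rule parity_cong[OF HOL.refl])
    fix x assume "x \<in> {x. c x}"
    then have x: "c x" by simp
    have "parity {..Suc n} (\<lambda>i. parity Y (\<lambda>y. bar_face G i x = y \<and> f y)) \<longleftrightarrow> parity {..Suc n} (\<lambda>i. f (bar_face G i x))"
      by (rule parity_cong[OF HOL.refl]) (use parity_delta[OF Y YI[OF x]] in auto)
    then show "parity {..Suc n} (\<lambda>i. parity Y (\<lambda>y. bar_face G i x = y \<and> f y)) \<longleftrightarrow> bar_coboundary G n f x"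
      using len[OF x] by (simp add: bar_coboundary_parity)
  qed
  finally show ?thesis by (simp add: pairing_def)
qed

lemma bar_chains_xor:
  assumes "a \<in> bar_chains G n" "b \<in> bar_chains G n"
  shows "(\<lambda>x. a x \<noteq> b x) \<in> bar_chains G n"
proof -
  have "{x. a x \<noteq> b x} \<subseteq> {x. a x} \<union> {x. b x}" by auto
  then have "finite {x. a x \<noteq> b x}" by (rule finite_subset) (use assms in \<open>auto simp: bar_chains_def\<close>)
  then show ?thesis using assms by (auto simp: bar_chains_def)
qed

lemma bar_boundary_xor:
  assumes "finite {x. a x}" "finite {x. b x}"
  shows "bar_boundary G (\<lambda>x. a x \<noteq> b x) = (\<lambda>y. bar_boundary G a y \<noteq> bar_boundary G b y)"
proof
  fix y
  have eq: "{x. a x \<noteq> b x} = sym_diff {x. a x} {x. b x}" by auto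
  have "finite {x. a x \<noteq> b x}" unfolding eq using assms by simp
  then show "bar_boundary G (\<lambda>x. a x \<noteq> b x) y \<longleftrightarrow> (bar_boundary G a y \<noteq> bar_boundary G b y)"
    using assms by (simp only: bar_boundary_parity eq parity_sym_diff)
qed

lemma xor_closed_boundaries: "xor_closed (boundaries G n)"
  unfolding xor_closed_def boundaries_def
proof (intro conjI ballI)
  have "bar_boundary G (\<lambda>_. False) = (\<lambda>_. False)" by (rule ext) (simp add: bar_boundary_def)
  then show "(\<lambda>_. False) \<in> bar_boundary G ` bar_chains G (Suc n)"
    by (intro image_eqI[of _ _ "\<lambda>_. False"]) (auto simp: bar_chains_def)
  fix a b assume "a \<in> bar_boundary G ` bar_chains G (Suc n)" "b \<in> bar_boundary G ` bar_chains G (Suc n)"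
  then obtain c d where cd: "c \<in> bar_chains G (Suc n)" "d \<in> bar_chains G (Suc n)"
    "a = bar_boundary G c" "b = bar_boundary G d" by blast
  have eq: "bar_boundary G (\<lambda>x. c x \<noteq> d x) = (\<lambda>y. a y \<noteq> b y)"
    unfolding cd(3,4) by (rule bar_boundary_xor) (use cd(1,2) in \<open>auto simp: bar_chains_def\<close>)
  show "(\<lambda>x. a x \<noteq> b x) \<in> bar_boundary G ` bar_chains G (Suc n)"
    unfolding eq[symmetric] by (rule imageI[OF bar_chains_xor[OF cd(1,2)]])
qed

lemma cocycle_boundary:
  assumes "f \<in> cocycles G n" "b \<in> boundaries G n"
  shows "\<not> pairing f b"
  using assms pairing_boundary[of _ G n f] by (auto simp: boundaries_def cocycles_def pairing_def)

lemma coboundary_cycle: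
  assumes "f \<in> coboundaries G (Suc n)" "z \<in> cycles G (Suc n)"
  shows "\<not> pairing f z"
  using assms pairing_boundary[of z G n, symmetric] by (auto simp: coboundaries_def cycles_def pairing_def)

text \<open>Cochains dual to independent cycles kill boundaries, so they are cocycles. A nonempty
  sum of them takes the value one on the cycle of any of its members, which a coboundary cannot
  do.\<close>

lemma ex_dual_cocycles:
  assumes G: "group G" and S: "independent_mod (cycles G (Suc n)) (boundaries G (Suc n)) S"
  obtains f where "\<And>s. s \<in> S \<Longrightarrow> f s \<in> cocycles G (Suc n)"
    "\<And>U. U \<subseteq> S \<Longrightarrow> U \<noteq> {} \<Longrightarrow> (\<lambda>x. parity U (\<lambda>s. f s x)) \<in> cocycles G (Suc n) - coboundaries G (Suc n)"
proof -
  let ?N = "Suc n"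
  have finS: "finite S" "S \<subseteq> cycles G ?N" using S by (auto simp: independent_mod_def)
  have "finite {x. b x}" if "b \<in> boundaries G ?N" for b
    using that finite_bar_boundary by (auto simp: boundaries_def bar_chains_def)
  moreover have "finite {x. z x}" if "z \<in> cycles G ?N" for z
    using that by (auto simp: cycles_def bar_chains_def)
  ultimately have "\<exists>f. \<forall>s\<in>S. (\<forall>t\<in>S. pairing (f s) t \<longleftrightarrow> s = t) \<and> (\<forall>b\<in>boundaries G ?N. \<not> pairing (f s) b)"
    by (rule ex_dual_cochains[OF S xor_closed_boundaries])
  then obtain f0 where f0': "\<forall>s\<in>S. (\<forall>t\<in>S. pairing (f0 s) t \<longleftrightarrow> s = t) \<and> (\<forall>b\<in>boundaries G ?N. \<not> pairing (f0 s) b)"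
    by (elim exE)
  then have f0: "\<And>s t. s \<in> S \<Longrightarrow> t \<in> S \<Longrightarrow> pairing (f0 s) t \<longleftrightarrow> s = t"
    "\<And>s b. s \<in> S \<Longrightarrow> b \<in> boundaries G ?N \<Longrightarrow> \<not> pairing (f0 s) b"
    by blast+
  \<comment> \<open>The dual cochain is arbitrary on lists that are not cells of this degree; it is
    cut off there to become a bar cochain.\<close>
  define f where "f s x \<longleftrightarrow> length x = ?N \<and> set x \<subseteq> carrier G \<and> f0 s x" for s x
  have pair: "pairing (f s) t \<longleftrightarrow> s = t" if "s \<in> S" "t \<in> S" for s t
  proof -
    have "pairing (f s) t \<longleftrightarrow> pairing (f0 s) t" unfolding pairing_def
      by (rule parity_cong) (use finS(2) that in \<open>auto simp: f_def cycles_def bar_chains_def\<close>)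
    then show ?thesis using f0(1) that by simp
  qed
  have zero: "\<not> bar_coboundary G ?N (f s) x" if s: "s \<in> S" for s x
  proof
    assume x: "bar_coboundary G ?N (f s) x"
    \<comment> \<open>A single cell, regarded as a chain: its boundary would pair nontrivially with
      a cochain that kills boundaries.\<close>
    have ch: "(\<lambda>y. y = x) \<in> bar_chains G (Suc ?N)" using x by (auto simp: bar_chains_def bar_coboundary_def)
    have ev: "pairing g (\<lambda>y. y = x) \<longleftrightarrow> g x" for g by (simp add: pairing_def)
    have fb: "pairing (f s) (bar_boundary G (\<lambda>y. y = x))"
      using pairing_boundary[OF ch, of "f s"] ev x by simp
    have "f s y \<longleftrightarrow> f0 s y" if "bar_boundary G (\<lambda>y. y = x) y" for y
      using bar_boundary_face[OF that] bar_face_closed[OF G, of x n] x by (auto simp: f_def bar_coboundary_def)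
    then have "pairing (f s) (bar_boundary G (\<lambda>y. y = x)) \<longleftrightarrow> pairing (f0 s) (bar_boundary G (\<lambda>y. y = x))"
      unfolding pairing_def by (intro parity_cong) auto
    moreover have "bar_boundary G (\<lambda>y. y = x) \<in> boundaries G ?N" using ch by (simp add: boundaries_def)
    ultimately show False using fb f0(2)[OF s] by blast
  qed
  show thesis
  proof (rule that[of f])
    show fc: "f s \<in> cocycles G ?N" if "s \<in> S" for s
      using zero[OF that] by (auto simp: cocycles_def bar_cochains_def f_def)
    fix U assume U: "U \<subseteq> S" "U \<noteq> {}"
    have finU: "finite U" using U finS(1) finite_subset by blast
    let ?g = "\<lambda>x. parity U (\<lambda>s. f s x)"
    have "?g x \<longrightarrow> length x = ?N \<and> set x \<subseteq> carrier G" for x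
    proof
      assume "?g x"
      then have "\<exists>s\<in>U. f s x" using parity_cong[of U U "\<lambda>s. f s x" "\<lambda>_. False"] by auto
      then show "length x = ?N \<and> set x \<subseteq> carrier G" by (auto simp: f_def)
    qed
    moreover have "\<not> bar_coboundary G ?N ?g x" for x
    proof
      assume x: "bar_coboundary G ?N ?g x"
      then have "parity {..Suc ?N} (\<lambda>i. parity U (\<lambda>s. f s (bar_face G i x)))"
        by (simp only: bar_coboundary_parity)
      then have "parity U (\<lambda>s. parity {..Suc ?N} (\<lambda>i. f s (bar_face G i x)))"
        by (subst parity_swap[OF finU finite_atMost])
      then have "\<exists>s\<in>U. parity {..Suc ?N} (\<lambda>i. f s (bar_face G i x))"
        using parity_cong[of U U "\<lambda>s. parity {..Suc ?N} (\<lambda>i. f s (bar_face G i x))" "\<lambda>_. False"] by auto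
      then obtain s where "s \<in> U" "bar_coboundary G ?N (f s) x"
        using x unfolding bar_coboundary_parity by blast
      then show False using zero U by blast
    qed
    ultimately have "?g \<in> cocycles G ?N" by (auto simp: cocycles_def bar_cochains_def)
    moreover have "?g \<notin> coboundaries G ?N"
    proof
      assume cb: "?g \<in> coboundaries G ?N"
      obtain t where t: "t \<in> U" using U by blast
      then have "t \<in> cycles G ?N" using U finS by blast
      then have "\<not> pairing ?g t" using coboundary_cycle[OF cb] by blast
      moreover have "pairing ?g t \<longleftrightarrow> parity U (\<lambda>s. pairing (f s) t)"
        unfolding pairing_def using \<open>t \<in> cycles G ?N\<close> finU
        by (intro parity_swap) (auto simp: cycles_def bar_chains_def)
      moreover have "parity U (\<lambda>s. pairing (f s) t) \<longleftrightarrow> parity U (\<lambda>s. t = s \<and> True)"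
        by (rule parity_cong[OF HOL.refl]) (use pair t U in auto)
      moreover have "parity U (\<lambda>s. t = s \<and> True)" using parity_delta[OF finU t, of "\<lambda>_. True"] by simp
      ultimately show False by blast
    qed
    ultimately show "?g \<in> cocycles G ?N - coboundaries G ?N" by blast
  qed
qed

section \<open>Finite incidence structures\<close>

text \<open>Orthogonality of characters, from expanding the product of the factors
  \<open>1 + (-1) ^ n s\<close>.\<close>

lemma sum_sign_Pow:
  fixes n :: "'y \<Rightarrow> nat"
  assumes "finite Y"
  shows "(\<Sum>c\<in>Pow Y. (-1) ^ (\<Sum>s\<in>c. n s)) = (if \<forall>s\<in>Y. even (n s) then 2 ^ card Y else (0::int))"
proof -
  have "(\<Sum>c\<in>Pow Y. (-1) ^ (\<Sum>s\<in>c. n s)) = (\<Sum>c\<in>Pow Y. (\<Prod>s\<in>c. (-1::int) ^ n s) * (\<Prod>s\<in>Y - c. 1))"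
    by (simp add: power_sum)
  also have "\<dots> = (\<Prod>s\<in>Y. (-1) ^ n s + 1)"
    using prod_add[OF assms, of "\<lambda>s. (-1::int) ^ n s" "\<lambda>s. 1"] by simp
  also have "\<dots> = (if \<forall>s\<in>Y. even (n s) then 2 ^ card Y else 0)"
  proof (cases "\<forall>s\<in>Y. even (n s)")
    case True
    then have "(\<Prod>s\<in>Y. (-1::int) ^ n s + 1) = (\<Prod>s\<in>Y. 2)" by (intro prod.cong) auto
    then show ?thesis using True by simp
  next
    case False
    then obtain s where "s \<in> Y" "(-1::int) ^ n s + 1 = 0" by auto
    then have "(\<Prod>s\<in>Y. (-1::int) ^ n s + 1) = 0" using assms by (intro prod_zero) auto
    then show ?thesis using False by simp
  qed
  finally show ?thesis .
qed

text \<open>Rank-nullity together with the equality of row and column rank, by a character sum.\<close>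

lemma card_kernel_duality:
  assumes X: "finite X" and Y: "finite Y"
  shows "card {A. A \<subseteq> X \<and> (\<forall>s\<in>Y. \<not> parity A (\<lambda>e. I e s))} * 2 ^ card Y =
    card {c. c \<subseteq> Y \<and> (\<forall>e\<in>X. \<not> parity c (I e))} * 2 ^ card X"
proof -
  define nA where "nA A s = card {e \<in> A. I e s}" for A s
  define nc where "nc c e = card {s \<in> c. I e s}" for c e
  have total: "(\<Sum>x\<in>A. if P x then r else (0::int)) = int (card {x \<in> A. P x}) * r" if "finite A" for A :: "'x set" and P r
    using that by (simp add: sum.inter_filter[symmetric])
  have swap: "(\<Sum>s\<in>c. nA A s) = (\<Sum>e\<in>A. nc c e)" if "finite A" "finite c" for A c
  proof -
    have "(\<Sum>s\<in>c. nA A s) = (\<Sum>s\<in>c. \<Sum>e\<in>A. if I e s then 1 else 0)"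
      unfolding nA_def card_eq_sum using that by (simp only: sum.inter_filter)
    also have "\<dots> = (\<Sum>e\<in>A. \<Sum>s\<in>c. if I e s then 1 else 0)" by (rule sum.swap)
    also have "\<dots> = (\<Sum>e\<in>A. nc c e)"
      unfolding nc_def card_eq_sum using that by (simp only: sum.inter_filter)
    finally show ?thesis .
  qed
  have "int (card {A \<in> Pow X. \<forall>s\<in>Y. even (nA A s)}) * 2 ^ card Y =
      (\<Sum>A\<in>Pow X. \<Sum>c\<in>Pow Y. (-1) ^ (\<Sum>s\<in>c. nA A s))"
    using X by (simp only: sum_sign_Pow[OF Y] total finite_Pow_iff)
  also have "\<dots> = (\<Sum>c\<in>Pow Y. \<Sum>A\<in>Pow X. (-1) ^ (\<Sum>s\<in>c. nA A s))" by (rule sum.swap)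
  also have "\<dots> = (\<Sum>c\<in>Pow Y. \<Sum>A\<in>Pow X. (-1) ^ (\<Sum>e\<in>A. nc c e))"
    using X Y by (intro sum.cong refl) (subst swap, auto dest: finite_subset)
  also have "\<dots> = int (card {c \<in> Pow Y. \<forall>e\<in>X. even (nc c e)}) * 2 ^ card X"
    using Y by (simp only: sum_sign_Pow[OF X] total finite_Pow_iff)
  finally have "card {A \<in> Pow X. \<forall>s\<in>Y. even (nA A s)} * 2 ^ card Y =
      card {c \<in> Pow Y. \<forall>e\<in>X. even (nc c e)} * 2 ^ card X"
    using of_nat_eq_iff[where 'a = int] by fastforce
  then show ?thesis by (simp add: parity_def nA_def nc_def)
qed

text \<open>The mod 2 coboundary of \<open>u\<close>, read as a 0-cochain on the graph with edge set
  \<open>E\<close>.\<close>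

definition cut :: "'v set set \<Rightarrow> 'v set \<Rightarrow> 'v set set" where
  "cut E u = {e \<in> E. parity e (\<lambda>v. v \<in> u)}"

lemma parity_doubleton: "a \<noteq> b \<Longrightarrow> parity {a, b} P \<longleftrightarrow> (P a \<noteq> P b)"
  by simp

text \<open>Sharp for the complete graph on \<open>r + 1\<close> vertices. The proof adds the vertices one by one.\<close>

lemma cut_rank:
  assumes "finite V" "\<And>e. e \<in> E \<Longrightarrow> e \<subseteq> V \<and> card e = 2"
  shows "\<exists>r. 2 ^ r \<le> card (cut E ` Pow V) \<and> 2 * card E \<le> r * (r + 1)"
  using assms
proof (induction V arbitrary: E rule: finite_induct)
  case empty
  then have "E = {}" by fastforce
  then show ?case by (intro exI[of _ 0]) simp
next
  case (insert v V)
  define E0 where "E0 = {e \<in> E. v \<notin> e}"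
  define N where "N = {w \<in> V. {v, w} \<in> E}"
  have "e \<subseteq> V \<and> card e = 2" if "e \<in> E0" for e
    using insert.prems[of e] that by (auto simp: E0_def)
  from insert.IH[OF this] obtain r where r: "2 ^ r \<le> card (cut E0 ` Pow V)" "2 * card E0 \<le> r * (r + 1)" by auto
  have finN: "finite N" using insert by (simp add: N_def)
  have E: "E = E0 \<union> (\<lambda>w. {v, w}) ` N"
  proof (intro equalityI subsetI)
    fix e assume e: "e \<in> E"
    show "e \<in> E0 \<union> (\<lambda>w. {v, w}) ` N"
    proof (cases "v \<in> e")
      case True
      then obtain w where "e = {v, w}" "w \<noteq> v"
        using insert.prems[OF e] by (metis card_2_iff doubleton_eq_iff insertE singletonD)
      then show ?thesis using insert.prems[OF e] e by (auto simp: N_def)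
    qed (use e in \<open>simp add: E0_def\<close>)
  qed (auto simp: E0_def N_def)
  have finE0: "finite E0" using insert.prems insert.hyps(1)
    by (intro finite_subset[of E0 "Pow (insert v V)"]) (auto simp: E0_def)
  have "inj_on (\<lambda>w. {v, w}) N" by (auto simp: inj_on_def doubleton_eq_iff)
  then have cardE: "card E = card E0 + card N"
    unfolding E using finE0 finN
    by (subst card_Un_disjoint) (auto simp: E0_def card_image)
  have fin: "finite (cut E ` Pow (insert v V))" using insert by simp
  have restrict: "cut E u \<inter> E0 = cut E0 u" for u by (auto simp: cut_def E0_def)
  have even_cut: "cut E0 (insert v u) = cut E0 u" for u
    unfolding cut_def E0_def
  proof (intro Collect_cong conj_cong refl parity_cong)
    fix e x assume "e \<in> {e \<in> E. v \<notin> e}" "x \<in> e"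
    then show "(x \<in> insert v u) = (x \<in> u)" by auto
  qed
  have star: "{v, w} \<in> cut E u \<longleftrightarrow> (v \<in> u \<longleftrightarrow> w \<notin> u)" if "w \<in> N" for u w
  proof -
    have w: "{v, w} \<in> E" "v \<noteq> w" using that insert.hyps(2) by (auto simp: N_def)
    show ?thesis using w(1) parity_doubleton[OF w(2), of "\<lambda>x. x \<in> u"] unfolding cut_def by auto
  qed
  show ?case
  proof (cases "N = {}")
    case True
    then have "E = E0" using E by simp
    then have "cut E0 ` Pow V \<subseteq> cut E ` Pow (insert v V)" by auto
    then have "card (cut E0 ` Pow V) \<le> card (cut E ` Pow (insert v V))" using fin by (rule card_mono[rotated])
    then show ?thesis using r \<open>E = E0\<close> by (intro exI[of _ r]) auto
  next
    case False
    then obtain w where w: "w \<in> N" by blast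
    define u where "u K = (SOME a. a \<in> Pow V \<and> cut E0 a = K)" for K
    have u: "u K \<subseteq> V \<and> cut E0 (u K) = K" if K: "K \<in> cut E0 ` Pow V" for K
    proof -
      have "\<exists>a. a \<in> Pow V \<and> cut E0 a = K" using K by auto
      from someI_ex[OF this] show ?thesis unfolding u_def by simp
    qed
    \<comment> \<open>Every cut of \<open>E0\<close> extends in two ways, with \<open>v\<close> on
      either side; the edge from \<open>v\<close> to \<open>w\<close> tells them apart. So the
      number of cuts at least doubles.\<close>
    define \<phi> where "\<phi> = (\<lambda>(K, b). cut E (if b then insert v (u K) else u K))"
    have \<phi>: "\<phi> (K, b) \<inter> E0 = K \<and> (({v, w} \<in> \<phi> (K, b)) = (b = (w \<notin> u K)))" if K: "K \<in> cut E0 ` Pow V" for K b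
    proof -
      have "v \<notin> u K" "w \<noteq> v" using u[OF K] insert.hyps(2) w by (auto simp: N_def)
      then show ?thesis using u[OF K] restrict even_cut star[OF w] by (auto simp: \<phi>_def)
    qed
    have "inj_on \<phi> (cut E0 ` Pow V \<times> UNIV)"
    proof (rule inj_onI)
      fix x y assume xy: "x \<in> cut E0 ` Pow V \<times> UNIV" "y \<in> cut E0 ` Pow V \<times> UNIV" "\<phi> x = \<phi> y"
      obtain a p b q where ab: "x = (a, p)" "y = (b, q)" "a \<in> cut E0 ` Pow V" "b \<in> cut E0 ` Pow V"
        using xy(1,2) by (cases x; cases y) auto
      have "a = b" using \<phi>[OF ab(3), of p] \<phi>[OF ab(4), of q] xy(3) ab(1,2) by metis
      moreover from this have "p = q" using \<phi>[OF ab(3), of p] \<phi>[OF ab(4), of q] xy(3) ab(1,2) by metis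
      ultimately show "x = y" using ab by simp
    qed
    moreover have "\<phi> ` (cut E0 ` Pow V \<times> UNIV) \<subseteq> cut E ` Pow (insert v V)"
    proof clarify
      fix a b assume "a \<subseteq> V"
      then have "u (cut E0 a) \<subseteq> V" using u[of "cut E0 a"] by auto
      then show "\<phi> (cut E0 a, b) \<in> cut E ` Pow (insert v V)" unfolding \<phi>_def by auto
    qed
    ultimately have "card (cut E0 ` Pow V \<times> (UNIV :: bool set)) \<le> card (cut E ` Pow (insert v V))"
      using fin by (rule card_inj_on_le)
    then have 1: "2 ^ (r + 1) \<le> card (cut E ` Pow (insert v V))"
      using r(1) by (simp add: card_cartesian_product)
    \<comment> \<open>Second lower bound: with \<open>v\<close> outside, a set of neighbours of
      \<open>v\<close> can be read off from the edges at \<open>v\<close>.\<close>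
    have "inj_on (cut E) (Pow N)"
    proof (rule inj_onI)
      fix a b assume ab: "a \<in> Pow N" "b \<in> Pow N" "cut E a = cut E b"
      have "v \<notin> a" "v \<notin> b" using ab insert.hyps(2) by (auto simp: N_def)
      then have "x \<in> a \<longleftrightarrow> x \<in> b" if "x \<in> N" for x using star[OF that, of a] star[OF that, of b] ab(3) by auto
      then show "a = b" using ab by blast
    qed
    moreover have "cut E ` Pow N \<subseteq> cut E ` Pow (insert v V)" by (auto simp: N_def)
    ultimately have "card (Pow N) \<le> card (cut E ` Pow (insert v V))" using fin by (rule card_inj_on_le)
    then have 2: "2 ^ card N \<le> card (cut E ` Pow (insert v V))" using finN by (simp add: card_Pow)
    \<comment> \<open>Both lower bounds at once. As \<open>r \<le> r' - 1\<close> and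
      \<open>v\<close> has at most \<open>r'\<close> neighbours, twice the number of edges is at
      most \<open>(r' - 1) * r' + 2 * r' = r' * (r' + 1)\<close>.\<close>
    define r' where "r' = max (r + 1) (card N)"
    obtain t where t: "r' = Suc t" "r \<le> t" unfolding r'_def by (cases r') (auto simp: r'_def max_def split: if_splits)
    have "2 ^ r' \<le> card (cut E ` Pow (insert v V))" using 1 2 by (simp add: r'_def max_def)
    moreover have "2 * card E \<le> r' * (r' + 1)"
    proof -
      have "r * (r + 1) \<le> t * (t + 1)" using t(2) by (intro mult_le_mono) auto
      moreover have "card N \<le> Suc t" using t(1) unfolding r'_def by simp
      ultimately show ?thesis using r(2) cardE unfolding t(1) by simp
    qed
    ultimately show ?thesis by blast
  qed
qed

definition set_sum :: "'s set set \<Rightarrow> 's set" where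
  "set_sum U = {s. parity U (\<lambda>c. s \<in> c)}"

lemma ex_spanning_independent:
  assumes Z: "finite Z"
  shows "\<exists>C\<subseteq>Z. (\<forall>U. U \<subseteq> C \<and> U \<noteq> {} \<longrightarrow> set_sum U \<noteq> {}) \<and> card Z \<le> 2 ^ card C"
proof -
  let ?ind = "\<lambda>C. C \<subseteq> Z \<and> (\<forall>U. U \<subseteq> C \<and> U \<noteq> {} \<longrightarrow> set_sum U \<noteq> {})"
  have "?ind {}" by simp
  moreover have "card C \<le> card Z" if "?ind C" for C using that Z by (auto intro: card_mono)
  ultimately obtain C where C: "?ind C" and max: "\<And>D. ?ind D \<Longrightarrow> card D \<le> card C"
    using ex_has_greatest_nat[of ?ind "{}" card "Suc (card Z)"] by (auto simp: less_Suc_eq_le)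
  have finC: "finite C" using C Z finite_subset by blast
  have "z \<in> set_sum ` Pow C" if z: "z \<in> Z" for z
  proof (cases "z \<in> C")
    case True
    then have "set_sum {z} = z" by (simp add: set_sum_def)
    then show ?thesis using True by (metis Pow_iff empty_subsetI image_eqI insert_subset)
  next
    case False
    then have "card (insert z C) = Suc (card C)" using finC by simp
    then have "\<not> ?ind (insert z C)" using max[of "insert z C"] by auto
    then obtain U where U: "U \<subseteq> insert z C" "U \<noteq> {}" "set_sum U = {}" using C z by blast
    have "z \<in> U" using U C by blast
    define W where "W = U - {z}"
    have W: "W \<subseteq> C" "U = insert z W" "z \<notin> W" using U \<open>z \<in> U\<close> by (auto simp: W_def)
    have "finite W" using W(1) finC finite_subset by blast
    have "s \<in> set_sum W \<longleftrightarrow> s \<in> z" for s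
    proof -
      have "\<not> parity (insert z W) (\<lambda>c. s \<in> c)" using U(3) W(2) unfolding set_sum_def by blast
      then show ?thesis using parity_insert[OF \<open>finite W\<close> W(3)] by (simp add: set_sum_def)
    qed
    then have "set_sum W = z" by blast
    then show ?thesis using W(1) by blast
  qed
  then have "card Z \<le> card (set_sum ` Pow C)" using finC by (intro card_mono) auto
  also have "\<dots> \<le> card (Pow C)" using finC by (intro card_image_le) simp
  also have "\<dots> = 2 ^ card C" using finC by (simp add: card_Pow)
  finally show ?thesis using C by blast
qed

text \<open>The inequalities reduce to \<open>n * n - 7 * n + 6 * k \<ge> 0\<close>, and
  \<open>rho k\<close> is the larger root rounded up. The quadratic is also nonnegative below its
  smaller root, as at \<open>n = 3\<close> for \<open>k = 2\<close>; the five edges exclude that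
  range.\<close>

lemma heawood_bound:
  fixes n s1 s2 :: nat and k :: int
  assumes euler: "int n - int s1 + int s2 \<le> k" and deg: "2 * s1 \<le> 3 * s2"
    and simple: "2 * s1 \<le> n * (n - 1)" and "5 \<le> s1"
  shows "2 * rho k - 2 * k \<le> int s2"
proof -
  have n4: "4 \<le> n"
  proof (rule ccontr)
    assume "\<not> 4 \<le> n"
    then have "n * (n - 1) \<le> 3 * 2" by (intro mult_le_mono) auto
    then show False using simple assms(4) by linarith
  qed
  have "int (n * (n - 1)) = int n * (int n - 1)" using n4 by (simp add: of_nat_diff)
  then have "2 * int s1 \<le> int n * (int n - 1)" using simple by (metis of_nat_le_iff of_nat_mult of_nat_numeral)
  moreover have deg': "2 * int s1 \<le> 3 * int s2" using deg by (metis of_nat_le_iff of_nat_mult of_nat_numeral)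
  \<comment> \<open>From \<open>n - k \<le> s1 - s2\<close> and
    \<open>s2 \<ge> 2 * s1 / 3\<close>.\<close>
  then have "3 * (int n - k) \<le> int s1" using euler by (smt (verit))
  ultimately have "6 * (int n - k) \<le> int n * (int n - 1)" by linarith
  then have "real_of_int (6 * (int n - k)) \<le> real_of_int (int n * (int n - 1))" by (simp only: of_int_le_iff)
  then have q: "6 * (real n - real_of_int k) \<le> real n * (real n - 1)" by simp
  have "49 - 24 * real_of_int k \<le> (2 * real n - 7)\<^sup>2"
    using q by (simp add: power2_eq_square algebra_simps)
  then have "sqrt (49 - 24 * real_of_int k) \<le> 2 * real n - 7"
    using n4 by (intro real_le_lsqrt) auto
  then have "rho k \<le> int n" unfolding rho_def by (simp add: ceiling_le_iff)
  \<comment> \<open>Replacing \<open>s1\<close> by its bound \<open>3 * s2 / 2\<close> in the Euler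
    inequality gives \<open>s2 \<ge> 2 * (n - k)\<close>.\<close>
  then show ?thesis using euler deg' by linarith
qed

section \<open>Triangles and edges\<close>

definition edges_of :: "nat set \<Rightarrow> nat set set" where
  "edges_of s = {e. e \<subseteq> s \<and> card e = 2}"

definition mid :: "nat set \<Rightarrow> nat" where
  "mid s = Min (s - {Min s})"

lemma triangle_sorted:
  assumes "card s = 3"
  obtains a b c where "a < b" "b < c" "s = {a, b, c :: nat}"
proof -
  obtain x y z where s: "s = {x, y, z}" "x \<noteq> y" "y \<noteq> z" "x \<noteq> z"
    using assms by (auto simp: card_3_iff)
  then consider "x < y" "y < z" | "x < z" "z < y" | "y < x" "x < z" | "y < z" "z < x" | "z < x" "x < y" | "z < y" "y < x"
    by linarith
  then show thesis
  proof cases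
    case 1 then show thesis using that[of x y z] s by simp
  next
    case 2 then show thesis using that[of x z y] s by (simp add: insert_commute)
  next
    case 3 then show thesis using that[of y x z] s by (simp add: insert_commute)
  next
    case 4 then show thesis using that[of y z x] s by (simp add: insert_commute)
  next
    case 5 then show thesis using that[of z x y] s by (simp add: insert_commute)
  next
    case 6 then show thesis using that[of z y x] s by (simp add: insert_commute)
  qed
qed

lemma sorted_triangle:
  assumes "a < b" "b < c" "s = {a, b, c :: nat}"
  shows "Min s = a" "mid s = b" "Max s = c" "card s = 3"
proof -
  show m: "Min s = a" using assms by simp
  have "s - {a} = {b, c}" using assms by auto
  then show "mid s = b" using assms unfolding mid_def m by simp
  show "Max s = c" "card s = 3" using assms by simp_all
qed

lemma edges_of_triangle:
  assumes "a < b" "b < c" "s = {a, b, c :: nat}"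
  shows "edges_of s = {{a, b}, {b, c}, {a, c}}" "parity (edges_of s) h \<longleftrightarrow> (h {a, b} \<noteq> (h {b, c} \<noteq> h {a, c}))"
proof -
  show e: "edges_of s = {{a, b}, {b, c}, {a, c}}"
  proof (intro equalityI subsetI)
    fix e assume "e \<in> edges_of s"
    then obtain x y where "e = {x, y}" "x \<noteq> y" "x \<in> s" "y \<in> s"
      by (auto simp: edges_of_def card_2_iff)
    then show "e \<in> {{a, b}, {b, c}, {a, c}}" using assms by (auto simp: insert_commute)
  qed (use assms in \<open>auto simp: edges_of_def\<close>)
  have "{a, b} \<notin> {{b, c}, {a, c}}" "{b, c} \<notin> {{a, c}}" using assms by (auto simp: doubleton_eq_iff)
  then show "parity (edges_of s) h \<longleftrightarrow> (h {a, b} \<noteq> (h {b, c} \<noteq> h {a, c}))"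
    unfolding e by simp
qed

lemma finite_edges_of: "finite s \<Longrightarrow> finite (edges_of s)"
  unfolding edges_of_def by (rule finite_subset[of _ "Pow s"]) auto

lemma card_edges_of: "card s = 3 \<Longrightarrow> card (edges_of s) = 3"
  unfolding edges_of_def using n_subsets[of s 2] by (simp add: card_ge_0_finite choose_two)

text \<open>Mod 2 cycles as sets of triangles. The condition ranges over all two-element sets, not
  just the edges of \<open>L\<close>, so a cycle remains one when \<open>L\<close> is enlarged, or
  shrunk around it.\<close>

definition cycles2 :: "nat set set \<Rightarrow> nat set set set" where
  "cycles2 L = {c. c \<subseteq> L \<and> (\<forall>e. card e = 2 \<longrightarrow> \<not> parity c (\<lambda>s. e \<subseteq> s))}"

text \<open>After exchanging the sums, an edge is counted once for every triangle of
  \<open>c\<close> that contains it, hence evenly often.\<close>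

lemma stokes:
  assumes c: "c \<in> cycles2 L" and "finite L" and tri: "\<And>s. s \<in> L \<Longrightarrow> card s = 3"
  shows "\<not> parity c (\<lambda>s. parity (edges_of s) h)"
proof -
  have cL: "c \<subseteq> L" and finc: "finite c" using c \<open>finite L\<close> by (auto simp: cycles2_def finite_subset)
  define E where "E = (\<Union>s\<in>c. edges_of s)"
  have finE: "finite E" unfolding E_def using finc cL tri
    by (auto intro!: finite_edges_of dest!: subsetD simp: card_ge_0_finite)
  have "parity c (\<lambda>s. parity (edges_of s) h) \<longleftrightarrow> parity c (\<lambda>s. parity E (\<lambda>e. h e \<and> e \<subseteq> s))"
  proof (rule parity_cong[OF refl])
    fix s assume s: "s \<in> c"
    have "parity E (\<lambda>e. h e \<and> e \<subseteq> s) \<longleftrightarrow> parity (edges_of s) (\<lambda>e. h e \<and> e \<subseteq> s)"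
      by (rule parity_superset) (use s in \<open>auto simp: E_def edges_of_def\<close>)
    also have "\<dots> \<longleftrightarrow> parity (edges_of s) h" by (rule parity_cong) (auto simp: edges_of_def)
    finally show "parity (edges_of s) h \<longleftrightarrow> parity E (\<lambda>e. h e \<and> e \<subseteq> s)" by simp
  qed
  also have "\<dots> \<longleftrightarrow> parity E (\<lambda>e. parity c (\<lambda>s. h e \<and> e \<subseteq> s))" by (rule parity_swap[OF finc finE])
  also have "\<dots> \<longleftrightarrow> parity E (\<lambda>e. False)"
  proof (rule parity_cong[OF refl])
    fix e assume "e \<in> E"
    then have "\<not> parity c (\<lambda>s. e \<subseteq> s)" using c by (auto simp: cycles2_def E_def edges_of_def)
    then show "parity c (\<lambda>s. h e \<and> e \<subseteq> s) \<longleftrightarrow> False" by (simp add: parity_conj)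
  qed
  finally show ?thesis by simp
qed

lemma cycles2_sym_diff:
  assumes "c \<in> cycles2 L" "d \<in> cycles2 L" "finite L"
  shows "sym_diff c d \<in> cycles2 L"
proof -
  have "finite c" "finite d" using assms by (auto simp: cycles2_def finite_subset)
  then show ?thesis using assms by (auto simp: cycles2_def parity_sym_diff)
qed

section \<open>Low-degree cochains of a group\<close>

lemma bar_coboundary_1:
  assumes "x \<in> carrier G" "y \<in> carrier G"
  shows "bar_coboundary G 1 f [x, y] \<longleftrightarrow> (f [x] \<noteq> (f [y] \<noteq> f [x \<otimes>\<^bsub>G\<^esub> y]))"
proof -
  have "{..Suc 1} = {0, 1, 2 :: nat}" by auto
  then show ?thesis using assms by (auto simp: bar_coboundary_parity bar_face_def)
qed

lemma bar_coboundary_2: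
  assumes "x \<in> carrier G" "y \<in> carrier G" "z \<in> carrier G"
  shows "bar_coboundary G 2 f [x, y, z] \<longleftrightarrow>
    (f [y, z] \<noteq> (f [x \<otimes>\<^bsub>G\<^esub> y, z] \<noteq> (f [x, y \<otimes>\<^bsub>G\<^esub> z] \<noteq> f [x, y])))"
proof -
  have "{..Suc 2} = {0, 1, 2, 3 :: nat}" by auto
  then show ?thesis using assms by (auto simp: bar_coboundary_parity bar_face_def numeral_2_eq_2 numeral_3_eq_3)
qed

lemma bar_coboundary_support: "bar_coboundary G n f x \<Longrightarrow> length x = Suc n \<and> set x \<subseteq> carrier G"
  by (simp add: bar_coboundary_def)

lemma length_1E: "length x = Suc 0 \<Longrightarrow> \<exists>a. x = [a]"
  by (simp add: length_Suc_conv)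

lemma cocycles1_mult:
  "a \<in> cocycles G 1 \<Longrightarrow> x \<in> carrier G \<Longrightarrow> y \<in> carrier G \<Longrightarrow> a [x \<otimes>\<^bsub>G\<^esub> y] \<longleftrightarrow> (a [x] \<noteq> a [y])"
  using bar_coboundary_1[of x G y a] by (auto simp: cocycles_def)

lemma cocycles2_eq:
  "f \<in> cocycles G 2 \<Longrightarrow> x \<in> carrier G \<Longrightarrow> y \<in> carrier G \<Longrightarrow> z \<in> carrier G \<Longrightarrow>
    f [y, z] \<noteq> f [x \<otimes>\<^bsub>G\<^esub> y, z] \<longleftrightarrow> f [x, y \<otimes>\<^bsub>G\<^esub> z] \<noteq> f [x, y]"
  using bar_coboundary_2[of x G y z f] by (auto simp: cocycles_def)

text \<open>Both faces of a 1-cell are the empty cell and cancel mod 2.\<close>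

lemma coboundaries_1: "coboundaries G 1 = {\<lambda>_. False}"
proof -
  have "bar_coboundary G 0 f = (\<lambda>_. False)" for f
  proof (rule ext)
    fix x
    have two: "{..Suc 0} = {0, 1 :: nat}" by auto
    have "\<not> parity {..Suc 0} (\<lambda>i. f (bar_face G i x))" if l: "length x = Suc 0"
    proof -
      obtain a where "x = [a]" using length_1E[OF l] by (elim exE)
      then show ?thesis unfolding two by (simp add: bar_face_def)
    qed
    then show "bar_coboundary G 0 f x \<longleftrightarrow> False" by (auto simp: bar_coboundary_parity)
  qed
  moreover have "bar_cochains G 0 \<noteq> {}" by (auto simp: bar_cochains_def)
  ultimately show ?thesis by (auto simp: coboundaries_def)
qed

lemma cup11_cocycle:
  assumes G: "group G" and a: "a \<in> cocycles G 1" and b: "b \<in> cocycles G 1"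
  shows "cup11 G a b \<in> cocycles G 2"
proof -
  interpret group G by fact
  have "bar_coboundary G 2 (cup11 G a b) w \<longleftrightarrow> False" for w
  proof (cases "length w = 3 \<and> set w \<subseteq> carrier G")
    case True
    then obtain x y z where w: "w = [x, y, z]" by (auto simp: length_Suc_conv numeral_3_eq_3)
    then show ?thesis using True cocycles1_mult[OF a] cocycles1_mult[OF b]
      by (simp add: bar_coboundary_2 cup11_def) blast
  qed (auto dest: bar_coboundary_support)
  then show ?thesis by (auto simp: cocycles_def bar_cochains_def cup11_def)
qed

lemma bar_coboundary_zeroI:
  assumes "\<And>x y. x \<in> carrier G \<Longrightarrow> y \<in> carrier G \<Longrightarrow> f [x, y] \<longleftrightarrow> (b x \<noteq> (b y \<noteq> b (x \<otimes>\<^bsub>G\<^esub> y)))"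
    and "f \<in> bar_cochains G 2" and "group G"
  shows "f \<in> coboundaries G 2"
proof -
  interpret group G by fact
  define \<beta> where "\<beta> w \<longleftrightarrow> (\<exists>h\<in>carrier G. w = [h] \<and> b h)" for w
  have "f w \<longleftrightarrow> bar_coboundary G 1 \<beta> w" for w
  proof (cases "length w = 2 \<and> set w \<subseteq> carrier G")
    case True
    then obtain x y where "w = [x, y]" by (auto simp: length_Suc_conv numeral_2_eq_2)
    then show ?thesis using True assms(1)[of x y] bar_coboundary_1[of x G y \<beta>] by (auto simp: \<beta>_def)
  next
    case False
    then show ?thesis using assms(2) bar_coboundary_support[of G 1 \<beta> w] by (auto simp: bar_cochains_def numeral_2_eq_2)
  qed
  then have "f = bar_coboundary G 1 \<beta>" by (rule ext)
  moreover have "\<beta> \<in> bar_cochains G 1" by (auto simp: \<beta>_def bar_cochains_def)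
  ultimately show ?thesis by (simp add: coboundaries_def)
qed

section \<open>The central extension of a 2-cocycle\<close>

text \<open>The central extension of \<open>G\<close> by the group of order two with cocycle
  \<open>f\<close>. Since \<open>f\<close> need not be normalized, the second entry of the unit is
  its value at the pair of units.\<close>

definition extension :: "('a, 'c) monoid_scheme \<Rightarrow> ('a list \<Rightarrow> bool) \<Rightarrow> ('a \<times> bool) monoid" where
  "extension G f = \<lparr>carrier = carrier G \<times> UNIV,
     mult = (\<lambda>u v. (fst u \<otimes>\<^bsub>G\<^esub> fst v, snd u \<noteq> (snd v \<noteq> f [fst u, fst v]))),
     one = (\<one>\<^bsub>G\<^esub>, f [\<one>\<^bsub>G\<^esub>, \<one>\<^bsub>G\<^esub>])\<rparr>"

lemma extension_simps [simp]:
  "u \<in> carrier (extension G f) \<longleftrightarrow> fst u \<in> carrier G"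
  "u \<otimes>\<^bsub>extension G f\<^esub> v = (fst u \<otimes>\<^bsub>G\<^esub> fst v, snd u \<noteq> (snd v \<noteq> f [fst u, fst v]))"
  "\<one>\<^bsub>extension G f\<^esub> = (\<one>\<^bsub>G\<^esub>, f [\<one>\<^bsub>G\<^esub>, \<one>\<^bsub>G\<^esub>])"
  by (auto simp: extension_def mem_Times_iff)

lemma group_extension:
  assumes "group G" and f: "f \<in> cocycles G 2"
  shows "group (extension G f)"
proof -
  interpret group G by fact
  show ?thesis
  proof (rule groupI, goal_cases)
    case (3 x y z)
    then show ?case using cocycles2_eq[OF f, of "fst x" "fst y" "fst z"] by (auto simp: m_assoc)
  next
    case (4 x)
    \<comment> \<open>This instance of the cocycle identity says that \<open>f\<close> is constant
      on pairs whose first entry is the unit.\<close>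
    then show ?case using cocycles2_eq[OF f, of "\<one>\<^bsub>G\<^esub>" "\<one>\<^bsub>G\<^esub>" "fst x"] by (cases x) auto
  next
    case (5 x)
    then show ?case
      by (intro bexI[of _ "(inv\<^bsub>G\<^esub> (fst x), snd x \<noteq> (f [\<one>\<^bsub>G\<^esub>, \<one>\<^bsub>G\<^esub>] \<noteq> f [inv\<^bsub>G\<^esub> (fst x), fst x]))"]) auto
  qed auto
qed

lemma fst_extension_hom: "fst \<in> hom (extension G f) G"
  by (auto intro: homI)

section \<open>Complexes whose fundamental group retracts onto a group\<close>

text \<open>The labels \<open>g\<close> describe a retraction onto \<open>G\<close>, the loops \<open>\<gamma>\<close> its section.\<close>

locale retract_labels = labeled_complex G K g
  for G :: "('a, 'c) monoid_scheme" (structure) and K g +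
  fixes v0 :: nat and \<gamma> :: "'a \<Rightarrow> nat list"
  assumes loop: "\<And>h. h \<in> carrier G \<Longrightarrow> \<gamma> h \<in> edge_loops K v0"
    and loop_label: "\<And>h. h \<in> carrier G \<Longrightarrow> path_label G g (\<gamma> h) = h"
    and loop_mult: "\<And>h k. h \<in> carrier G \<Longrightarrow> k \<in> carrier G \<Longrightarrow> hpt K (\<gamma> h @ tl (\<gamma> k)) (\<gamma> (h \<otimes> k))"
begin

definition triangles :: "nat set set" where "triangles = {s \<in> K. card s = 3}"

text \<open>Where the simplicial map to the bar construction sends a triangle with its vertices in
  increasing order; \<open>coboundary_cell\<close> says that this respects coboundaries.\<close>

definition cell :: "nat set \<Rightarrow> 'a list" where "cell s = [g (Min s) (mid s), g (mid s) (Max s)]"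

definition elabel :: "nat set \<Rightarrow> 'a" where "elabel e = g (Min e) (Max e)"

lemma finite_K: "finite K"
  using complex by (simp add: simplicial_complex_def)

lemma finite_triangles: "finite triangles"
  using finite_K by (simp add: triangles_def)

lemma elabel_pair: "a < b \<Longrightarrow> elabel {a, b} = g a b"
  by (simp add: elabel_def)

lemma triangleE:
  assumes "s \<in> triangles"
  obtains a b c where "a < b" "b < c" "s = {a, b, c}" "cell s = [g a b, g b c]"
    "g a b \<in> carrier G" "g b c \<in> carrier G" "g a c = g a b \<otimes> g b c"
    "\<And>h. parity (edges_of s) h \<longleftrightarrow> (h {a, b} \<noteq> (h {b, c} \<noteq> h {a, c}))"
    "elabel {a, b} = g a b" "elabel {b, c} = g b c" "elabel {a, c} = g a c"
proof -
  have s: "s \<in> K" "card s = 3" using assms by (auto simp: triangles_def)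
  then obtain a b c where abc: "a < b" "b < c" "s = {a, b, c}" using triangle_sorted by metis
  have "{a, b} \<in> K" "{b, c} \<in> K" by (rule simplicial_complex_subset[OF complex s(1)]; use abc in auto)+
  then show thesis
    using that[OF abc] sorted_triangle[OF abc] edges_of_triangle[OF abc] label_mult[of a b c] s abc
    by (auto simp: cell_def elabel_pair)
qed

lemma cell_closed: "s \<in> triangles \<Longrightarrow> length (cell s) = 2 \<and> set (cell s) \<subseteq> carrier G"
  by (erule triangleE) simp

lemma coboundary_cell:
  assumes "s \<in> triangles"
  shows "bar_coboundary G 1 f (cell s) \<longleftrightarrow> parity (edges_of s) (\<lambda>e. f [elabel e])"
  using assms
proof (rule triangleE)
  fix a b c assume "cell s = [g a b, g b c]" "g a b \<in> carrier G" "g b c \<in> carrier G" "g a c = g a b \<otimes> g b c"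
    "\<And>h. parity (edges_of s) h \<longleftrightarrow> (h {a, b} \<noteq> (h {b, c} \<noteq> h {a, c}))"
    "elabel {a, b} = g a b" "elabel {b, c} = g b c" "elabel {a, c} = g a c"
  then show ?thesis by (simp add: bar_coboundary_1 del: One_nat_def)
qed

text \<open>Injectivity of the map from the second cohomology of \<open>G\<close> to that of
  \<open>L\<close>: in top dimension, and over a field, a cochain is a coboundary as soon as it
  vanishes on all cycles.\<close>

definition detects :: "nat set set \<Rightarrow> bool" where
  "detects L \<longleftrightarrow> (\<forall>f\<in>cocycles G 2. (\<forall>c\<in>cycles2 L. \<not> parity c (\<lambda>s. f (cell s))) \<longrightarrow> f \<in> coboundaries G 2)"

lemma detectsD:
  "detects L \<Longrightarrow> f \<in> cocycles G 2 \<Longrightarrow> (\<And>c. c \<in> cycles2 L \<Longrightarrow> \<not> parity c (\<lambda>s. f (cell s))) \<Longrightarrow> f \<in> coboundaries G 2"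
  by (simp add: detects_def)

text \<open>If \<open>f\<close> were not a coboundary on the triangles, some functional would kill
  all coboundaries but not \<open>f\<close>; its support is a 2-cycle on which \<open>f\<close> does
  not vanish.\<close>

lemma ex_primitive:
  assumes f: "\<And>c. c \<in> cycles2 triangles \<Longrightarrow> \<not> parity c (\<lambda>s. f (cell s))"
  shows "\<exists>a. \<forall>s\<in>triangles. f (cell s) \<longleftrightarrow> parity (edges_of s) a"
proof -
  define b where "b a s \<longleftrightarrow> s \<in> triangles \<and> parity (edges_of s) a" for a s
  define z where "z s \<longleftrightarrow> s \<in> triangles \<and> f (cell s)" for s
  have fin: "finite {s. b a s}" "finite {s. z s}" for a
    by (rule finite_subset[OF _ finite_triangles]; auto simp: b_def z_def)+
  have fine: "finite (edges_of s)" if "s \<in> triangles" for s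
    using that by (intro finite_edges_of) (auto simp: triangles_def card_ge_0_finite)
  have closed: "xor_closed (range b)" unfolding xor_closed_def
  proof (intro conjI ballI)
    have "b (\<lambda>_. False) = (\<lambda>_. False)" by (rule ext) (simp add: b_def)
    then show "(\<lambda>_. False) \<in> range b" by (metis rangeI)
    fix p q assume "p \<in> range b" "q \<in> range b"
    then obtain a a' where "p = b a" "q = b a'" by blast
    then have "(\<lambda>x. p x \<noteq> q x) = b (\<lambda>e. a e \<noteq> a' e)"
      by (intro ext) (metis b_def fine parity_xor)
    then show "(\<lambda>x. p x \<noteq> q x) \<in> range b" by simp
  qed
  have "z \<in> range b"
  proof (rule ccontr)
    assume "z \<notin> range b"
    then obtain \<phi> where \<phi>: "\<forall>p\<in>range b. \<not> pairing \<phi> p" "pairing \<phi> z"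
      using ex_separating_cochain[OF closed _ _ fin(2)] fin(1) by blast
    \<comment> \<open>That the functional kills the coboundary of a single edge means that this edge
      lies in evenly many triangles of \<open>c\<close>.\<close>
    define c where "c = {s \<in> triangles. \<phi> s}"
    have "c \<in> cycles2 triangles" unfolding cycles2_def
    proof (intro CollectI conjI allI impI)
      show "c \<subseteq> triangles" by (auto simp: c_def)
      fix e :: "nat set" assume e: "card e = 2"
      have "b (\<lambda>e'. e = e' \<and> True) s \<longleftrightarrow> s \<in> triangles \<and> e \<subseteq> s" for s
      proof (cases "s \<in> triangles \<and> e \<subseteq> s")
        case True
        then have "e \<in> edges_of s" using e by (simp add: edges_of_def)
        then show ?thesis using True parity_delta[OF fine, of s e "\<lambda>_. True"] by (simp add: b_def)
      next
        case False
        have "parity (edges_of s) (\<lambda>e'. e = e' \<and> True) \<longleftrightarrow> False" if "\<not> e \<subseteq> s"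
          using that parity_cong[of "edges_of s" "edges_of s" "\<lambda>e'. e = e' \<and> True" "\<lambda>_. False"]
          by (auto simp: edges_of_def)
        then show ?thesis using False by (auto simp: b_def)
      qed
      then have eq: "{s. b (\<lambda>e'. e = e' \<and> True) s} = {s \<in> triangles. e \<subseteq> s}" by blast
      have "parity c (\<lambda>s. e \<subseteq> s) \<longleftrightarrow> parity {s \<in> triangles. e \<subseteq> s} \<phi>"
        unfolding parity_def c_def by (rule arg_cong[where f = "\<lambda>S. odd (card S)"]) auto
      also have "\<dots> \<longleftrightarrow> pairing \<phi> (b (\<lambda>e'. e = e' \<and> True))" unfolding pairing_def eq ..
      also have "\<dots> \<longleftrightarrow> False" using \<phi>(1) by blast
      finally show "\<not> parity c (\<lambda>s. e \<subseteq> s)" by simp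
    qed
    moreover have "parity c (\<lambda>s. f (cell s)) \<longleftrightarrow> pairing \<phi> z"
      unfolding pairing_def parity_def c_def z_def by (rule arg_cong[where f = "\<lambda>S. odd (card S)"]) auto
    ultimately show False using f \<phi>(2) by blast
  qed
  then obtain a where "z = b a" by blast
  then have "f (cell s) \<longleftrightarrow> parity (edges_of s) a" if "s \<in> triangles" for s
    using that fun_cong[OF \<open>z = b a\<close>, of s] unfolding z_def b_def by blast
  then show ?thesis by blast
qed

text \<open>On an increasing triangle, multiplicativity in the extension is precisely the statement
  that \<open>f\<close> is the coboundary of \<open>a\<close>.\<close>

lemma ex_extension_labeling:
  assumes f: "f \<in> cocycles G 2"
    and a: "\<And>s. s \<in> triangles \<Longrightarrow> f (cell s) \<longleftrightarrow> parity (edges_of s) a"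
  shows "\<exists>l. labeling K (extension G f) l \<and> (\<forall>u v. {u, v} \<in> K \<longrightarrow> g u v = fst (l u v))"
proof -
  let ?E = "extension G f"
  interpret E: group ?E by (rule group_extension[OF is_group f])
  interpret h: group_hom ?E G fst using fst_extension_hom by unfold_locales
  \<comment> \<open>The second entry ignores the direction of the edge, so this is right only for
    \<open>u < v\<close>; \<open>l'\<close> inverts it for the other direction.\<close>
  define l where "l u v = (g u v, a {u, v})" for u v
  define l' where "l' u v = (if u < v then l u v else if v < u then inv\<^bsub>?E\<^esub> (l v u) else \<one>\<^bsub>?E\<^esub>)" for u v
  have "labeling K ?E l'"
    unfolding l'_def
  proof (rule E.labeling_of_sorted[OF complex])
    show "l u v \<in> carrier ?E" if "{u, v} \<in> K" for u v using that by (simp add: l_def)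
    fix u v w assume uvw: "{u, v, w} \<in> K" "u < v" "v < w"
    have "card {u, v, w} = 3" using uvw by simp
    then have t: "{u, v, w} \<in> triangles" using uvw by (simp add: triangles_def)
    have "cell {u, v, w} = [g u v, g v w]"
      using sorted_triangle[OF uvw(2,3) refl] by (simp add: cell_def)
    moreover have "parity (edges_of {u, v, w}) a \<longleftrightarrow> (a {u, v} \<noteq> (a {v, w} \<noteq> a {u, w}))"
      by (rule edges_of_triangle(2)[OF uvw(2,3) refl])
    ultimately have "f [g u v, g v w] \<longleftrightarrow> (a {u, v} \<noteq> (a {v, w} \<noteq> a {u, w}))" using a[OF t] by simp
    then show "l u v \<otimes>\<^bsub>?E\<^esub> l v w = l u w"
      using label_mult[OF uvw(1)] by (auto simp: l_def)
  qed
  moreover have "g u v = fst (l' u v)" if uv: "{u, v} \<in> K" for u v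
  proof -
    consider "u < v" | "v < u" | "u = v" by linarith
    then show ?thesis
    proof cases
      case 2
      have vu: "{v, u} \<in> K" using uv by (simp add: insert_commute)
      then have "fst (inv\<^bsub>?E\<^esub> (l v u)) = inv (g v u)" by (subst h.hom_inv) (auto simp: l_def)
      then show ?thesis using 2 label_sym[OF vu] by (simp add: l'_def)
    next
      case 3
      then show ?thesis using uv label_refl[of u] by (simp add: l'_def)
    qed (simp add: l'_def l_def)
  qed
  ultimately show ?thesis by blast
qed

text \<open>A 2-cocycle vanishing on the complex gives a central extension to which the retraction
  lifts; composed with the section the lift splits the extension.\<close>

lemma detects_triangles: "detects triangles"
  unfolding detects_def
proof (intro ballI impI)
  fix f assume f: "f \<in> cocycles G 2" and van: "\<forall>c\<in>cycles2 triangles. \<not> parity c (\<lambda>s. f (cell s))"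
  let ?E = "extension G f"
  obtain a where "\<forall>s\<in>triangles. f (cell s) \<longleftrightarrow> parity (edges_of s) a" using ex_primitive van by blast
  then obtain l where l: "labeling K ?E l" "\<And>u v. {u, v} \<in> K \<Longrightarrow> g u v = fst (l u v)"
    using ex_extension_labeling[OF f] by blast
  interpret E: group ?E by (rule group_extension[OF is_group f])
  interpret E: labeled_complex ?E K l using complex l by unfold_locales
  have path: "edge_path K (\<gamma> h)" "hd (\<gamma> h) = v0" "last (\<gamma> h) = v0" if "h \<in> carrier G" for h
    using loop[OF that] by (auto simp: edge_loops_def)
  \<comment> \<open>The second coordinate along the section is the 1-cochain with coboundary
    \<open>f\<close>.\<close>
  define b where "b h = snd (path_label ?E l (\<gamma> h))" for h
  have pl: "path_label ?E l (\<gamma> h) = (h, b h)" if h: "h \<in> carrier G" for h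
  proof -
    have "path_label G g (\<gamma> h) = fst (path_label ?E l (\<gamma> h))"
      by (rule path_label_hom[OF E.is_group is_group fst_extension_hom complex l(1) path(1)[OF h] l(2)])
    then show ?thesis using loop_label[OF h] by (simp add: b_def prod_eq_iff)
  qed
  show "f \<in> coboundaries G 2"
  proof (rule bar_coboundary_zeroI[OF _ _ is_group])
    show "f \<in> bar_cochains G 2" using f by (simp add: cocycles_def)
    fix x y assume xy: "x \<in> carrier G" "y \<in> carrier G"
    have "path_label ?E l (\<gamma> (x \<otimes> y)) = path_label ?E l (\<gamma> x @ tl (\<gamma> y))"
      using E.path_label_hpt[OF loop_mult[OF xy]] edge_path_glue path xy by simp
    also have "\<dots> = path_label ?E l (\<gamma> x) \<otimes>\<^bsub>?E\<^esub> path_label ?E l (\<gamma> y)"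
      using path xy by (intro E.path_label_glue) auto
    finally show "f [x, y] \<longleftrightarrow> (b x \<noteq> (b y \<noteq> b (x \<otimes> y)))"
      using pl xy by auto
  qed
qed

text \<open>The loops \<open>\<gamma>\<close> write every element of \<open>G\<close> as a product
  of edge labels, and a 1-cocycle is a homomorphism.\<close>

lemma cocycle1_zero:
  assumes \<alpha>: "\<alpha> \<in> cocycles G 1" and zero: "\<And>e. e \<in> K \<Longrightarrow> card e = 2 \<Longrightarrow> \<not> \<alpha> [elabel e]"
  shows "\<alpha> = (\<lambda>_. False)"
proof -
  note mult = cocycles1_mult[OF \<alpha>]
  have one: "\<not> \<alpha> [\<one>]" using mult[of \<one> \<one>] by simp
  have inv: "\<alpha> [inv x] \<longleftrightarrow> \<alpha> [x]" if "x \<in> carrier G" for x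
    using mult[of "inv x" x] that one by simp
  have edge: "\<not> \<alpha> [g u v]" if uv: "{u, v} \<in> K" for u v
  proof -
    consider "u < v" | "v < u" | "u = v" by linarith
    then show ?thesis
    proof cases
      case 1
      then show ?thesis using zero[OF uv] elabel_pair[of u v] by simp
    next
      case 2
      have vu: "{v, u} \<in> K" using uv by (simp add: insert_commute)
      then show ?thesis using 2 zero[OF vu] elabel_pair[of v u] label_sym[OF vu] inv[of "g v u"] by simp
    next
      case 3
      then show ?thesis using uv one label_refl[of u] by simp
    qed
  qed
  have "\<not> \<alpha> [path_label G g p]" if "edge_path K p" for p
    using that
  proof (induction p rule: induct_list012)
    case (3 u v p)
    then show ?case using mult[of "g u v" "path_label G g (v # p)"] edge[of u v] by simp
  qed (use one in auto)
  then have zero: "\<not> \<alpha> [h]" if "h \<in> carrier G" for h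
    using loop[OF that] loop_label[OF that] by (metis (no_types, lifting) edge_loops_def mem_Collect_eq)
  show ?thesis
  proof (rule ext)
    fix x
    have "length x = Suc 0 \<and> set x \<subseteq> carrier G" if "\<alpha> x"
      using \<alpha> that by (simp add: cocycles_def bar_cochains_def)
    then show "\<alpha> x = False" using zero length_1E[of x] by auto
  qed
qed

text \<open>The sums of dual cocycles over different subsets of \<open>S\<close> are not
  cohomologous, so their values on \<open>X\<close> differ: there are at most as many subsets of
  \<open>S\<close> as of \<open>X\<close>.\<close>

lemma independent_card_bound:
  assumes S: "independent_mod (cycles G (Suc n)) (boundaries G (Suc n)) S" and X: "finite X"
    and zero: "\<And>f. f \<in> cocycles G (Suc n) \<Longrightarrow> (\<And>x. x \<in> X \<Longrightarrow> \<not> f (r x)) \<Longrightarrow> f \<in> coboundaries G (Suc n)"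
  shows "card S \<le> card X"
proof -
  obtain f where f: "\<And>s. s \<in> S \<Longrightarrow> f s \<in> cocycles G (Suc n)"
    "\<And>U. U \<subseteq> S \<Longrightarrow> U \<noteq> {} \<Longrightarrow> (\<lambda>x. parity U (\<lambda>s. f s x)) \<in> cocycles G (Suc n) - coboundaries G (Suc n)"
    using ex_dual_cocycles[OF is_group S] by metis
  have finS: "finite S" using S by (simp add: independent_mod_def)
  define R where "R U = {x \<in> X. parity U (\<lambda>s. f s (r x))}" for U
  have "inj_on R (Pow S)"
  proof (rule inj_onI, rule ccontr)
    fix U V assume UV: "U \<in> Pow S" "V \<in> Pow S" "R U = R V" "U \<noteq> V"
    have fin: "finite U" "finite V" using UV(1,2) by (auto intro: finite_subset[OF _ finS])
    have "sym_diff U V \<subseteq> S" "sym_diff U V \<noteq> {}" using UV by auto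
    from f(2)[OF this] have "\<exists>x\<in>X. parity (sym_diff U V) (\<lambda>s. f s (r x))" using zero by blast
    then obtain x where "x \<in> X" "parity U (\<lambda>s. f s (r x)) \<noteq> parity V (\<lambda>s. f s (r x))"
      using parity_sym_diff[OF fin] by blast
    then show False using UV(3) unfolding R_def by blast
  qed
  moreover have "R ` Pow S \<subseteq> Pow X" by (auto simp: R_def)
  ultimately have "card (Pow S) \<le> card (Pow X)" using X by (intro card_inj_on_le) auto
  then show ?thesis using X finS by (simp add: card_Pow)
qed

lemma independent_bound_1:
  assumes "independent_mod (cycles G 1) (boundaries G 1) S"
  shows "card S \<le> card {e \<in> K. card e = 2}"
proof (rule independent_card_bound[of 0 S _ "\<lambda>e. [elabel e]", folded One_nat_def, OF assms])
  show "finite {e \<in> K. card e = 2}" using finite_K by simp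
  fix f assume "f \<in> cocycles G 1" "\<And>e. e \<in> {e \<in> K. card e = 2} \<Longrightarrow> \<not> f [elabel e]"
  then have "f = (\<lambda>_. False)" by (intro cocycle1_zero) simp_all
  then show "f \<in> coboundaries G 1" by (simp only: coboundaries_1 singleton_iff)
qed

lemma independent_bound_2:
  "independent_mod (cycles G 2) (boundaries G 2) S \<Longrightarrow> card S \<le> card triangles"
proof -
  assume S: "independent_mod (cycles G 2) (boundaries G 2) S"
  have "f \<in> coboundaries G 2" if "f \<in> cocycles G 2" "\<And>s. s \<in> triangles \<Longrightarrow> \<not> f (cell s)" for f
  proof (rule detectsD[OF detects_triangles that(1)])
    fix c assume "c \<in> cycles2 triangles"
    then have "parity c (\<lambda>s. f (cell s)) \<longleftrightarrow> parity c (\<lambda>s. False)"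
      using that(2) by (intro parity_cong) (auto simp: cycles2_def)
    then show "\<not> parity c (\<lambda>s. f (cell s))" by simp
  qed
  then show ?thesis
    using independent_card_bound[of 1 S triangles cell] S finite_triangles by (simp add: numeral_2_eq_2)
qed

text \<open>The image of a simplicial chain in the bar complex; triangles with the same cell cancel
  in pairs.\<close>

definition push :: "nat set set \<Rightarrow> 'a list \<Rightarrow> bool" where
  "push c y \<longleftrightarrow> parity c (\<lambda>s. cell s = y)"

lemma push_support: "push c y \<Longrightarrow> y \<in> cell ` c"
  using parity_cong[of c c "\<lambda>s. cell s = y" "\<lambda>_. False"] unfolding push_def by auto

lemma pairing_push:
  assumes "finite c"
  shows "pairing f (push c) \<longleftrightarrow> parity c (\<lambda>s. f (cell s))"
proof -
  have fin: "finite (cell ` c)" using assms by simp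
  have "{y. push c y} = {y. push c y \<and> y \<in> cell ` c}" using push_support by blast
  then have "pairing f (push c) \<longleftrightarrow> parity (cell ` c) (\<lambda>y. push c y \<and> f y)"
    unfolding pairing_def using parity_restrict[OF fin, of "push c" f] by simp
  also have "\<dots> \<longleftrightarrow> parity (cell ` c) (\<lambda>y. parity c (\<lambda>s. cell s = y \<and> f y))"
  proof (rule parity_cong[OF refl])
    fix y
    show "(push c y \<and> f y) \<longleftrightarrow> parity c (\<lambda>s. cell s = y \<and> f y)" by (cases "f y") (simp_all add: push_def)
  qed
  also have "\<dots> \<longleftrightarrow> parity c (\<lambda>s. parity (cell ` c) (\<lambda>y. cell s = y \<and> f y))"
    by (rule parity_swap[OF fin assms])
  also have "\<dots> \<longleftrightarrow> parity c (\<lambda>s. f (cell s))"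
    by (rule parity_cong[OF refl]) (use parity_delta[OF fin] in blast)
  finally show ?thesis .
qed

lemma push_cycle:
  assumes c: "c \<in> cycles2 triangles"
  shows "push c \<in> cycles G 2"
proof -
  have cT: "c \<subseteq> triangles" and finc: "finite c"
    using c finite_triangles by (auto simp: cycles2_def finite_subset)
  have chain: "push c \<in> bar_chains G (Suc 1)"
  proof -
    have "finite {y. push c y}" using finite_subset[of "{y. push c y}" "cell ` c"] finc push_support by blast
    moreover have "length y = Suc 1 \<and> set y \<subseteq> carrier G" if "push c y" for y
      using push_support[OF that] cell_closed cT by fastforce
    ultimately show ?thesis by (simp add: bar_chains_def)
  qed
  have "bar_boundary G (push c) y \<longleftrightarrow> False" for y
  proof -
    have fin: "finite {x. bar_boundary G (push c) x}"
      using chain by (intro finite_bar_boundary) (simp add: bar_chains_def)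
    have "pairing (\<lambda>x. x = y) d \<longleftrightarrow> d y" if "finite {x. d x}" for d :: "'a list \<Rightarrow> bool"
    proof -
      have "{x \<in> {x. d x}. x = y} = (if d y then {y} else {})" by auto
      then show ?thesis by (simp add: pairing_def parity_def)
    qed
    \<comment> \<open>The boundary is evaluated at \<open>y\<close> by pairing with the indicator of
      \<open>y\<close>; adjointness moves the question to \<open>K\<close>, where
      \<open>stokes\<close> applies.\<close>
    from this[OF fin] have "bar_boundary G (push c) y \<longleftrightarrow> pairing (bar_coboundary G 1 (\<lambda>x. x = y)) (push c)"
      using pairing_boundary[OF chain] by simp
    also have "\<dots> \<longleftrightarrow> parity c (\<lambda>s. bar_coboundary G 1 (\<lambda>x. x = y) (cell s))" by (rule pairing_push[OF finc])
    also have "\<dots> \<longleftrightarrow> parity c (\<lambda>s. parity (edges_of s) (\<lambda>e. [elabel e] = y))"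
      by (rule parity_cong[OF refl], rule coboundary_cell) (use cT in blast)
    also have "\<dots> \<longleftrightarrow> False" using stokes[OF c finite_triangles] by (simp add: triangles_def)
    finally show ?thesis .
  qed
  then show ?thesis using chain by (auto simp: cycles_def numeral_2_eq_2)
qed

end

section \<open>Minimal detecting sets of triangles\<close>

context retract_labels
begin

definition minimal :: "nat set set \<Rightarrow> bool" where
  "minimal L \<longleftrightarrow> L \<subseteq> triangles \<and> detects L \<and> (\<forall>s\<in>L. \<not> detects (L - {s}))"

lemma ex_minimal: "\<exists>L. minimal L"
proof -
  let ?A = "{L \<in> Pow triangles. detects L}"
  have A: "finite ?A" "?A \<noteq> {}" using finite_triangles detects_triangles by auto
  obtain L where L: "L \<in> ?A" "\<forall>M\<in>?A. M \<subseteq> L \<longrightarrow> L = M"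
    using finite_has_minimal[OF A] by (elim bexE)
  have "\<not> detects (L - {s})" if s: "s \<in> L" for s
  proof
    assume "detects (L - {s})"
    then have "L - {s} \<in> ?A" using L(1) by auto
    then have "L = L - {s}" using L(2) by blast
    then show False using s by blast
  qed
  then show ?thesis using L(1) unfolding minimal_def by blast
qed

end

locale minimal_detecting = retract_labels G K g v0 \<gamma> for G (structure) and K g v0 \<gamma> +
  fixes L :: "nat set set"
  assumes minimal: "minimal L"
begin

lemma L_triangles: "L \<subseteq> triangles" and L_detects: "detects L" and L_minimal: "s \<in> L \<Longrightarrow> \<not> detects (L - {s})"
  using minimal by (auto simp: minimal_def)

lemma finite_L: "finite L"
  using finite_subset[OF L_triangles finite_triangles] .

lemma card_L: "s \<in> L \<Longrightarrow> card s = 3"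
  using L_triangles by (auto simp: triangles_def)

lemma finite_cycle: "c \<in> cycles2 L \<Longrightarrow> finite c"
  using finite_L by (auto simp: cycles2_def finite_subset)

lemma cycles2_triangles: "c \<in> cycles2 L \<Longrightarrow> c \<in> cycles2 triangles"
  using L_triangles by (auto simp: cycles2_def)

definition edges :: "nat set set" where
  "edges = (\<Union>s\<in>L. edges_of s)"

lemma finite_edges: "finite edges"
  unfolding edges_def using finite_L card_L by (auto intro!: finite_edges_of simp: card_ge_0_finite)

text \<open>A triangle with a free edge lies in no 2-cycle, so dropping it changes neither the
  cycles nor what they detect, against minimality.\<close>

lemma edge_in_two_triangles:
  assumes s: "s \<in> L" and e: "e \<in> edges_of s"
  shows "\<exists>t\<in>L. t \<noteq> s \<and> e \<subseteq> t"
proof (rule ccontr)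
  assume only: "\<not> ?thesis"
  have "c \<subseteq> L - {s}" if c: "c \<in> cycles2 L" for c
  proof (rule ccontr)
    assume "\<not> c \<subseteq> L - {s}"
    then have "s \<in> c" "c \<subseteq> L" using c by (auto simp: cycles2_def)
    then have "{t \<in> c. e \<subseteq> t} = {s}" using only e by (auto simp: edges_of_def)
    then have "parity c (\<lambda>t. e \<subseteq> t)" by (simp add: parity_def)
    then show False using c e by (auto simp: cycles2_def edges_of_def)
  qed
  then have "cycles2 L = cycles2 (L - {s})" by (auto simp: cycles2_def)
  then have "detects (L - {s})" using L_detects by (simp add: detects_def)
  then show False using L_minimal[OF s] by blast
qed

lemma push_not_boundary:
  assumes c: "c \<in> cycles2 L" "c \<noteq> {}"
  shows "push c \<notin> boundaries G 2"
proof
  assume b: "push c \<in> boundaries G 2"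
  obtain s where s: "s \<in> c" using c by blast
  then have sL: "s \<in> L" using c by (auto simp: cycles2_def)
  have "detects (L - {s})" unfolding detects_def
  proof (intro ballI impI)
    fix f assume f: "f \<in> cocycles G 2" and van: "\<forall>d\<in>cycles2 (L - {s}). \<not> parity d (\<lambda>s. f (cell s))"
    have fc: "\<not> parity c (\<lambda>s. f (cell s))"
      using cocycle_boundary[OF f b] pairing_push[OF finite_cycle[OF c(1)]] by simp
    show "f \<in> coboundaries G 2"
    proof (rule detectsD[OF L_detects f])
      fix d assume d: "d \<in> cycles2 L"
      show "\<not> parity d (\<lambda>s. f (cell s))"
      proof (cases "s \<in> d")
        case True
        have "sym_diff d c \<in> cycles2 L" by (rule cycles2_sym_diff[OF d c(1) finite_L])
        then have "sym_diff d c \<in> cycles2 (L - {s})" using True s by (auto simp: cycles2_def)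
        then have "\<not> parity (sym_diff d c) (\<lambda>s. f (cell s))" using van by blast
        then show ?thesis using parity_sym_diff[OF finite_cycle[OF d] finite_cycle[OF c(1)]] fc by blast
      next
        case False
        then have "d \<in> cycles2 (L - {s})" using d by (auto simp: cycles2_def)
        then show ?thesis using van by blast
      qed
    qed
  qed
  then show False using L_minimal[OF sL] by blast
qed

text \<open>By \<open>push_not_boundary\<close> the 2-cycles of \<open>L\<close> inject into the
  second homology of \<open>G\<close>; a basis \<open>C\<close> of them becomes an independent set
  of bar cycles.\<close>

lemma card_cycles2: "card (cycles2 L) \<le> 2 ^ homology_dim G 2"
proof -
  have finZ: "finite (cycles2 L)"
    by (rule finite_subset[of _ "Pow L"]) (auto simp: cycles2_def finite_L)
  obtain C where C': "C \<subseteq> cycles2 L" "\<forall>U. U \<subseteq> C \<and> U \<noteq> {} \<longrightarrow> set_sum U \<noteq> {}"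
    "card (cycles2 L) \<le> 2 ^ card C"
    using ex_spanning_independent[OF finZ] by (elim exE conjE)
  have C: "C \<subseteq> cycles2 L" "\<And>U. U \<subseteq> C \<Longrightarrow> U \<noteq> {} \<Longrightarrow> set_sum U \<noteq> {}"
    "card (cycles2 L) \<le> 2 ^ card C"
    using C' by simp_all
  have finC: "finite C" using C(1) finZ finite_subset by blast
  have sum_cycle: "set_sum U \<in> cycles2 L" if "U \<subseteq> C" for U
    using finite_subset[OF that finC] that
  proof (induction U rule: finite_induct)
    case empty
    then show ?case by (simp add: set_sum_def cycles2_def)
  next
    case (insert c U)
    have "set_sum (insert c U) = sym_diff c (set_sum U)" using insert by (auto simp: set_sum_def)
    then show ?case using insert C(1) cycles2_sym_diff[OF _ _ finite_L, of c "set_sum U"] by auto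
  qed
  have push_sum: "push (set_sum U) y \<longleftrightarrow> parity U (\<lambda>c. push c y)" if "U \<subseteq> C" for U y
    using finite_subset[OF that finC] that
  proof (induction U rule: finite_induct)
    case empty
    then show ?case by (simp add: set_sum_def push_def)
  next
    case (insert c U)
    have "set_sum (insert c U) = sym_diff c (set_sum U)" using insert by (auto simp: set_sum_def)
    moreover have "finite c" "finite (set_sum U)"
      using insert C(1) finite_cycle sum_cycle[of U] by auto
    ultimately show ?case using insert by (simp add: push_def parity_sym_diff)
  qed
  \<comment> \<open>Independence is a property of sets of chains, so distinct members of
    \<open>C\<close> must stay distinct: if two were identified, their nonempty sum would be pushed
    to zero.\<close>
  have inj: "inj_on push C"
  proof (rule inj_onI, rule ccontr)
    fix c d assume cd: "c \<in> C" "d \<in> C" "push c = push d" "c \<noteq> d"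
    have ne: "set_sum {c, d} \<noteq> {}" "set_sum {c, d} \<in> cycles2 L" using C(2)[of "{c, d}"] sum_cycle[of "{c, d}"] cd by auto
    have "push (set_sum {c, d}) y \<longleftrightarrow> False" for y
      using push_sum[of "{c, d}" y] cd by simp
    then have "push (set_sum {c, d}) = (\<lambda>_. False)" by (rule ext)
    then show False using push_not_boundary[OF ne(2,1)] xor_closed_boundaries[of G 2] by (simp add: xor_closed_def)
  qed
  have "independent_mod (cycles G 2) (boundaries G 2) (push ` C)"
    unfolding independent_mod_def
  proof (intro conjI allI impI)
    show "push ` C \<subseteq> cycles G 2" using push_cycle cycles2_triangles C(1) by blast
    show "finite (push ` C)" using finC by simp
    fix V assume V: "V \<subseteq> push ` C \<and> V \<noteq> {}"
    then obtain U where U: "U \<subseteq> C" "V = push ` U" by (meson subset_imageE)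
    have "f2_sum V y \<longleftrightarrow> push (set_sum U) y" for y
    proof -
      have "{c \<in> push ` U. c y} = push ` {c \<in> U. push c y}" by auto
      moreover have "inj_on push {c \<in> U. push c y}" by (rule inj_on_subset[OF inj]) (use U(1) in auto)
      ultimately have "card {c \<in> push ` U. c y} = card {c \<in> U. push c y}" by (simp add: card_image)
      then show ?thesis unfolding push_sum[OF U(1)] U(2) f2_sum_def parity_def by simp
    qed
    then have "f2_sum V = push (set_sum U)" by (rule ext)
    moreover have "U \<noteq> {}" using U V by blast
    ultimately show "f2_sum V \<notin> boundaries G 2"
      using push_not_boundary[OF sum_cycle[OF U(1)] C(2)[OF U(1)]] by simp
  qed
  then have "card (push ` C) \<le> homology_dim G 2"
    unfolding homology_dim_def using f2_quotient_dim(2)[OF independent_bound_2] by blast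
  then have "card C \<le> homology_dim G 2" by (simp add: card_image[OF inj])
  then show ?thesis using C(3) by (meson le_trans one_le_numeral power_increasing)
qed

text \<open>The place where property (A) enters. A class that dies on \<open>L\<close> has all its
  cup products dying on \<open>L\<close>, and \<open>L\<close> detects the second cohomology of
  \<open>G\<close>.\<close>

lemma cocycle_not_cut:
  assumes A: "property_A G" and \<alpha>: "\<alpha> \<in> cocycles G 1" "\<alpha> \<notin> coboundaries G 1"
  shows "\<exists>e\<in>edges. \<alpha> [elabel e] \<noteq> parity e (\<lambda>v. v \<in> u)"
proof (rule ccontr)
  assume "\<not> ?thesis"
  then have cut: "\<And>e. e \<in> edges \<Longrightarrow> \<alpha> [elabel e] \<longleftrightarrow> parity e (\<lambda>v. v \<in> u)" by blast
  obtain \<beta> where \<beta>: "\<beta> \<in> cocycles G 1" "cup11 G \<alpha> \<beta> \<notin> coboundaries G 2"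
    using A \<alpha> unfolding property_A_def by blast
  have "\<not> (\<forall>c\<in>cycles2 L. \<not> parity c (\<lambda>s. cup11 G \<alpha> \<beta> (cell s)))"
    using \<beta>(2) detectsD[OF L_detects cup11_cocycle[OF is_group \<alpha>(1) \<beta>(1)]] by blast
  then obtain c where c: "c \<in> cycles2 L" "parity c (\<lambda>s. cup11 G \<alpha> \<beta> (cell s))" by blast
  \<comment> \<open>The cup product of the 0-cochain \<open>u\<close> with \<open>\<beta>\<close>:
    the first factor is evaluated at the smaller vertex, matching the vertex order used in
    \<open>cell\<close>.\<close>
  define h where "h e \<longleftrightarrow> Min e \<in> u \<and> \<beta> [elabel e]" for e
  have "cup11 G \<alpha> \<beta> (cell s) \<longleftrightarrow> parity (edges_of s) h" if s: "s \<in> L" for s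
  proof -
    have "s \<in> triangles" using s L_triangles by blast
    then obtain a b c where t: "a < b" "b < c" "s = {a, b, c}" "cell s = [g a b, g b c]"
      "g a b \<in> carrier G" "g b c \<in> carrier G" "g a c = g a b \<otimes> g b c"
      "\<And>h. parity (edges_of s) h \<longleftrightarrow> (h {a, b} \<noteq> (h {b, c} \<noteq> h {a, c}))"
      "elabel {a, b} = g a b" "elabel {b, c} = g b c" "elabel {a, c} = g a c"
      using triangleE by metis
    have "{a, b} \<in> edges" using s edges_of_triangle(1)[OF t(1-3)] unfolding edges_def by blast
    then have "\<alpha> [g a b] \<longleftrightarrow> (a \<in> u) \<noteq> (b \<in> u)" using cut t(1,9) by fastforce
    moreover have "h {a, b} \<longleftrightarrow> a \<in> u \<and> \<beta> [g a b]" "h {b, c} \<longleftrightarrow> b \<in> u \<and> \<beta> [g b c]"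
      "h {a, c} \<longleftrightarrow> a \<in> u \<and> (\<beta> [g a b] \<noteq> \<beta> [g b c])"
      using t cocycles1_mult[OF \<beta>(1) t(5,6)] by (auto simp: h_def)
    moreover have "cup11 G \<alpha> \<beta> (cell s) \<longleftrightarrow> \<alpha> [g a b] \<and> \<beta> [g b c]"
      using t(4,5,6) by (simp add: cup11_def)
    ultimately show ?thesis unfolding t(8) by argo
  qed
  then have "parity c (\<lambda>s. cup11 G \<alpha> \<beta> (cell s)) \<longleftrightarrow> parity c (\<lambda>s. parity (edges_of s) h)"
    using c(1) by (intro parity_cong) (auto simp: cycles2_def)
  then show False using c(2) stokes[OF c(1) finite_L card_L] by blast
qed

definition cocycles1 :: "nat set set set" where
  "cocycles1 = {A. A \<subseteq> edges \<and> (\<forall>s\<in>L. \<not> parity A (\<lambda>e. e \<subseteq> s))}"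

lemma parity_edges: "s \<in> L \<Longrightarrow> A \<subseteq> edges \<Longrightarrow> parity A (\<lambda>e. e \<subseteq> s) \<longleftrightarrow> parity (edges_of s) (\<lambda>e. e \<in> A)"
  unfolding parity_def
  by (rule arg_cong[where f = "\<lambda>S. odd (card S)"]) (auto simp: edges_of_def edges_def)

text \<open>Dual cocycles of \<open>G\<close> and cuts together inject into the 1-cocycles of
  \<open>L\<close>: a coincidence would make a nontrivial class of \<open>G\<close> a cut on
  \<open>L\<close>, which \<open>cocycle_not_cut\<close> forbids.\<close>

lemma homology_class_count:
  assumes A: "property_A G"
  shows "2 ^ homology_dim G 1 * card (cut edges ` Pow (\<Union>L)) \<le> card cocycles1"
proof -
  obtain S where S: "independent_mod (cycles G 1) (boundaries G 1) S" "card S = homology_dim G 1"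
    using f2_quotient_dim(1)[OF independent_bound_1] unfolding homology_dim_def by blast
  obtain f where f: "\<And>s. s \<in> S \<Longrightarrow> f s \<in> cocycles G 1"
    "\<And>U. U \<subseteq> S \<Longrightarrow> U \<noteq> {} \<Longrightarrow> (\<lambda>x. parity U (\<lambda>s. f s x)) \<in> cocycles G 1 - coboundaries G 1"
    using ex_dual_cocycles[OF is_group, of 0 S] S(1) unfolding One_nat_def[symmetric] by metis
  have finS: "finite S" using S by (simp add: independent_mod_def)
  define F where "F U x \<longleftrightarrow> parity U (\<lambda>s. f s x)" for U x
  have F1: "F U \<in> cocycles G 1" if U: "U \<subseteq> S" for U
  proof (cases "U = {}")
    case True
    have "bar_coboundary G 1 (\<lambda>_. False) = (\<lambda>_. False)" by (rule ext) (simp add: bar_coboundary_parity)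
    then show ?thesis using True by (simp add: F_def[abs_def] cocycles_def bar_cochains_def)
  next
    case False
    then show ?thesis using f(2)[OF U] by (simp add: F_def[abs_def])
  qed
  \<comment> \<open>The sum of a cocycle of \<open>G\<close> restricted to \<open>L\<close> and a
    coboundary of \<open>L\<close>.\<close>
  define m where "m = (\<lambda>(U, d). {e \<in> edges. F U [elabel e] \<noteq> (e \<in> d)})"
  have tri: "\<not> parity (edges_of s) (\<lambda>e. F U [elabel e] \<noteq> (e \<in> cut edges u))" if s: "s \<in> L" and U: "U \<subseteq> S" for s U u
  proof -
    have "s \<in> triangles" using s L_triangles by blast
    then obtain a b c where t: "a < b" "b < c" "s = {a, b, c}" "cell s = [g a b, g b c]"
      "g a b \<in> carrier G" "g b c \<in> carrier G" "g a c = g a b \<otimes> g b c"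
      "\<And>h. parity (edges_of s) h \<longleftrightarrow> (h {a, b} \<noteq> (h {b, c} \<noteq> h {a, c}))"
      "elabel {a, b} = g a b" "elabel {b, c} = g b c" "elabel {a, c} = g a c"
      using triangleE by metis
    have "{a, b} \<in> edges" "{b, c} \<in> edges" "{a, c} \<in> edges"
      using s edges_of_triangle(1)[OF t(1-3)] unfolding edges_def by blast+
    then have "{a, b} \<in> cut edges u \<longleftrightarrow> (a \<in> u) \<noteq> (b \<in> u)" "{b, c} \<in> cut edges u \<longleftrightarrow> (b \<in> u) \<noteq> (c \<in> u)"
      "{a, c} \<in> cut edges u \<longleftrightarrow> (a \<in> u) \<noteq> (c \<in> u)"
      using t(1,2) parity_doubleton[of a b] parity_doubleton[of b c] parity_doubleton[of a c]
      by (auto simp: cut_def)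
    then show ?thesis unfolding t(8) t(9-11) t(7) cocycles1_mult[OF F1[OF U] t(5,6)] by argo
  qed
  have "m ` (Pow S \<times> cut edges ` Pow (\<Union>L)) \<subseteq> cocycles1"
  proof clarify
    fix U u assume U: "U \<subseteq> S"
    have "parity (m (U, cut edges u)) (\<lambda>e. e \<subseteq> s) \<longleftrightarrow> parity (edges_of s) (\<lambda>e. F U [elabel e] \<noteq> (e \<in> cut edges u))"
      if s: "s \<in> L" for s
    proof -
      have "parity (m (U, cut edges u)) (\<lambda>e. e \<subseteq> s) \<longleftrightarrow> parity (edges_of s) (\<lambda>e. e \<in> m (U, cut edges u))"
        by (rule parity_edges[OF s]) (auto simp: m_def)
      also have "\<dots> \<longleftrightarrow> parity (edges_of s) (\<lambda>e. F U [elabel e] \<noteq> (e \<in> cut edges u))"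
        by (rule parity_cong[OF refl]) (use s in \<open>auto simp: m_def edges_def\<close>)
      finally show ?thesis .
    qed
    then show "m (U, cut edges u) \<in> cocycles1" using tri[OF _ U] by (auto simp: cocycles1_def m_def)
  qed
  moreover have "inj_on m (Pow S \<times> cut edges ` Pow (\<Union>L))"
  proof (rule inj_onI)
    fix x y assume x: "x \<in> Pow S \<times> cut edges ` Pow (\<Union>L)" and y: "y \<in> Pow S \<times> cut edges ` Pow (\<Union>L)" and eq: "m x = m y"
    obtain U u where xU: "x = (U, cut edges u)" "U \<subseteq> S" using x by (cases x) auto
    obtain V v where yV: "y = (V, cut edges v)" "V \<subseteq> S" using y by (cases y) auto
    have e: "(F U [elabel e] \<noteq> (e \<in> cut edges u)) \<longleftrightarrow> (F V [elabel e] \<noteq> (e \<in> cut edges v))" if "e \<in> edges" for e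
      using eq that unfolding xU(1) yV(1) m_def by auto
    have fin: "finite U" "finite V" using xU(2) yV(2) by (auto intro: finite_subset[OF _ finS])
    have UV: "U = V"
    proof (rule ccontr)
      assume "U \<noteq> V"
      then have W: "sym_diff U V \<subseteq> S" "sym_diff U V \<noteq> {}" using xU yV by auto
      have FW: "F (sym_diff U V) z \<longleftrightarrow> (F U z \<noteq> F V z)" for z
        unfolding F_def by (rule parity_sym_diff[OF fin])
      have "F (sym_diff U V) \<in> cocycles G 1" "F (sym_diff U V) \<notin> coboundaries G 1"
        using f(2)[OF W] by (auto simp: F_def[abs_def])
      from cocycle_not_cut[OF A this, of "sym_diff u v"] obtain d where d: "d \<in> edges"
        "F (sym_diff U V) [elabel d] \<noteq> parity d (\<lambda>x. x \<in> sym_diff u v)" by blast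
      have "finite d" using d(1) card_L by (auto simp: edges_def edges_of_def card_ge_0_finite)
      have "parity d (\<lambda>x. x \<in> sym_diff u v) \<longleftrightarrow> parity d (\<lambda>x. (x \<in> u) \<noteq> (x \<in> v))"
        by (rule parity_cong) auto
      also have "\<dots> \<longleftrightarrow> (d \<in> cut edges u) \<noteq> (d \<in> cut edges v)"
        using d(1) parity_xor[OF \<open>finite d\<close>, of "\<lambda>x. x \<in> u" "\<lambda>x. x \<in> v"] by (simp add: cut_def)
      finally show False using d(2) FW e[OF d(1)] by blast
    qed
    have "d \<in> cut edges u \<longleftrightarrow> d \<in> cut edges v" for d
      using e[of d] UV by (cases "d \<in> edges") (auto simp: cut_def)
    then show "x = y" using xU yV UV by blast
  qed
  moreover have "finite cocycles1"
    by (rule finite_subset[of _ "Pow edges"]) (auto simp: cocycles1_def finite_edges)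
  ultimately have "card (Pow S \<times> cut edges ` Pow (\<Union>L)) \<le> card cocycles1" by (intro card_inj_on_le)
  then show ?thesis using S(2) finS by (simp add: card_cartesian_product card_Pow)
qed

lemma cycles2_edges: "cycles2 L = {c. c \<subseteq> L \<and> (\<forall>e\<in>edges. \<not> parity c (\<lambda>s. e \<subseteq> s))}"
proof (intro equalityI subsetI CollectI conjI)
  fix c assume "c \<in> {c. c \<subseteq> L \<and> (\<forall>e\<in>edges. \<not> parity c (\<lambda>s. e \<subseteq> s))}"
  then have c: "c \<subseteq> L" "\<forall>e\<in>edges. \<not> parity c (\<lambda>s. e \<subseteq> s)" by auto
  have "\<not> parity c (\<lambda>s. e \<subseteq> s)" if e: "card e = 2" for e
  proof (cases "e \<in> edges")
    case False
    then have empty: "{s \<in> c. e \<subseteq> s} = {}" using c(1) e by (auto simp: edges_def edges_of_def)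
    show ?thesis unfolding parity_def empty by simp
  qed (use c in blast)
  then show "c \<in> cycles2 L" using c by (simp add: cycles2_def)
qed (auto simp: cycles2_def edges_def edges_of_def)

lemma double_count: "2 * card edges \<le> 3 * card L"
proof -
  have two: "2 \<le> card {s \<in> L. e \<subseteq> s}" if e: "e \<in> edges" for e
  proof -
    obtain s where s: "s \<in> L" "e \<in> edges_of s" using e by (auto simp: edges_def)
    then obtain t where t: "t \<in> L" "t \<noteq> s" "e \<subseteq> t" using edge_in_two_triangles by blast
    have "{s, t} \<subseteq> {s \<in> L. e \<subseteq> s}" using s t by (auto simp: edges_of_def)
    then have "card {s, t} \<le> card {s \<in> L. e \<subseteq> s}" using finite_L by (intro card_mono) auto
    then show ?thesis using t(2) by simp
  qed
  have "(\<Sum>e\<in>edges. 2) \<le> (\<Sum>e\<in>edges. card {s \<in> L. e \<subseteq> s})" by (rule sum_mono) (rule two)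
  also have "\<dots> = (\<Sum>e\<in>edges. \<Sum>s\<in>L. if e \<subseteq> s then 1 else 0)"
    unfolding card_eq_sum using finite_L by (simp only: sum.inter_filter)
  also have "\<dots> = (\<Sum>s\<in>L. \<Sum>e\<in>edges. if e \<subseteq> s then 1 else 0)" by (rule sum.swap)
  also have "\<dots> = (\<Sum>s\<in>L. card {e \<in> edges. e \<subseteq> s})"
    unfolding card_eq_sum using finite_edges by (simp only: sum.inter_filter)
  also have "\<dots> = (\<Sum>s\<in>L. 3)"
  proof (rule sum.cong[OF refl])
    fix s assume s: "s \<in> L"
    have "{e \<in> edges. e \<subseteq> s} = edges_of s" using s by (auto simp: edges_def edges_of_def)
    then show "card {e \<in> edges. e \<subseteq> s} = 3" using card_edges_of[OF card_L[OF s]] by simp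
  qed
  finally show ?thesis by simp
qed

text \<open>A triangle and a second one across one of its edges already have five edges. This is
  what rules out the small root in \<open>heawood_bound\<close>.\<close>

lemma five_edges:
  assumes "L \<noteq> {}"
  shows "5 \<le> card edges"
proof -
  obtain s where s: "s \<in> L" using assms by blast
  obtain a b c where abc: "a < b" "b < c" "s = {a, b, c}" using triangle_sorted[OF card_L[OF s]] by metis
  have "{a, b} \<in> edges_of s" using edges_of_triangle(1)[OF abc] by blast
  then obtain t where t: "t \<in> L" "t \<noteq> s" "{a, b} \<subseteq> t" using edge_in_two_triangles[OF s] by blast
  have "card (t - {a, b}) = 1" using t card_L[OF t(1)] abc by (subst card_Diff_subset) auto
  then obtain d where "t - {a, b} = {d}" by (auto simp: card_1_singleton_iff)
  then have d: "t = {a, b, d}" "d \<noteq> a" "d \<noteq> b" using t(3) by auto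
  have "d \<noteq> c" using d(1) abc(3) t(2) by auto
  have ds: "d \<notin> s" using d \<open>d \<noteq> c\<close> abc(3) by simp
  have "{a, d} \<in> edges_of t" "{b, d} \<in> edges_of t" using d by (simp_all add: edges_of_def)
  then have sub: "edges_of s \<union> {{a, d}, {b, d}} \<subseteq> edges" using s t(1) unfolding edges_def by blast
  have "edges_of s \<inter> {{a, d}, {b, d}} = {}" using ds by (simp add: edges_of_def)
  moreover have "finite (edges_of s)" using card_edges_of[OF card_L[OF s]] by (simp add: card_ge_0_finite)
  moreover have "card {{a, d}, {b, d}} = 2" using abc(1) by (simp add: doubleton_eq_iff)
  ultimately have "card (edges_of s \<union> {{a, d}, {b, d}}) = 3 + 2"
    using card_edges_of[OF card_L[OF s]] by (simp only: card_Un_disjoint finite.intros)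
  then show ?thesis using card_mono[OF finite_edges sub] by simp
qed

lemma L_nonempty:
  assumes "homology_dim G 2 > 0"
  shows "L \<noteq> {}"
proof
  assume L: "L = {}"
  obtain S where S: "independent_mod (cycles G 2) (boundaries G 2) S" "card S = homology_dim G 2"
    using f2_quotient_dim(1)[OF independent_bound_2] unfolding homology_dim_def by blast
  then have "S \<noteq> {}" using assms by auto
  obtain f where "\<And>U. U \<subseteq> S \<Longrightarrow> U \<noteq> {} \<Longrightarrow> (\<lambda>x. parity U (\<lambda>s. f s x)) \<in> cocycles G 2 - coboundaries G 2"
    using ex_dual_cocycles[OF is_group, of 1 S] S(1) unfolding Suc_1 by metis
  from this[OF subset_refl \<open>S \<noteq> {}\<close>] have F: "(\<lambda>x. parity S (\<lambda>s. f s x)) \<in> cocycles G 2"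
    "(\<lambda>x. parity S (\<lambda>s. f s x)) \<notin> coboundaries G 2" by auto
  have "\<not> parity c P" if "c \<in> cycles2 L" for c P using that L by (simp add: cycles2_def)
  then show False using detectsD[OF L_detects F(1)] F(2) by blast
qed

lemma triangle_count:
  assumes A: "property_A G" and H2: "homology_dim G 2 > 0"
  shows "2 * rho (chi2 G) - 2 * chi2 G \<le> int (card triangles)"
proof -
  let ?s1 = "card edges" and ?s2 = "card L" and ?b1 = "homology_dim G 1" and ?b2 = "homology_dim G 2"
  obtain r where r: "2 ^ r \<le> card (cut edges ` Pow (\<Union>L))" "2 * ?s1 \<le> r * (r + 1)"
  proof -
    have "finite (\<Union>L)" using finite_L card_L by (auto simp: card_ge_0_finite)
    moreover have "e \<subseteq> \<Union>L \<and> card e = 2" if "e \<in> edges" for e using that by (auto simp: edges_def edges_of_def)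
    ultimately show thesis using cut_rank[of "\<Union>L" edges] that by blast
  qed
  have "2 ^ ?b1 * 2 ^ r \<le> 2 ^ ?b1 * card (cut edges ` Pow (\<Union>L))" using r(1) by simp
  also have "\<dots> \<le> card cocycles1" by (rule homology_class_count[OF A])
  finally have "2 ^ ?b1 * 2 ^ r * 2 ^ ?s2 \<le> card cocycles1 * 2 ^ ?s2" by simp
  \<comment> \<open>Edges against triangles: the kernel on the edge side consists of the 1-cocycles
    of \<open>L\<close>, the one on the triangle side of its 2-cycles.\<close>
  also have "\<dots> = card (cycles2 L) * 2 ^ ?s1"
    unfolding cycles2_edges cocycles1_def by (rule card_kernel_duality[OF finite_edges finite_L])
  also have "\<dots> \<le> 2 ^ ?b2 * 2 ^ ?s1" using card_cycles2 by simp
  finally have "(2::nat) ^ (?b1 + r + ?s2) \<le> 2 ^ (?b2 + ?s1)" by (simp add: power_add)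
  then have count: "?b1 + r + ?s2 \<le> ?b2 + ?s1" by (rule power_le_imp_le_exp[rotated]) simp
  have "int (r + 1) - int ?s1 + int ?s2 \<le> chi2 G" using count by (simp add: chi2_def)
  moreover have "2 * ?s1 \<le> (r + 1) * (r + 1 - 1)" using r(2) by (simp add: mult.commute)
  ultimately have "2 * rho (chi2 G) - 2 * chi2 G \<le> int ?s2"
    using heawood_bound double_count five_edges[OF L_nonempty[OF H2]] by blast
  also have "\<dots> \<le> int (card triangles)" using card_mono[OF finite_triangles L_triangles] by simp
  finally show ?thesis .
qed

end

text \<open>The retraction kills \<open>T\<close>, its section is the inclusion of the free factor
  \<open>G\<close>; transported through the isomorphism they become the labels \<open>g\<close> and
  the loops \<open>\<gamma>\<close>.\<close>

lemma triangle_count_of_free_factor: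
  fixes G :: "('a, 'c) monoid_scheme" and T :: "('b, 'd) monoid_scheme"
  assumes G: "group G" and T: "group T" and A: "property_A G" and H2: "homology_dim G 2 > 0"
    and K: "simplicial_complex K" "{v0} \<in> K" and iso: "edge_path_group K v0 \<cong> free_product G T"
  shows "2 * rho (chi2 G) - 2 * chi2 G \<le> int (card {s \<in> K. card s = 3})"
proof -
  interpret fp: free_product_groups G T using G T by (simp add: free_product_groups_def)
  obtain \<tau> where "rooted_complex K v0 \<tau>" using ex_rooted_complex[OF K] by blast
  then interpret R: rooted_complex K v0 \<tau> .
  interpret C: labeled_complex R.\<pi> K R.canon by (rule R.labeled_canon)
  obtain \<Psi> where \<Psi>: "\<Psi> \<in> iso R.\<pi> fp.FP" using iso by (auto simp: is_iso_def)
  define \<Phi> where "\<Phi> = inv_into (carrier R.\<pi>) \<Psi>"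
  have \<Phi>: "\<Phi> \<in> iso fp.FP R.\<pi>" unfolding \<Phi>_def by (rule R.pi.iso_set_sym[OF \<Psi>])
  have \<Psi>\<Phi>: "\<Psi> (\<Phi> w) = w" if "w \<in> carrier fp.FP" for w
    using that \<Psi> by (auto simp: \<Phi>_def iso_def bij_betw_def f_inv_into_f)
  have triv: "(\<lambda>t. \<one>\<^bsub>G\<^esub>) \<in> hom T G" by (auto intro!: homI)
  have ident: "(\<lambda>x. x) \<in> hom G G" by (auto intro!: homI)
  obtain c where c: "c \<in> hom fp.FP G" "\<And>h. h \<in> carrier G \<Longrightarrow> c (fp.inl h) = h"
    using fp.FP_universal[OF G ident triv] by metis
  define P where "P x = c (\<Psi> x)" for x
  have P: "P \<in> hom R.\<pi> G"
    using hom_compose[OF iso_imp_homomorphism[OF \<Psi>] c(1)] by (simp add: P_def[abs_def] comp_def)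
  \<comment> \<open>Pushing \<open>canon\<close> forward along \<open>P\<close> makes the label of a
    loop the image of its class under the retraction.\<close>
  define g where "g u v = P (R.canon u v)" for u v
  define \<gamma> where "\<gamma> h = (SOME p. p \<in> edge_loops K v0 \<and> cls K p = \<Phi> (fp.inl h))" for h
  have inl: "fp.inl h \<in> carrier fp.FP" if "h \<in> carrier G" for h using hom_in_carrier[OF fp.inl_hom that] .
  have \<gamma>: "\<gamma> h \<in> edge_loops K v0 \<and> cls K (\<gamma> h) = \<Phi> (fp.inl h)" if h: "h \<in> carrier G" for h
  proof -
    have "\<Phi> (fp.inl h) \<in> carrier R.\<pi>" using hom_in_carrier[OF iso_imp_homomorphism[OF \<Phi>] inl[OF h]] .
    then have "\<exists>p. p \<in> edge_loops K v0 \<and> cls K p = \<Phi> (fp.inl h)"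
      by (auto simp: carrier_edge_path_group[OF K(1)])
    then show ?thesis unfolding \<gamma>_def by (rule someI_ex)
  qed
  have "labeling K G g" unfolding labeling_def
  proof (intro conjI allI impI)
    show "g u v \<in> carrier G" if "{u, v} \<in> K" for u v
      using hom_in_carrier[OF P] C.label_closed[OF that] by (simp add: g_def)
    fix u v w assume uvw: "{u, v, w} \<in> K"
    have "{u, v} \<in> K" "{v, w} \<in> K" by (rule simplicial_complex_subset[OF K(1) uvw]; auto)+
    then show "g u v \<otimes>\<^bsub>G\<^esub> g v w = g u w"
      using C.label_mult[OF uvw] hom_mult[OF P C.label_closed C.label_closed, of u v v w] by (simp add: g_def)
  qed
  then interpret g: labeled_complex G K g using K(1) by unfold_locales
  interpret r: retract_labels G K g v0 \<gamma>
  proof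
    fix h assume h: "h \<in> carrier G"
    show "\<gamma> h \<in> edge_loops K v0" using \<gamma>[OF h] by simp
    have "path_label G g (\<gamma> h) = P (path_label R.\<pi> R.canon (\<gamma> h))"
      by (rule path_label_hom[OF R.pi.is_group G P K(1) C.labeling])
        (use \<gamma>[OF h] in \<open>auto simp: edge_loops_def g_def\<close>)
    also have "\<dots> = P (\<Phi> (fp.inl h))" using R.path_label_canon_loop \<gamma>[OF h] by simp
    also have "\<dots> = h" using \<Psi>\<Phi>[OF inl[OF h]] c(2)[OF h] by (simp add: P_def)
    finally show "path_label G g (\<gamma> h) = h" .
  next
    fix h k assume hk: "h \<in> carrier G" "k \<in> carrier G"
    have "cls K (\<gamma> h @ tl (\<gamma> k)) = cls K (\<gamma> h) \<otimes>\<^bsub>R.\<pi>\<^esub> cls K (\<gamma> k)"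
      by (rule mult_edge_path_group[OF K(1), symmetric]) (use \<gamma> hk in auto)
    also have "\<dots> = \<Phi> (fp.inl h \<otimes>\<^bsub>fp.FP\<^esub> fp.inl k)"
      using hom_mult[OF iso_imp_homomorphism[OF \<Phi>] inl[OF hk(1)] inl[OF hk(2)]] \<gamma> hk by simp
    also have "fp.inl h \<otimes>\<^bsub>fp.FP\<^esub> fp.inl k = fp.inl (h \<otimes>\<^bsub>G\<^esub> k)"
      using hom_mult[OF fp.inl_hom hk] by simp
    also have "\<Phi> \<dots> = cls K (\<gamma> (h \<otimes>\<^bsub>G\<^esub> k))" using \<gamma> hk by simp
    finally show "hpt K (\<gamma> h @ tl (\<gamma> k)) (\<gamma> (h \<otimes>\<^bsub>G\<^esub> k))" by (simp only: cls_eq_iff)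
  qed
  obtain L where "r.minimal L" using r.ex_minimal by blast
  then interpret m: minimal_detecting G K g v0 \<gamma> L by unfold_locales
  show ?thesis using m.triangle_count[OF A H2] by (simp add: r.triangles_def)
qed

theorem theorem3p3:
  fixes G :: "('a, 'c) monoid_scheme" and T :: "('b, 'd) monoid_scheme"
  assumes "finitely_presentable G" and "finitely_presentable T"
    and "property_A G"
    and "chi2 G \<le> 2"
    and "homology_dim G 2 > 0"
  shows "int (simplicial_complexity (free_product G T)) \<ge> 2 * rho (chi2 G) - 2 * chi2 G"
proof -
  have groups: "group G" "group T" using assms(1,2) by (auto simp: finitely_presentable_def)
  let ?P = "\<lambda>n. \<exists>K v0. simplicial_complex K \<and> dimension_two K \<and> {v0} \<in> K \<and>
      card {s \<in> K. card s = 3} = n \<and> edge_path_group K v0 \<cong> free_product G T"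
  obtain n R x where "presents (free_product G T) n R x"
    using finitely_presentable_free_product[OF assms(1,2)] by blast
  then have "\<exists>n. ?P n" using ex_complex_of_presentation by blast
  then have "?P (simplicial_complexity (free_product G T))"
    unfolding simplicial_complexity_def by (rule LeastI_ex)
  then obtain K v0 where K: "simplicial_complex K" "{v0} \<in> K"
    and card: "card {s \<in> K. card s = 3} = simplicial_complexity (free_product G T)"
    and iso: "edge_path_group K v0 \<cong> free_product G T"
    by (elim exE conjE)
  show ?thesis
    using triangle_count_of_free_factor[OF groups assms(3,5) K iso] unfolding card .
qed

end
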